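(* Let $\mathcal A$ be an operator algebra of functions on the set $X$. Then there exist a Hilbert space $\mathfrak C$ and a positive definite function $K:X\times X\to B(\mathfrak C)$ such that $\mathcal M(K)=\tilde{\mathcal A}$ completely isometrically.
   Context: An (abstract, unital) operator algebra is a unital algebra with a norm on each matrix level satisfying the Blecher–Ruan–Sinclair (BRS) axioms: $\|LGM\|\le\|L\|\|G\|\|M\|$ for scalar matrices $L,M$; $\|G\oplus H\|=\max\{\|G\|,\|H\|\}$; $\|GH\|\le\|G\|\|H\|$; $\|1\|=1$. Completeness is not assumed. An operator algebra of functions on $X$ is a subalgebra $\mathcal A$ of the algebra of all complex-valued functions on $X$ which separates the points of $X$ and contains the constants, is equipped with norms on all $M_n(\mathcal A)$ satisfying the BRS axioms, and has every evaluation functional $f\mapsto f(x)$, $x\in X$, bounded. The BPW completion $\tilde{\mathcal A}$ is the set of functions $f:X\to\mathbb C$ that are pointwise limits on $X$ of norm-bounded nets in $\mathcal A$, with matrix norms $$\|(f_{ij})\|_{M_n(\tilde{\mathcal A})}=\inf\{C:\ \exists\text{ a net }(f^\lambda_{ij})\in M_n(\mathcal A),\ \|(f^\lambda_{ij})\|\le C\ \forall\lambda,\ (f^\lambda_{ij}(x))\to(f_{ij}(x))\ \forall x\in X\}.$$ A function $K:X\times X\to B(\mathfrak C)$ is positive definite if for every finite set of distinct points $x_1,\dots,x_k\in X$ the operator matrix $(K(x_i,x_j))$ is positive semidefinite on $\mathfrak C^{(k)}$. For such $K$ there is a unique Hilbert space $\mathcal L(K,\mathfrak C)$ of $\mathfrak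 C$-valued functions on $X$ with bounded evaluations $E_x$ satisfying $K(x,y)=E_xE_y^*$. $\mathcal M(K)$ is the algebra of multipliers, i.e. functions $f:X\to\mathbb C$ with $f\,\mathcal L(K,\mathfrak C)\subseteq\mathcal L(K,\mathfrak C)$, regarded via $f\mapsto M_f$ (multiplication by $f$) as a subalgebra of $B(\mathcal L(K,\mathfrak C))$ with the inherited matrix norms. "$\mathcal M(K)=\tilde{\mathcal A}$ completely isometrically" means that they are equal as algebras of functions on $X$ and that $\|(f_{ij})\|_{M_n(\tilde{\mathcal A})}=\|(M_{f_{ij}})\|$ for all $n$ and all $(f_{ij})\in M_n(\tilde{\mathcal A})$. *)

theory Defs
  imports
    Complex_Main
    "HOL-Library.Function_Algebras"
    "HOL-Library.Nonpos_Ints"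
    "Jordan_Normal_Form.Matrix"
begin

section \<open>Operator algebras of functions\<close>

text \<open>
  The set \<open>X\<close> is the universe of a type variable \<open>'x\<close>; functions on \<open>X\<close> are multiplied and added
  pointwise. There is no loss in \<open>X\<close> being nonempty: on the empty set \<open>1 = 0\<close>, so that the axiom
  \<open>\<parallel>1\<parallel> = 1\<close> fails.
\<close>

definition mats :: "nat \<Rightarrow> 'a set \<Rightarrow> 'a mat set" where
  "mats n A = {G \<in> carrier_mat n n. elements_mat G \<subseteq> A}"

definition euclidean_norm :: "complex vec \<Rightarrow> real" where
  "euclidean_norm v = sqrt (\<Sum>i<dim_vec v. (cmod (v $ i))\<^sup>2)"

definition scalar_mat_norm :: "complex mat \<Rightarrow> real" where
  "scalar_mat_norm L = Inf {c. 0 \<le> c \<and>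
     (\<forall>v\<in>carrier_vec (dim_col L). euclidean_norm (L *\<^sub>v v) \<le> c * euclidean_norm v)}"

definition constant_mat :: "complex mat \<Rightarrow> ('x \<Rightarrow> complex) mat" where
  "constant_mat L = map_mat (\<lambda>c x. c) L"

definition direct_sum_mat :: "'a::zero mat \<Rightarrow> 'a mat \<Rightarrow> 'a mat" (infixr \<open>\<oplus>\<^sub>d\<close> 65) where
  "G \<oplus>\<^sub>d H = four_block_mat G (0\<^sub>m (dim_row G) (dim_col H)) (0\<^sub>m (dim_row H) (dim_col G)) H"

definition mat_of_elem :: "'a \<Rightarrow> 'a mat" where
  "mat_of_elem f = mat 1 1 (\<lambda>_. f)"

text \<open>
  A single function \<open>nrm\<close> on square matrices carries the norms of all levels; its values on matrices
  with entries outside \<open>A\<close>, and on the empty matrix, are irrelevant.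
\<close>

locale operator_algebra_of_functions =
  fixes A :: "('x \<Rightarrow> complex) set"
    and nrm :: "('x \<Rightarrow> complex) mat \<Rightarrow> real"
  assumes const_mem: "(\<lambda>x. c) \<in> A"
    and add_mem: "f \<in> A \<Longrightarrow> g \<in> A \<Longrightarrow> f + g \<in> A"
    and mult_mem: "f \<in> A \<Longrightarrow> g \<in> A \<Longrightarrow> f * g \<in> A"
    and separates_points: "x \<noteq> y \<Longrightarrow> \<exists>f\<in>A. f x \<noteq> f y"
    and nrm_nonneg: "0 < n \<Longrightarrow> G \<in> mats n A \<Longrightarrow> 0 \<le> nrm G"
    and nrm_eq_0_iff: "0 < n \<Longrightarrow> G \<in> mats n A \<Longrightarrow> nrm G = 0 \<longleftrightarrow> G = 0\<^sub>m n n"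
    and nrm_triangle: "0 < n \<Longrightarrow> G \<in> mats n A \<Longrightarrow> H \<in> mats n A \<Longrightarrow> nrm (G + H) \<le> nrm G + nrm H"
    and nrm_scale: "0 < n \<Longrightarrow> G \<in> mats n A \<Longrightarrow> nrm ((\<lambda>x. c) \<cdot>\<^sub>m G) = cmod c * nrm G"
    and nrm_bimodule:
      "0 < m \<Longrightarrow> 0 < n \<Longrightarrow> L \<in> carrier_mat m n \<Longrightarrow> G \<in> mats n A \<Longrightarrow> M \<in> carrier_mat n m \<Longrightarrow>
       nrm (constant_mat L * G * constant_mat M) \<le> scalar_mat_norm L * nrm G * scalar_mat_norm M"
    and nrm_direct_sum:
      "0 < m \<Longrightarrow> 0 < n \<Longrightarrow> G \<in> mats m A \<Longrightarrow> H \<in> mats n A \<Longrightarrow> nrm (G \<oplus>\<^sub>d H) = max (nrm G) (nrm H)"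
    and nrm_mult: "0 < n \<Longrightarrow> G \<in> mats n A \<Longrightarrow> H \<in> mats n A \<Longrightarrow> nrm (G * H) \<le> nrm G * nrm H"
    and nrm_one: "nrm (mat_of_elem (\<lambda>x. 1)) = 1"
    and bounded_evaluations: "\<exists>c. \<forall>f\<in>A. cmod (f x) \<le> c * nrm (mat_of_elem f)"


section \<open>The BPW completion\<close>

definition directed_set :: "'i set \<Rightarrow> ('i \<Rightarrow> 'i \<Rightarrow> bool) \<Rightarrow> bool" where
  "directed_set I prec \<longleftrightarrow> I \<noteq> {} \<and> (\<forall>i\<in>I. prec i i) \<and>
     (\<forall>i\<in>I. \<forall>j\<in>I. \<forall>k\<in>I. prec i j \<longrightarrow> prec j k \<longrightarrow> prec i k) \<and>
     (\<forall>i\<in>I. \<forall>j\<in>I. \<exists>k\<in>I. prec i k \<and> prec j k)"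

definition net_tendsto :: "'i set \<Rightarrow> ('i \<Rightarrow> 'i \<Rightarrow> bool) \<Rightarrow> ('i \<Rightarrow> complex) \<Rightarrow> complex \<Rightarrow> bool" where
  "net_tendsto I prec a l \<longleftrightarrow> (\<forall>e>0. \<exists>i\<in>I. \<forall>j\<in>I. prec i j \<longrightarrow> dist (a j) l < e)"

definition bounded_approx_net ::
  "('x \<Rightarrow> complex) set \<Rightarrow> (('x \<Rightarrow> complex) mat \<Rightarrow> real) \<Rightarrow> ('x \<Rightarrow> complex) mat \<Rightarrow> real \<Rightarrow>
   'i set \<Rightarrow> ('i \<Rightarrow> 'i \<Rightarrow> bool) \<Rightarrow> ('i \<Rightarrow> ('x \<Rightarrow> complex) mat) \<Rightarrow> bool" where
  "bounded_approx_net A nrm F C I prec \<Phi> \<longleftrightarrow> directed_set I prec \<and>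
     (\<forall>i\<in>I. \<Phi> i \<in> mats (dim_row F) A \<and> nrm (\<Phi> i) \<le> C) \<and>
     (\<forall>j<dim_row F. \<forall>k<dim_row F. \<forall>x.
        net_tendsto I prec (\<lambda>i. (\<Phi> i $$ (j, k)) x) ((F $$ (j, k)) x))"

text \<open>
  HOL cannot quantify existentially over the type of the indices of a net. Restricting the index type
  to \<open>'x set \<times> nat\<close> loses no nets up to reindexing; see \<open>bounded_approx_net_reindex\<close> below.
\<close>

definition bpw_bounds ::
  "('x \<Rightarrow> complex) set \<Rightarrow> (('x \<Rightarrow> complex) mat \<Rightarrow> real) \<Rightarrow> ('x \<Rightarrow> complex) mat \<Rightarrow> real set" where
  "bpw_bounds A nrm F = {C. \<exists>(I :: ('x set \<times> nat) set) prec \<Phi>. bounded_approx_net A nrm F C I prec \<Phi>}"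

definition bpw_completion ::
  "('x \<Rightarrow> complex) set \<Rightarrow> (('x \<Rightarrow> complex) mat \<Rightarrow> real) \<Rightarrow> ('x \<Rightarrow> complex) set" where
  "bpw_completion A nrm = {f. \<exists>C. C \<in> bpw_bounds A nrm (mat_of_elem f)}"

definition bpw_norm ::
  "('x \<Rightarrow> complex) set \<Rightarrow> (('x \<Rightarrow> complex) mat \<Rightarrow> real) \<Rightarrow> ('x \<Rightarrow> complex) mat \<Rightarrow> real" where
  "bpw_norm A nrm F = Inf (bpw_bounds A nrm F)"

lemma directed_set_finite_upper_bound:
  assumes "directed_set I prec" "finite S" "S \<subseteq> I"
  shows "\<exists>k\<in>I. \<forall>i\<in>S. prec i k"
  using assms(2,3)
proof (induction S rule: finite_induct)
  case empty
  then show ?case using assms(1) unfolding directed_set_def by blast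
next
  case (insert i S)
  then obtain k where k: "k \<in> I" "\<forall>j\<in>S. prec j k" by auto
  have i: "i \<in> I" and S: "S \<subseteq> I" using insert.prems by auto
  have ub: "\<forall>i\<in>I. \<forall>j\<in>I. \<exists>k\<in>I. prec i k \<and> prec j k"
    and tr: "\<forall>i\<in>I. \<forall>j\<in>I. \<forall>k\<in>I. prec i j \<longrightarrow> prec j k \<longrightarrow> prec i k"
    using assms(1) unfolding directed_set_def by blast+
  obtain l where l: "l \<in> I" "prec i l" "prec k l" using ub i k(1) by blast
  have "\<forall>j\<in>S. prec j l" using tr k l S by blast
  with l show ?case by auto
qed

lemma bounded_approx_net_reindex:
  fixes A :: "('x \<Rightarrow> complex) set" and I :: "'i set"
  assumes net: "bounded_approx_net A nrm F C I prec \<Phi>"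
  shows "\<exists>(J :: ('x set \<times> nat) set) prec' \<Psi>. bounded_approx_net A nrm F C J prec' \<Psi>"
proof -
  let ?n = "dim_row F"
  define J :: "('x set \<times> nat) set" where "J = {p. finite (fst p)}"
  define prec' :: "'x set \<times> nat \<Rightarrow> 'x set \<times> nat \<Rightarrow> bool"
    where "prec' p q \<longleftrightarrow> fst p \<subseteq> fst q \<and> snd p \<le> snd q" for p q
  have dir: "directed_set I prec" using net by (simp add: bounded_approx_net_def)
  define close :: "nat \<Rightarrow> 'i \<Rightarrow> nat \<times> nat \<times> 'x \<Rightarrow> bool"
    where "close m i = (\<lambda>(j, k, x). dist ((\<Phi> i $$ (j, k)) x) ((F $$ (j, k)) x) < 1 / Suc m)" for m i
  have ex: "\<exists>i\<in>I. \<forall>t\<in>{..<?n} \<times> {..<?n} \<times> fst p. close (snd p) i t" if p: "p \<in> J" for p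
  proof -
    let ?S = "{..<?n} \<times> {..<?n} \<times> fst p"
    have fin: "finite ?S" using p by (simp add: J_def)
    have "\<forall>t\<in>?S. \<exists>i. i \<in> I \<and> (\<forall>l\<in>I. prec i l \<longrightarrow> close (snd p) l t)"
    proof
      fix t assume "t \<in> ?S"
      then obtain j k x where t: "t = (j, k, x)" "j < ?n" "k < ?n" by auto
      have "net_tendsto I prec (\<lambda>i. (\<Phi> i $$ (j, k)) x) ((F $$ (j, k)) x)"
        using net t by (simp add: bounded_approx_net_def)
      moreover have "0 < 1 / real (Suc (snd p))" by simp
      ultimately have "\<exists>i\<in>I. \<forall>l\<in>I. prec i l \<longrightarrow>
          dist ((\<Phi> l $$ (j, k)) x) ((F $$ (j, k)) x) < 1 / Suc (snd p)"
        unfolding net_tendsto_def by blast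
      then show "\<exists>i. i \<in> I \<and> (\<forall>l\<in>I. prec i l \<longrightarrow> close (snd p) l t)"
        unfolding close_def t(1) by (simp only: prod.case) blast
    qed
    from bchoice[OF this] obtain h
      where h: "\<forall>t\<in>?S. h t \<in> I \<and> (\<forall>l\<in>I. prec (h t) l \<longrightarrow> close (snd p) l t)" ..
    have "h ` ?S \<subseteq> I" using h by blast
    then obtain i where i: "i \<in> I" "\<forall>s\<in>h ` ?S. prec s i"
      using directed_set_finite_upper_bound[OF dir finite_imageI[OF fin]] by blast
    then have "\<forall>t\<in>?S. close (snd p) i t" using h by blast
    with i(1) show ?thesis by blast
  qed
  have "\<forall>p\<in>J. \<exists>i. i \<in> I \<and> (\<forall>t\<in>{..<?n} \<times> {..<?n} \<times> fst p. close (snd p) i t)"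
    using ex by blast
  from bchoice[OF this] obtain g where
    g: "\<forall>p\<in>J. g p \<in> I \<and> (\<forall>t\<in>{..<?n} \<times> {..<?n} \<times> fst p. close (snd p) (g p) t)" ..
  have dirJ: "directed_set J prec'"
    unfolding directed_set_def
  proof (intro conjI ballI impI)
    have "({}, 0) \<in> J" by (simp add: J_def)
    then show "J \<noteq> {}" by blast
  next
    fix p q assume pq: "p \<in> J" "q \<in> J"
    have "(fst p \<union> fst q, max (snd p) (snd q)) \<in> J" using pq by (simp add: J_def)
    then show "\<exists>r\<in>J. prec' p r \<and> prec' q r"
      by (rule bexI[rotated]) (auto simp: prec'_def)
  qed (auto simp: prec'_def)
  have conv: "net_tendsto J prec' (\<lambda>p. (\<Phi> (g p) $$ (j, k)) x) ((F $$ (j, k)) x)"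
    if jk: "j < ?n" "k < ?n" for j k x
    unfolding net_tendsto_def
  proof (intro allI impI)
    fix e :: real assume "e > 0"
    then obtain m where m: "1 / Suc m < e"
      using nat_approx_posE by blast
    have "dist ((\<Phi> (g q) $$ (j, k)) x) ((F $$ (j, k)) x) < e" if q: "q \<in> J" "prec' ({x}, m) q" for q
    proof -
      have "dist ((\<Phi> (g q) $$ (j, k)) x) ((F $$ (j, k)) x) < 1 / Suc (snd q)"
        using bspec[OF g q(1)] q(2) jk by (auto simp: close_def prec'_def)
      also have "\<dots> \<le> 1 / Suc m" using q(2) by (simp add: prec'_def frac_le)
      finally show ?thesis using m by simp
    qed
    then show "\<exists>p\<in>J. \<forall>q\<in>J. prec' p q \<longrightarrow> dist ((\<Phi> (g q) $$ (j, k)) x) ((F $$ (j, k)) x) < e"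
      by (intro bexI[of _ "({x}, m)"]) (auto simp: J_def)
  qed
  have "bounded_approx_net A nrm F C J prec' (\<lambda>p. \<Phi> (g p))"
    using net g dirJ conv by (simp add: bounded_approx_net_def)
  then show ?thesis by blast
qed


section \<open>Complex Hilbert spaces\<close>

class complex_vs = ab_group_add +
  fixes scaleC :: "complex \<Rightarrow> 'a \<Rightarrow> 'a" (infixr \<open>*\<^sub>C\<close> 75)
  assumes scaleC_add_right: "c *\<^sub>C (x + y) = c *\<^sub>C x + c *\<^sub>C y"
    and scaleC_add_left: "(c + d) *\<^sub>C x = c *\<^sub>C x + d *\<^sub>C x"
    and scaleC_scaleC: "c *\<^sub>C d *\<^sub>C x = (c * d) *\<^sub>C x"
    and scaleC_one: "1 *\<^sub>C x = x"

instantiation complex :: complex_vs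
begin
definition scaleC_complex :: "complex \<Rightarrow> complex \<Rightarrow> complex" where
  "scaleC_complex c z = c * z"
instance by standard (simp_all add: scaleC_complex_def algebra_simps)
end

instantiation "fun" :: (type, complex_vs) complex_vs
begin
definition scaleC_fun :: "complex \<Rightarrow> ('a \<Rightarrow> 'b) \<Rightarrow> 'a \<Rightarrow> 'b" where
  "scaleC_fun c f = (\<lambda>x. c *\<^sub>C f x)"
instance
  by standard
    (simp_all add: scaleC_fun_def fun_eq_iff scaleC_add_right scaleC_add_left scaleC_scaleC scaleC_one)
end

definition hnorm :: "('v \<Rightarrow> 'v \<Rightarrow> complex) \<Rightarrow> 'v \<Rightarrow> real" where
  "hnorm ip v = sqrt (Re (ip v v))"

text \<open>
  A Hilbert space is a linear subspace \<open>H\<close> of an ambient complex vector space together with an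
  inner product (linear in the first argument), of which only the values on \<open>H\<close> matter.
  The ambient space \<open>('x \<Rightarrow> complex) \<Rightarrow> complex\<close> is large enough for the coefficient spaces of kernels on
  \<open>X\<close>: it contains \<open>\<ell>\<^sup>2(T)\<close> for every set \<open>T\<close> of functions on \<open>X\<close>.
\<close>

locale chilbert_space =
  fixes H :: "'v::complex_vs set" and ip :: "'v \<Rightarrow> 'v \<Rightarrow> complex"
  assumes zero_mem: "0 \<in> H"
    and add_mem: "u \<in> H \<Longrightarrow> v \<in> H \<Longrightarrow> u + v \<in> H"
    and scale_mem: "v \<in> H \<Longrightarrow> c *\<^sub>C v \<in> H"
    and ip_add_left: "u \<in> H \<Longrightarrow> v \<in> H \<Longrightarrow> w \<in> H \<Longrightarrow> ip (u + v) w = ip u w + ip v w"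
    and ip_scale_left: "v \<in> H \<Longrightarrow> w \<in> H \<Longrightarrow> ip (c *\<^sub>C v) w = c * ip v w"
    and ip_commute: "v \<in> H \<Longrightarrow> w \<in> H \<Longrightarrow> ip v w = cnj (ip w v)"
    and ip_nonneg: "v \<in> H \<Longrightarrow> 0 \<le> Re (ip v v)"
    and ip_eq_0: "v \<in> H \<Longrightarrow> ip v v = 0 \<Longrightarrow> v = 0"
    and complete:
      "(\<And>n. s n \<in> H) \<Longrightarrow> (\<And>e. 0 < e \<Longrightarrow> \<exists>N. \<forall>m\<ge>N. \<forall>n\<ge>N. hnorm ip (s m - s n) < e) \<Longrightarrow>
       \<exists>l\<in>H. (\<lambda>n. hnorm ip (s n - l)) \<longlonglongrightarrow> 0"

definition bounded_op ::
  "'v::complex_vs set \<Rightarrow> ('v \<Rightarrow> 'v \<Rightarrow> complex) \<Rightarrow> 'w::complex_vs set \<Rightarrow> ('w \<Rightarrow> 'w \<Rightarrow> complex) \<Rightarrow>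
   ('v \<Rightarrow> 'w) \<Rightarrow> bool" where
  "bounded_op H ip H' ip' T \<longleftrightarrow> (\<forall>v\<in>H. T v \<in> H') \<and>
     (\<forall>u\<in>H. \<forall>v\<in>H. T (u + v) = T u + T v) \<and>
     (\<forall>c. \<forall>v\<in>H. T (c *\<^sub>C v) = c *\<^sub>C T v) \<and>
     (\<exists>b. \<forall>v\<in>H. hnorm ip' (T v) \<le> b * hnorm ip v)"

definition is_adjoint ::
  "'v::complex_vs set \<Rightarrow> ('v \<Rightarrow> 'v \<Rightarrow> complex) \<Rightarrow> 'w::complex_vs set \<Rightarrow> ('w \<Rightarrow> 'w \<Rightarrow> complex) \<Rightarrow>
   ('v \<Rightarrow> 'w) \<Rightarrow> ('w \<Rightarrow> 'v) \<Rightarrow> bool" where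
  "is_adjoint H ip H' ip' T S \<longleftrightarrow> bounded_op H' ip' H ip S \<and>
     (\<forall>v\<in>H. \<forall>w\<in>H'. ip' (T v) w = ip v (S w))"

text \<open>Norm of an operator matrix acting between finite direct sums of copies of \<open>H\<close>.\<close>

definition op_mat_norm ::
  "'v::complex_vs set \<Rightarrow> ('v \<Rightarrow> 'v \<Rightarrow> complex) \<Rightarrow> ('v \<Rightarrow> 'v) mat \<Rightarrow> real" where
  "op_mat_norm H ip T = Inf {c. 0 \<le> c \<and> (\<forall>h. (\<forall>j<dim_col T. h j \<in> H) \<longrightarrow>
     sqrt (\<Sum>i<dim_row T. (hnorm ip (\<Sum>j<dim_col T. (T $$ (i, j)) (h j)))\<^sup>2)
       \<le> c * sqrt (\<Sum>j<dim_col T. (hnorm ip (h j))\<^sup>2))}"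


section \<open>Operator-valued kernels and multiplier algebras\<close>

text \<open>
  Positivity of the operator matrix \<open>(K x\<^sub>i x\<^sub>j)\<close> on \<open>C\<^sup>k\<close>: its quadratic form takes values in
  \<open>[0, \<infinity>)\<close>. The distinct points \<open>x\<^sub>1, \<dots>, x\<^sub>k\<close> form the finite set \<open>S\<close>, which also serves
  as index set.
\<close>

definition positive_definite_kernel ::
  "'c::complex_vs set \<Rightarrow> ('c \<Rightarrow> 'c \<Rightarrow> complex) \<Rightarrow> ('x \<Rightarrow> 'x \<Rightarrow> 'c \<Rightarrow> 'c) \<Rightarrow> bool" where
  "positive_definite_kernel C ip K \<longleftrightarrow> (\<forall>x y. bounded_op C ip C ip (K x y)) \<and>
     (\<forall>S v. finite S \<longrightarrow> (\<forall>x\<in>S. v x \<in> C) \<longrightarrow>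
        (\<Sum>x\<in>S. ip (\<Sum>y\<in>S. K x y (v y)) (v x)) \<in> \<real>\<^sub>\<ge>\<^sub>0)"

text \<open>
  \<open>L\<close> with inner product \<open>ipL\<close> is the space \<open>\<L>(K, C)\<close>: the evaluations \<open>E\<^sub>x\<close> are bounded and
  \<open>K x y = E\<^sub>x E\<^sub>y\<^sup>*\<close>.
\<close>

definition is_kernel_space ::
  "'c::complex_vs set \<Rightarrow> ('c \<Rightarrow> 'c \<Rightarrow> complex) \<Rightarrow> ('x \<Rightarrow> 'x \<Rightarrow> 'c \<Rightarrow> 'c) \<Rightarrow>
   ('x \<Rightarrow> 'c) set \<Rightarrow> (('x \<Rightarrow> 'c) \<Rightarrow> ('x \<Rightarrow> 'c) \<Rightarrow> complex) \<Rightarrow> bool" where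
  "is_kernel_space C ip K L ipL \<longleftrightarrow> chilbert_space L ipL \<and>
     (\<forall>x. bounded_op L ipL C ip (\<lambda>f. f x)) \<and>
     (\<forall>y. \<exists>S. is_adjoint L ipL C ip (\<lambda>f. f y) S \<and> (\<forall>x. \<forall>v\<in>C. K x y v = S v x))"

definition mult_op :: "('x \<Rightarrow> complex) \<Rightarrow> ('x \<Rightarrow> 'c::complex_vs) \<Rightarrow> 'x \<Rightarrow> 'c" where
  "mult_op f h = (\<lambda>x. f x *\<^sub>C h x)"

definition multipliers :: "('x \<Rightarrow> 'c::complex_vs) set \<Rightarrow> ('x \<Rightarrow> complex) set" where
  "multipliers L = {f. mult_op f ` L \<subseteq> L}"

definition multiplier_norm ::
  "('x \<Rightarrow> 'c::complex_vs) set \<Rightarrow> (('x \<Rightarrow> 'c) \<Rightarrow> ('x \<Rightarrow> 'c) \<Rightarrow> complex) \<Rightarrow> ('x \<Rightarrow> complex) mat \<Rightarrow> real" where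
  "multiplier_norm L ipL F = op_mat_norm L ipL (map_mat mult_op F)"

end

theory Submission
  imports
    Defs
    "HOL-Analysis.Infinite_Sum"
    "HOL-Analysis.Convex"
begin

text \<open>
  The multiplier algebra is contained in the completion, with the right norms, once every \<open>n \<times> n\<close>
  matrix \<open>F\<close> that is not close on a finite set \<open>S\<close> to the unit ball of \<open>M\<^sub>n(A)\<close> fails to be
  contractive for some Hilbert space norm on the functions \<open>S \<rightarrow> \<complex>\<^sup>n\<close> on which all contractive matrices
  over \<open>A\<close> act contractively; the kernel space is then the direct sum of sufficiently many such spaces.
  By separation in a space of Hilbert--Schmidt matrices, if there is no such norm, then
  \<open>\<Sum> e\<^sub>j e\<^sub>j\<^sup>* - \<Sum> (F e)\<^sub>i (F e)\<^sub>i\<^sup>*\<close> is, up to a small error, bounded below by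
  \<open>\<Sum> f\<^sub>j f\<^sub>j\<^sup>* - \<Sum> (T f)\<^sub>i (T f)\<^sub>i\<^sup>*\<close> for some contractive \<open>T\<close> over \<open>A\<close>. Douglas factorization
  gives a scalar contraction that maps \<open>(e, T f)\<close> to \<open>(F e, f)\<close>: on \<open>S\<close>, the matrix \<open>F\<close> is the transfer
  function of a contractive linear system over \<open>A\<close> with state \<open>f\<close>. Averaging the responses of this
  system over a long time gives elements of the unit ball of \<open>M\<^sub>n(A)\<close> that converge to \<open>F\<close> on \<open>S\<close>.
\<close>


section \<open>Hilbert spaces\<close>

text \<open>The other inclusion is soft: contractivity for a form on functions over a finite set
  involves finitely many values, so it survives pointwise limits of bounded nets.

  The BRS axioms enter through a calculus of rectangular contractive matrices (scalar factors,
  products, direct sums); no representation of the algebra on a Hilbert space is invoked.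

  The transfer function of the system contains an inverse of the shape (1 - U T)^(-1), where U T is
  merely of norm at most 1. The inverse may fail to exist, and the algebra is not complete, so a
  Neumann series is out of reach. Time averages are finite sums of products: they stay in the
  algebra and keep the norm bound 1 exactly, and all they ask for is a state that the system
  reproduces.

  The coefficient space has to live in the functions on C^X, so the summands must be coded by
  functions on X. A sequence of forms, dense among all suitable ones, for each finite S and each n
  keeps the code down to a natural number attached to S.\<close>

lemma scaleC_zero_left [simp]: "0 *\<^sub>C x = (0::'a::complex_vs)"
  using scaleC_add_left[of 0 0 x] by simp

lemma scaleC_minus_one: "(-1) *\<^sub>C x = - (x::'a::complex_vs)"
proof -
  have "(-1) *\<^sub>C x + x = (-1 + 1) *\<^sub>C x"
    using scaleC_add_left[of "-1" 1 x] by (simp add: scaleC_one)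
  then show ?thesis by (simp add: eq_neg_iff_add_eq_0)
qed

lemma diff_eq_add_scaleC: "x - y = x + (-1) *\<^sub>C (y::'a::complex_vs)"
  by (simp add: scaleC_minus_one)

lemma scaleC_diff_right: "c *\<^sub>C (x - y) = c *\<^sub>C x - c *\<^sub>C (y::'a::complex_vs)"
  using scaleC_add_right[of c "x - y" y] by (simp add: algebra_simps)

lemma scaleC_zero_right [simp]: "c *\<^sub>C 0 = (0::'a::complex_vs)"
  using scaleC_add_right[of c 0 0] by simp

lemma scaleC_diff_left: "(c - d) *\<^sub>C x = c *\<^sub>C x - d *\<^sub>C (x::'a::complex_vs)"
  using scaleC_add_left[of "c - d" d x] by (simp add: algebra_simps)

lemma scaleC_sum_right: "c *\<^sub>C sum f I = (\<Sum>i\<in>I. c *\<^sub>C (f i::'a::complex_vs))"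
  by (induction I rule: infinite_finite_induct) (auto simp: scaleC_add_right)

lemmas scaleC_simps = scaleC_fun_def scaleC_complex_def

text \<open>Degenerate forms have to be covered: the summands of a direct sum are pulled back to one
  common space, where each form vanishes on the other summands.\<close>

locale semi_inner_product =
  fixes V :: "'v::complex_vs set" and p :: "'v \<Rightarrow> 'v \<Rightarrow> complex"
  assumes zero_in: "0 \<in> V"
    and add_in: "u \<in> V \<Longrightarrow> v \<in> V \<Longrightarrow> u + v \<in> V"
    and scale_in: "v \<in> V \<Longrightarrow> c *\<^sub>C v \<in> V"
    and add_left: "u \<in> V \<Longrightarrow> v \<in> V \<Longrightarrow> w \<in> V \<Longrightarrow> p (u + v) w = p u w + p v w"
    and scale_left: "v \<in> V \<Longrightarrow> w \<in> V \<Longrightarrow> p (c *\<^sub>C v) w = c * p v w"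
    and commute: "v \<in> V \<Longrightarrow> w \<in> V \<Longrightarrow> p v w = cnj (p w v)"
    and nonneg: "v \<in> V \<Longrightarrow> 0 \<le> Re (p v v)"
begin

lemma diff_in: "u \<in> V \<Longrightarrow> v \<in> V \<Longrightarrow> u - v \<in> V"
  using add_in scale_in by (simp add: diff_eq_add_scaleC)

lemma sum_in: "(\<And>i. i \<in> I \<Longrightarrow> f i \<in> V) \<Longrightarrow> sum f I \<in> V"
  by (induction I rule: infinite_finite_induct) (auto simp: zero_in add_in)

lemma add_right: "u \<in> V \<Longrightarrow> v \<in> V \<Longrightarrow> w \<in> V \<Longrightarrow> p w (u + v) = p w u + p w v"
  by (simp add: commute[of w] add_in add_left)

lemma scale_right: "v \<in> V \<Longrightarrow> w \<in> V \<Longrightarrow> p w (c *\<^sub>C v) = cnj c * p w v"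
  by (simp add: commute[of w] scale_in scale_left)

lemma zero_left: "w \<in> V \<Longrightarrow> p 0 w = 0"
  using scale_left[of 0 w 0] zero_in by simp

lemma zero_right: "w \<in> V \<Longrightarrow> p w 0 = 0"
  using zero_left by (simp add: commute[of w] zero_in)

lemma diff_left: "u \<in> V \<Longrightarrow> v \<in> V \<Longrightarrow> w \<in> V \<Longrightarrow> p (u - v) w = p u w - p v w"
  by (simp add: diff_eq_add_scaleC add_left scale_left scale_in)

lemma diff_right: "u \<in> V \<Longrightarrow> v \<in> V \<Longrightarrow> w \<in> V \<Longrightarrow> p w (u - v) = p w u - p w v"
  by (simp add: diff_eq_add_scaleC add_right scale_right scale_in)

lemma sum_right: "(\<And>i. i \<in> I \<Longrightarrow> f i \<in> V) \<Longrightarrow> w \<in> V \<Longrightarrow> p w (sum f I) = (\<Sum>i\<in>I. p w (f i))"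
  by (induction I rule: infinite_finite_induct) (auto simp: zero_right add_right sum_in)

lemma self_real: "v \<in> V \<Longrightarrow> p v v = of_real (Re (p v v))"
  using commute[of v v] by (simp add: complex_eq_iff)

lemma norm2_add:
  assumes "u \<in> V" "v \<in> V"
  shows "Re (p (u + v) (u + v)) = Re (p u u) + 2 * Re (p u v) + Re (p v v)"
  using assms commute[of v u] by (simp add: add_left add_right add_in)

lemma norm2_diff:
  assumes "u \<in> V" "v \<in> V"
  shows "Re (p (u - v) (u - v)) = Re (p u u) - 2 * Re (p u v) + Re (p v v)"
  using assms commute[of v u] by (simp add: diff_left diff_right diff_in)

lemma norm2_scale: "v \<in> V \<Longrightarrow> Re (p (c *\<^sub>C v) (c *\<^sub>C v)) = (cmod c)\<^sup>2 * Re (p v v)"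
proof -
  assume v: "v \<in> V"
  have "p (c *\<^sub>C v) (c *\<^sub>C v) = of_real ((cmod c)\<^sup>2) * p v v"
    using v complex_norm_square[of c] by (simp add: scale_in scale_left scale_right)
  then show ?thesis by simp
qed

lemma Cauchy_Schwarz:
  assumes u: "u \<in> V" and v: "v \<in> V"
  shows "(cmod (p u v))\<^sup>2 \<le> Re (p u u) * Re (p v v)"
proof -
  define a where "a = p u v"
  have *: "0 \<le> Re (p u u) - 2 * t * (cmod a)\<^sup>2 + t\<^sup>2 * (cmod a)\<^sup>2 * Re (p v v)" for t :: real
  proof -
    have "0 \<le> Re (p (u - (of_real t * a) *\<^sub>C v) (u - (of_real t * a) *\<^sub>C v))"
      using u v by (intro nonneg diff_in scale_in)
    also have "\<dots> = Re (p u u) - 2 * Re (p u ((of_real t * a) *\<^sub>C v)) + (cmod (of_real t * a))\<^sup>2 * Re (p v v)"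
      using u v by (simp add: norm2_diff norm2_scale scale_in)
    also have "p u ((of_real t * a) *\<^sub>C v) = of_real t * (a * cnj a)"
      using u v by (simp add: scale_right a_def)
    also have "Re (of_real t * (a * cnj a)) = t * (cmod a)\<^sup>2"
      by (simp add: complex_mult_cnj cmod_power2)
    finally show ?thesis by (simp add: norm_mult power_mult_distrib)
  qed
  show ?thesis
  proof (cases "Re (p v v) = 0")
    case True
    have "a = 0"
    proof (rule ccontr)
      assume "a \<noteq> 0"
      \<comment> \<open>For \<open>p v v = 0\<close> the bound is affine in \<open>t\<close>; this
        \<open>t\<close> turns it into \<open>-1\<close>.\<close>
      then show False using *[of "(Re (p u u) + 1) / (2 * (cmod a)\<^sup>2)"] True by (simp add: field_simps)
    qed
    then show ?thesis using True by (simp add: a_def)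
  next
    case False
    with nonneg[OF v] have pos: "Re (p v v) > 0" by simp
    then show ?thesis using *[of "1 / Re (p v v)"] by (simp add: a_def field_simps power2_eq_square)
  qed
qed

lemma hnorm_nonneg: "0 \<le> hnorm p v" if "v \<in> V"
  using nonneg[OF that] by (simp add: hnorm_def)

lemma hnorm_power2: "v \<in> V \<Longrightarrow> (hnorm p v)\<^sup>2 = Re (p v v)"
  using nonneg by (simp add: hnorm_def)

lemma cmod_le_hnorm:
  assumes "u \<in> V" "v \<in> V"
  shows "cmod (p u v) \<le> hnorm p u * hnorm p v"
  using Cauchy_Schwarz[OF assms] by (simp add: hnorm_def real_sqrt_mult[symmetric] real_le_rsqrt)

lemma hnorm_add:
  assumes "u \<in> V" "v \<in> V"
  shows "hnorm p (u + v) \<le> hnorm p u + hnorm p v"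
proof (rule power2_le_imp_le)
  have "Re (p u v) \<le> hnorm p u * hnorm p v"
    using cmod_le_hnorm[OF assms] complex_Re_le_cmod[of "p u v"] by linarith
  then show "(hnorm p (u + v))\<^sup>2 \<le> (hnorm p u + hnorm p v)\<^sup>2"
    using assms by (simp add: hnorm_power2 add_in norm2_add power2_sum)
qed (use assms in \<open>simp add: hnorm_nonneg\<close>)

lemma hnorm_scale: "v \<in> V \<Longrightarrow> hnorm p (c *\<^sub>C v) = cmod c * hnorm p v"
  by (simp add: hnorm_def norm2_scale real_sqrt_mult)

lemma hnorm_minus_commute: "u \<in> V \<Longrightarrow> v \<in> V \<Longrightarrow> hnorm p (u - v) = hnorm p (v - u)"
  using hnorm_scale[of "u - v" "-1"] by (simp add: scaleC_minus_one diff_in)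

lemma hnorm_triangle:
  assumes "u \<in> V" "v \<in> V" "w \<in> V"
  shows "hnorm p (u - w) \<le> hnorm p (u - v) + hnorm p (v - w)"
  using hnorm_add[of "u - v" "v - w"] assms by (simp add: diff_in)

lemma hnorm_sum: "(\<And>i. i \<in> I \<Longrightarrow> f i \<in> V) \<Longrightarrow> hnorm p (sum f I) \<le> (\<Sum>i\<in>I. hnorm p (f i))"
proof (induction I rule: infinite_finite_induct)
  case (insert i I)
  then show ?case using hnorm_add[of "f i" "sum f I"] by (simp add: sum_in)
qed (auto simp: hnorm_def zero_left zero_in)

lemma hnorm_tendsto:
  assumes s: "\<And>n. s n \<in> V" and l: "l \<in> V" and w: "w \<in> V"
    and lim: "(\<lambda>n. hnorm p (s n - l)) \<longlonglongrightarrow> 0"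
  shows "(\<lambda>n. hnorm p (w - s n)) \<longlonglongrightarrow> hnorm p (w - l)"
proof (rule LIM_zero_cancel, rule tendsto_0_le[OF lim, where K=1], rule always_eventually, rule allI)
  fix n
  have "hnorm p (w - s n) \<le> hnorm p (w - l) + hnorm p (l - s n)"
    "hnorm p (w - l) \<le> hnorm p (w - s n) + hnorm p (s n - l)"
    using hnorm_triangle s l w by auto
  then show "norm (hnorm p (w - s n) - hnorm p (w - l)) \<le> norm (hnorm p (s n - l)) * 1"
    using hnorm_minus_commute[OF l s, of n] hnorm_nonneg[OF diff_in[OF s l], of n] by simp
qed

text \<open>Gram--Schmidt, one vector at a time: \<open>r\<close> is the residual of the new vector
  and \<open>w\<close> that of \<open>v\<close>, and \<open>w\<close> is corrected by a multiple of
  \<open>r\<close>. The family \<open>b\<close> may be dependent, so \<open>r\<close> may have norm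
  0.\<close>

lemma orthogonal_projection:
  assumes "finite Z" "\<And>z. z \<in> Z \<Longrightarrow> b z \<in> V" "v \<in> V"
  shows "\<exists>c. \<forall>y\<in>Z. p (v - (\<Sum>z\<in>Z. c z *\<^sub>C b z)) (b y) = 0"
  using assms
proof (induction Z arbitrary: v rule: finite_induct)
  case (insert y Z)
  have b: "b z \<in> V" if "z \<in> insert y Z" for z using insert.prems(1) that .
  have comb: "(\<Sum>z\<in>Z. c z *\<^sub>C b z) \<in> V" for c using b by (intro sum_in scale_in) auto
  obtain d where d: "\<And>x. x \<in> Z \<Longrightarrow> p (b y - (\<Sum>z\<in>Z. d z *\<^sub>C b z)) (b x) = 0"
    using insert.IH[OF b[OF insertI2] b[OF insertI1]] by blast
  obtain e where e: "\<And>x. x \<in> Z \<Longrightarrow> p (v - (\<Sum>z\<in>Z. e z *\<^sub>C b z)) (b x) = 0"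
    using insert.IH[OF b[OF insertI2] insert.prems(2)] by blast
  define r where "r = b y - (\<Sum>z\<in>Z. d z *\<^sub>C b z)"
  define w where "w = v - (\<Sum>z\<in>Z. e z *\<^sub>C b z)"
  have r: "r \<in> V" and w: "w \<in> V" using b comb insert.prems(2) by (auto simp: r_def w_def intro: diff_in)
  \<comment> \<open>If \<open>p r r = 0\<close>, division by zero gives \<open>t = 0\<close>, and
    Cauchy--Schwarz gives \<open>p w r = 0\<close>, so the next equation covers this case
    too.\<close>
  define t where "t = p w r / p r r"
  have tr: "t * p r r = p w r"
    using Cauchy_Schwarz[OF w r] by (cases "p r r = 0") (auto simp: t_def)
  define c where "c z = (if z = y then t else e z - t * d z)" for z
  have "(\<Sum>z\<in>insert y Z. c z *\<^sub>C b z) = t *\<^sub>C b y + (\<Sum>z\<in>Z. (e z - t * d z) *\<^sub>C b z)"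
    using insert.hyps by (simp add: c_def) (intro sum.cong, auto)
  also have "\<dots> = (\<Sum>z\<in>Z. e z *\<^sub>C b z) + t *\<^sub>C r"
    by (simp add: r_def scaleC_diff_left scaleC_diff_right scaleC_sum_right scaleC_scaleC sum_subtractf)
  finally have res: "v - (\<Sum>z\<in>insert y Z. c z *\<^sub>C b z) = w - t *\<^sub>C r" by (simp add: w_def)
  have tr_in: "t *\<^sub>C r \<in> V" using r by (rule scale_in)
  have orth: "p (w - t *\<^sub>C r) (b x) = 0" if "x \<in> Z" for x
    using d[OF that] e[OF that] that b[of x] r w tr_in by (simp add: diff_left scale_left r_def[symmetric] w_def[symmetric])
  have "p (w - t *\<^sub>C r) (b y) = p (w - t *\<^sub>C r) (r + (\<Sum>z\<in>Z. d z *\<^sub>C b z))" by (simp add: r_def)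
  also have "\<dots> = p (w - t *\<^sub>C r) r + (\<Sum>z\<in>Z. cnj (d z) * p (w - t *\<^sub>C r) (b z))"
    using b r w tr_in comb[of d] by (simp add: add_right sum_right scale_right scale_in diff_in)
  also have "\<dots> = 0" using orth r w tr_in tr by (simp add: diff_left scale_left)
  finally show ?case using orth res by (intro exI[of _ c]) auto
qed auto

lemma norm2_sum_le:
  assumes "finite I" "\<And>i. i \<in> I \<Longrightarrow> f i \<in> V"
  shows "Re (p (sum f I) (sum f I)) \<le> card I * (\<Sum>i\<in>I. Re (p (f i) (f i)))"
proof -
  have "Re (p (sum f I) (sum f I)) = (hnorm p (sum f I))\<^sup>2"
    using assms by (simp add: hnorm_power2 sum_in)
  also have "\<dots> \<le> (\<Sum>i\<in>I. hnorm p (f i))\<^sup>2"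
    using assms by (intro power_mono hnorm_sum hnorm_nonneg sum_in)
  also have "\<dots> \<le> card I * (\<Sum>i\<in>I. (hnorm p (f i))\<^sup>2)"
    using Cauchy_Schwarz_ineq_sum[of "\<lambda>_. 1" "\<lambda>i. hnorm p (f i)" I] by simp
  also have "\<dots> = card I * (\<Sum>i\<in>I. Re (p (f i) (f i)))"
    using assms by (simp add: hnorm_power2)
  finally show ?thesis .
qed

end

section \<open>Complete spaces: separation of cones, Riesz representation, adjoints, direct
  sums\<close>

sublocale chilbert_space \<subseteq> semi_inner_product H ip
  by unfold_locales (simp_all add: zero_mem add_mem scale_mem ip_add_left ip_scale_left ip_nonneg ip_commute[symmetric])

text \<open>Let \<open>t\<close> decrease to 0. This extracts the first-order condition from
  minimality of a quadratic function of \<open>t\<close>.\<close>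

lemma nonneg_of_nonneg_perturbation:
  assumes "\<And>t::real. 0 < t \<Longrightarrow> t < 1 \<Longrightarrow> 0 \<le> a + t * b"
  shows "0 \<le> a"
proof (rule tendsto_lowerbound)
  have "((\<lambda>t. a + t * b) \<longlongrightarrow> a + 0 * b) (at_right 0)" by (intro tendsto_intros)
  then show "((\<lambda>t. a + t * b) \<longlongrightarrow> a) (at_right 0)" by simp
  show "\<forall>\<^sub>F t in at_right 0. 0 \<le> a + t * b"
    using assms by (intro eventually_at_rightI[of 0 1]) auto
qed simp

context chilbert_space
begin

text \<open>The separating functional is \<open>P - D\<close>, with \<open>P\<close> the point of the closure of \<open>Q\<close> nearest to \<open>D\<close>.\<close>

lemma cone_separation:
  assumes Q: "Q \<subseteq> H" "Q \<noteq> {}"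
    and Q_add: "\<And>u v. u \<in> Q \<Longrightarrow> v \<in> Q \<Longrightarrow> u + v \<in> Q"
    and Q_scale: "\<And>u t. u \<in> Q \<Longrightarrow> 0 < t \<Longrightarrow> of_real t *\<^sub>C u \<in> Q"
    and D: "D \<in> H" and eps: "0 < e" "\<And>z. z \<in> Q \<Longrightarrow> e \<le> hnorm ip (D - z)"
  shows "\<exists>u\<in>H. (\<forall>z\<in>Q. 0 \<le> Re (ip z u)) \<and> Re (ip D u) < 0"
proof -
  define d where "d = (INF z\<in>Q. (hnorm ip (D - z))\<^sup>2)"
  have bdd: "bdd_below ((\<lambda>z. (hnorm ip (D - z))\<^sup>2) ` Q)"
    by (rule bdd_belowI2[where m=0]) simp
  have d_le: "d \<le> (hnorm ip (D - z))\<^sup>2" if "z \<in> Q" for z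
    unfolding d_def using bdd that by (rule cINF_lower)
  have d_pos: "0 < d"
  proof -
    have "e\<^sup>2 \<le> d" unfolding d_def
      using Q(2) eps by (intro cINF_greatest power_mono) auto
    then show ?thesis using eps(1) zero_less_power[of e 2] by linarith
  qed
  have "\<exists>z\<in>Q. (hnorm ip (D - z))\<^sup>2 < d + 1 / Suc k" for k
  proof -
    have "d < d + 1 / Suc k" by simp
    then show ?thesis unfolding d_def using cINF_less_iff[OF Q(2) bdd] by blast
  qed
  then obtain s where s: "\<And>k. s k \<in> Q" "\<And>k. (hnorm ip (D - s k))\<^sup>2 < d + 1 / Suc k" by metis
  have sH: "s k \<in> H" for k using s(1) Q(1) by blast
  have near: "(hnorm ip (s k - s l))\<^sup>2 \<le> 2 / Suc k + 2 / Suc l" for k l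
  proof -
    \<comment> \<open>The midpoint lies in the cone, so the parallelogram law bounds the distance of
      two nearly optimal points: the minimizing sequence is Cauchy.\<close>
    let ?h = "of_real (1/2) *\<^sub>C (s k + s l)"
    have hQ: "?h \<in> Q" using s(1) by (intro Q_scale Q_add) auto
    have hH: "?h \<in> H" using hQ Q(1) by blast
    define a where "a = D - s k"
    define b where "b = D - s l"
    have a: "a \<in> H" and b: "b \<in> H" using D sH by (auto simp: a_def b_def intro: diff_in)
    have "2 *\<^sub>C D = D + D" using scaleC_add_left[of 1 1 D] by (simp add: scaleC_one)
    moreover have "2 *\<^sub>C ?h = s k + s l" by (simp add: scaleC_scaleC scaleC_one)
    ultimately have "a + b = 2 *\<^sub>C (D - ?h)"
      by (simp add: a_def b_def scaleC_diff_right del: of_real_divide scaleC_add_right)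
    then have "4 * (hnorm ip (D - ?h))\<^sup>2 = Re (ip (a + b) (a + b))"
      using D hH by (simp add: norm2_scale diff_in hnorm_power2)
    moreover have "s k - s l = b - a" by (simp add: a_def b_def)
    then have "(hnorm ip (s k - s l))\<^sup>2 = Re (ip (b - a) (b - a))"
      using a b by (simp add: hnorm_power2 diff_in)
    ultimately have "(hnorm ip (s k - s l))\<^sup>2 =
        2 * (hnorm ip a)\<^sup>2 + 2 * (hnorm ip b)\<^sup>2 - 4 * (hnorm ip (D - ?h))\<^sup>2"
      using a b commute[of a b] by (simp add: norm2_add norm2_diff hnorm_power2)
    also have "\<dots> \<le> 2 * (d + 1 / Suc k) + 2 * (d + 1 / Suc l) - 4 * d"
    proof -
      have "2 * x + 2 * y - 4 * z \<le> 2 * (d + p) + 2 * (d + q) - 4 * d"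
        if "x < d + p" "y < d + q" "d \<le> z" for x y z p q :: real
        using that by argo
      from this[OF s(2) s(2) d_le[OF hQ]] show ?thesis unfolding a_def b_def .
    qed
    finally show ?thesis by simp
  qed
  have "\<exists>N. \<forall>m\<ge>N. \<forall>n\<ge>N. hnorm ip (s m - s n) < \<epsilon>" if "0 < \<epsilon>" for \<epsilon>
  proof -
    have "0 < \<epsilon>\<^sup>2 / 4" using that by simp
    then obtain N where N: "1 / Suc N < \<epsilon>\<^sup>2 / 4" using nat_approx_posE by blast
    have "hnorm ip (s m - s n) < \<epsilon>" if "m \<ge> N" "n \<ge> N" for m n
    proof -
      have "1 / real (Suc m) \<le> 1 / Suc N" "1 / real (Suc n) \<le> 1 / Suc N"
        using that by (auto simp: frac_le)
      then have "(hnorm ip (s m - s n))\<^sup>2 < \<epsilon>\<^sup>2" using near[of m n] N by simp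
      then show ?thesis using \<open>0 < \<epsilon>\<close> by (simp add: power2_less_imp_less)
    qed
    then show ?thesis by blast
  qed
  from complete[OF sH this] obtain P where P: "P \<in> H" "(\<lambda>n. hnorm ip (s n - P)) \<longlonglongrightarrow> 0" by blast
  \<comment> \<open>\<open>P\<close> need not lie in \<open>Q\<close>; distance bounds for points of
    \<open>Q\<close> built from \<open>s n\<close> carry over to the same expressions in
    \<open>P\<close>.\<close>
  have lim: "d \<le> (hnorm ip (D - v - c *\<^sub>C P))\<^sup>2"
    if "v \<in> H" "\<And>n. d \<le> (hnorm ip (D - v - c *\<^sub>C s n))\<^sup>2" for v c
  proof (rule LIMSEQ_le_const)
    have "(\<lambda>n. cmod c * hnorm ip (s n - P)) \<longlonglongrightarrow> cmod c * 0"
      by (intro tendsto_mult tendsto_const P(2))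
    then have "(\<lambda>n. hnorm ip (c *\<^sub>C s n - c *\<^sub>C P)) \<longlonglongrightarrow> 0"
      using sH P(1) by (simp add: scaleC_diff_right[symmetric] hnorm_scale diff_in)
    then show "(\<lambda>n. (hnorm ip (D - v - c *\<^sub>C s n))\<^sup>2) \<longlonglongrightarrow> (hnorm ip (D - v - c *\<^sub>C P))\<^sup>2"
      using sH P(1) D that(1) by (intro tendsto_power hnorm_tendsto scale_in diff_in)
  qed (use that(2) in blast)
  define u where "u = P - D"
  have u: "u \<in> H" using P D by (simp add: u_def diff_in)
  have norm_u: "Re (ip u u) = d"
  proof (rule antisym)
    have "(\<lambda>n. (hnorm ip (D - s n))\<^sup>2) \<longlonglongrightarrow> (hnorm ip (D - P))\<^sup>2"
      by (intro tendsto_power hnorm_tendsto[OF sH P(1) D P(2)])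
    moreover have "(\<lambda>n. d + 1 / Suc n) \<longlonglongrightarrow> d + 0"
      by (intro tendsto_add tendsto_const LIMSEQ_Suc[OF lim_1_over_n])
    ultimately have "(hnorm ip (D - P))\<^sup>2 \<le> d + 0"
      by (rule LIMSEQ_le) (use s(2) in \<open>auto intro: less_imp_le\<close>)
    then show "Re (ip u u) \<le> d"
      using D P(1) by (simp add: u_def hnorm_minus_commute[of D] flip: hnorm_power2[OF diff_in])
    show "d \<le> Re (ip u u)"
      using lim[of 0 1] d_le[OF s(1)] D P(1) zero_in
      by (simp add: scaleC_one u_def hnorm_minus_commute[of D] flip: hnorm_power2[OF diff_in])
  qed
  have Qu: "0 \<le> Re (ip z u)" if z: "z \<in> Q" for z
  proof -
    have zH: "z \<in> H" using z Q(1) by blast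
    have "0 \<le> 2 * Re (ip z u) + t * Re (ip z z)" if t: "0 < t" for t
    proof -
      let ?z = "of_real t *\<^sub>C z"
      have tz: "?z \<in> H" using zH by (rule scale_in)
      have "d \<le> (hnorm ip ((D - ?z) - s n))\<^sup>2" for n
        using d_le[OF Q_add[OF s(1)[of n] Q_scale[OF z t]]] by (simp add: algebra_simps)
      then have "d \<le> (hnorm ip ((D - ?z) - P))\<^sup>2"
        using lim[OF tz, of 1] by (simp add: scaleC_one)
      also have "(D - ?z) - P = (-1) *\<^sub>C (u + ?z)" by (simp add: u_def scaleC_minus_one)
      also have "(hnorm ip \<dots>)\<^sup>2 = Re (ip (u + ?z) (u + ?z))"
        using u tz by (simp add: hnorm_scale add_in hnorm_power2)
      also have "\<dots> = d + 2 * t * Re (ip z u) + t\<^sup>2 * Re (ip z z)"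
        using u tz zH commute[OF u zH] by (simp add: norm2_add norm2_scale scale_left scale_right norm_u power2_eq_square)
      finally have "0 \<le> t * (2 * Re (ip z u) + t * Re (ip z z))"
        by (simp add: algebra_simps power2_eq_square)
      then show ?thesis using t by (simp add: zero_le_mult_iff)
    qed
    then have "0 \<le> 2 * Re (ip z u)" by (rule nonneg_of_nonneg_perturbation)
    then show ?thesis by simp
  qed
  \<comment> \<open>Shrinking \<open>P\<close> towards 0 cannot bring it nearer to \<open>D\<close>;
    the term of first order in \<open>t\<close> gives the sign.\<close>
  have Pu: "Re (ip P u) \<le> 0"
  proof -
    have "0 \<le> - (2 * Re (ip P u)) + t * Re (ip P P)" if t: "0 < t" "t < 1" for t
    proof -
      have "d \<le> (hnorm ip (D - of_real (1 - t) *\<^sub>C s n))\<^sup>2" for n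
        using d_le[OF Q_scale[OF s(1)[of n], of "1 - t"]] t by simp
      then have "d \<le> (hnorm ip (D - of_real (1 - t) *\<^sub>C P))\<^sup>2"
        using lim[of 0 "of_real (1 - t)"] zero_in by simp
      also have "D - of_real (1 - t) *\<^sub>C P = (-1) *\<^sub>C (u - of_real t *\<^sub>C P)"
        by (simp add: u_def scaleC_diff_left scaleC_one scaleC_minus_one)
      also have "(hnorm ip \<dots>)\<^sup>2 = d - 2 * t * Re (ip P u) + t\<^sup>2 * Re (ip P P)"
        using u P(1) commute[OF u P(1)]
        by (simp add: hnorm_scale diff_in scale_in hnorm_power2 norm2_diff norm2_scale scale_right norm_u)
           (simp add: scale_left power2_eq_square)
      finally have "0 \<le> t * (t * Re (ip P P) - 2 * Re (ip P u))"
        by (simp add: algebra_simps power2_eq_square)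
      then show ?thesis using t by (simp add: zero_le_mult_iff)
    qed
    then have "0 \<le> - (2 * Re (ip P u))" by (rule nonneg_of_nonneg_perturbation)
    then show ?thesis by simp
  qed
  have "D = P - u" by (simp add: u_def)
  then have "Re (ip D u) = Re (ip P u) - Re (ip u u)" using P(1) u by (simp add: diff_left)
  then have "Re (ip D u) < 0" using Pu norm_u d_pos by simp
  then show ?thesis using u Qu by blast
qed

text \<open>The kernel of \<open>\<phi>\<close> is a cone at positive distance from any
  \<open>D\<close> outside it, so \<open>cone_separation\<close> applies. A functional whose real
  part is nonnegative on a complex subspace vanishes there, which leaves a vector orthogonal to the
  kernel.\<close>

lemma Riesz_representation:
  assumes add: "\<And>u v. u \<in> H \<Longrightarrow> v \<in> H \<Longrightarrow> \<phi> (u + v) = \<phi> u + \<phi> v"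
    and scale: "\<And>c v. v \<in> H \<Longrightarrow> \<phi> (c *\<^sub>C v) = c * (\<phi> v :: complex)"
    and bdd: "\<And>v. v \<in> H \<Longrightarrow> cmod (\<phi> v) \<le> b * hnorm ip v"
  shows "\<exists>u\<in>H. \<forall>v\<in>H. \<phi> v = ip v u"
proof (cases "\<forall>v\<in>H. \<phi> v = 0")
  case True
  then show ?thesis using zero_in zero_right by (intro bexI[of _ 0]) auto
next
  case False
  then obtain D where D: "D \<in> H" "\<phi> D \<noteq> 0" by blast
  have diff: "\<phi> (u - v) = \<phi> u - \<phi> v" if "u \<in> H" "v \<in> H" for u v
    using that add scale scale_in by (simp add: diff_eq_add_scaleC)
  define Q where "Q = {z \<in> H. \<phi> z = 0}"
  \<comment> \<open>\<open>b\<close> may be zero or negative; \<open>\<bar>b\<bar> + 1\<close> is a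
    safe divisor.\<close>
  have sep: "cmod (\<phi> D) / (\<bar>b\<bar> + 1) \<le> hnorm ip (D - z)" if "z \<in> Q" for z
  proof -
    have z: "z \<in> H" "\<phi> z = 0" using that by (auto simp: Q_def)
    have "cmod (\<phi> D) = cmod (\<phi> (D - z))" using z D diff by simp
    also have "\<dots> \<le> b * hnorm ip (D - z)" using z D by (intro bdd diff_in)
    also have "\<dots> \<le> (\<bar>b\<bar> + 1) * hnorm ip (D - z)"
      using z D by (intro mult_right_mono hnorm_nonneg diff_in) auto
    finally show ?thesis by (simp add: field_simps)
  qed
  have "0 \<in> Q" using scale[of 0 0] zero_in by (simp add: Q_def)
  then have "\<exists>u\<in>H. (\<forall>z\<in>Q. 0 \<le> Re (ip z u)) \<and> Re (ip D u) < 0"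
    using D sep by (intro cone_separation[where e = "cmod (\<phi> D) / (\<bar>b\<bar> + 1)"])
      (auto simp: Q_def add_in scale_in add scale add_pos_nonneg intro!: divide_pos_pos)
  then obtain u where u: "u \<in> H" "\<And>z. z \<in> Q \<Longrightarrow> 0 \<le> Re (ip z u)" "Re (ip D u) < 0" by blast
  have orth: "ip z u = 0" if "z \<in> Q" for z
  proof -
    have scaled: "c *\<^sub>C z \<in> Q" for c using that by (simp add: Q_def scale_in scale)
    have z: "z \<in> H" using that by (simp add: Q_def)
    have "0 \<le> Re (c * ip z u)" for c using u(2)[OF scaled[of c]] z u(1) by (simp add: scale_left)
    from this[of 1] this[of "-1"] this[of \<i>] this[of "-\<i>"] show ?thesis
      by (simp add: complex_eq_iff)
  qed
  have Du: "ip D u \<noteq> 0" using u(3) by auto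
  define w where "w = cnj (\<phi> D / ip D u) *\<^sub>C u"
  have "\<phi> v = ip v w" if v: "v \<in> H" for v
  proof -
    have vD: "(\<phi> v / \<phi> D) *\<^sub>C D \<in> H" using D by (simp add: scale_in)
    then have "v - (\<phi> v / \<phi> D) *\<^sub>C D \<in> Q"
      using v D by (simp add: Q_def diff_in diff scale)
    from orth[OF this] have "ip v u = \<phi> v / \<phi> D * ip D u"
      using v D u(1) vD by (simp add: diff_left scale_left)
    then show ?thesis using v u(1) Du D(2) by (simp add: w_def scale_right)
  qed
  then show ?thesis using u(1) by (intro bexI[of _ w]) (auto simp: w_def scale_in)
qed

lemma eq_of_ip_eq:
  assumes "u \<in> H" "v \<in> H" "\<And>w. w \<in> H \<Longrightarrow> ip w u = ip w v"
  shows "u = v"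
proof -
  have "ip (u - v) (u - v) = 0" using assms by (simp add: diff_right diff_in)
  then show ?thesis using ip_eq_0[of "u - v"] assms by (simp add: diff_in)
qed

end

lemma adjoint_exists:
  assumes "chilbert_space H ip" "chilbert_space H' ip'" "bounded_op H ip H' ip' T"
  shows "\<exists>S. is_adjoint H ip H' ip' T S"
proof -
  interpret H: chilbert_space H ip by fact
  interpret H': chilbert_space H' ip' by fact
  have mem: "\<And>v. v \<in> H \<Longrightarrow> T v \<in> H'"
    and add: "\<And>u v. u \<in> H \<Longrightarrow> v \<in> H \<Longrightarrow> T (u + v) = T u + T v"
    and scale: "\<And>c v. v \<in> H \<Longrightarrow> T (c *\<^sub>C v) = c *\<^sub>C T v"
    using assms(3) by (auto simp: bounded_op_def)
  obtain b0 where b0: "\<And>v. v \<in> H \<Longrightarrow> hnorm ip' (T v) \<le> b0 * hnorm ip v"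
    using assms(3) unfolding bounded_op_def by blast
  have b: "hnorm ip' (T v) \<le> \<bar>b0\<bar> * hnorm ip v" if "v \<in> H" for v
    using b0[OF that] mult_right_mono[of b0 "\<bar>b0\<bar>" "hnorm ip v"] H.hnorm_nonneg[OF that] by linarith
  have "\<exists>u\<in>H. \<forall>v\<in>H. ip' (T v) w = ip v u" if w: "w \<in> H'" for w
  proof (rule H.Riesz_representation)
    fix v assume v: "v \<in> H"
    have "cmod (ip' (T v) w) \<le> hnorm ip' (T v) * hnorm ip' w"
      using v w mem by (intro H'.cmod_le_hnorm)
    also have "\<dots> \<le> (\<bar>b0\<bar> * hnorm ip v) * hnorm ip' w"
      using b[OF v] w by (intro mult_right_mono H'.hnorm_nonneg)
    finally show "cmod (ip' (T v) w) \<le> \<bar>b0\<bar> * hnorm ip' w * hnorm ip v" by (simp add: ac_simps)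
  qed (use w mem add scale in \<open>auto simp: H'.add_left H'.scale_left\<close>)
  then obtain S where S: "\<And>w. w \<in> H' \<Longrightarrow> S w \<in> H"
    and adj: "\<And>v w. v \<in> H \<Longrightarrow> w \<in> H' \<Longrightarrow> ip' (T v) w = ip v (S w)" by metis
  have "S (u + v) = S u + S v" if "u \<in> H'" "v \<in> H'" for u v
    using that S by (intro H.eq_of_ip_eq)
      (auto simp: H.add_in H'.add_in H'.add_right H.add_right mem simp flip: adj)
  moreover have "S (c *\<^sub>C v) = c *\<^sub>C S v" if "v \<in> H'" for c v
    using that S by (intro H.eq_of_ip_eq)
      (auto simp: H.scale_in H'.scale_in H'.scale_right H.scale_right mem simp flip: adj)
  moreover have "hnorm ip (S w) \<le> \<bar>b0\<bar> * hnorm ip' w" if w: "w \<in> H'" for w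
  proof -
    have "(hnorm ip (S w))\<^sup>2 = Re (ip' (T (S w)) w)"
      using w S by (simp add: H.hnorm_power2 adj)
    also have "\<dots> \<le> hnorm ip' (T (S w)) * hnorm ip' w"
      using H'.cmod_le_hnorm[of "T (S w)" w] complex_Re_le_cmod[of "ip' (T (S w)) w"] w S mem by fastforce
    also have "\<dots> \<le> (\<bar>b0\<bar> * hnorm ip (S w)) * hnorm ip' w"
      using b[OF S[OF w]] w by (intro mult_right_mono H'.hnorm_nonneg)
    finally have "hnorm ip (S w) * hnorm ip (S w) \<le> hnorm ip (S w) * (\<bar>b0\<bar> * hnorm ip' w)"
      by (simp add: power2_eq_square ac_simps)
    then show ?thesis
      using H.hnorm_nonneg[OF S[OF w]] H'.hnorm_nonneg[OF w] by (cases "hnorm ip (S w) = 0") auto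
  qed
  ultimately show ?thesis unfolding is_adjoint_def bounded_op_def using S adj by blast
qed

text \<open>All forms live on one space \<open>V\<close>, and the direct sum consists of the vectors
  with summable squared norms. Completeness is reduced to a common limit for all the seminorms
  (\<open>compl\<close>); both the square-summable families and the kernel space arise in this
  way.\<close>

lemma chilbert_space_direct_sum:
  fixes p :: "'b \<Rightarrow> 'v::complex_vs \<Rightarrow> 'v \<Rightarrow> complex"
  assumes V_zero: "0 \<in> V"
    and V_add: "\<And>u v. u \<in> V \<Longrightarrow> v \<in> V \<Longrightarrow> u + v \<in> V"
    and V_scale: "\<And>c v. v \<in> V \<Longrightarrow> c *\<^sub>C v \<in> V"
    and sip: "\<And>b. b \<in> B \<Longrightarrow> semi_inner_product V (p b)"
    and definite: "\<And>v. v \<in> V \<Longrightarrow> (\<And>b. b \<in> B \<Longrightarrow> p b v v = 0) \<Longrightarrow> v = 0"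
    and compl: "\<And>s. (\<And>n. s n \<in> V) \<Longrightarrow>
      (\<And>b e. b \<in> B \<Longrightarrow> 0 < e \<Longrightarrow> \<exists>N. \<forall>m\<ge>N. \<forall>n\<ge>N. hnorm (p b) (s m - s n) < e) \<Longrightarrow>
      \<exists>l\<in>V. \<forall>b\<in>B. (\<lambda>n. hnorm (p b) (s n - l)) \<longlonglongrightarrow> 0"
  shows "chilbert_space {v \<in> V. (\<lambda>b. Re (p b v v)) summable_on B} (\<lambda>u v. \<Sum>\<^sub>\<infinity>b\<in>B. p b u v)"
    (is "chilbert_space ?H ?ip")
proof -
  let ?q = "\<lambda>b v. Re (p b v v)"
  have nonneg: "0 \<le> ?q b v" if "b \<in> B" "v \<in> V" for b v
    using semi_inner_product.nonneg[OF sip] that by blast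
  have cross: "(\<lambda>b. p b u v) summable_on B" if "u \<in> ?H" "v \<in> ?H" for u v
  proof (rule abs_summable_summable, rule abs_summable_on_comparison_test')
    show "(\<lambda>b. ?q b u + ?q b v) summable_on B"
      using that by (auto intro: summable_on_add)
    show "cmod (p b u v) \<le> ?q b u + ?q b v" if b: "b \<in> B" for b
    proof -
      interpret semi_inner_product V "p b" using sip[OF b] .
      have uv: "u \<in> V" "v \<in> V" using \<open>u \<in> ?H\<close> \<open>v \<in> ?H\<close> by auto
      have "(cmod (p b u v))\<^sup>2 \<le> ?q b u * ?q b v" using uv by (rule Cauchy_Schwarz)
      also have "\<dots> \<le> (?q b u + ?q b v)\<^sup>2"
        using nonneg uv by (simp add: power2_sum)
      finally show ?thesis using nonneg uv by (intro power2_le_imp_le[of "cmod (p b u v)"]) auto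
    qed
  qed
  have ip_Re: "Re (?ip v v) = (\<Sum>\<^sub>\<infinity>b\<in>B. ?q b v)" if "v \<in> ?H" for v
    using infsum_Re[OF cross[OF that that]] by simp
  have norm_nonneg: "0 \<le> hnorm ?ip v" if "v \<in> ?H" for v
    unfolding hnorm_def ip_Re[OF that] using that by (intro real_sqrt_ge_zero infsum_nonneg nonneg) auto
  have scale: "c *\<^sub>C v \<in> ?H" if "v \<in> ?H" for c v
  proof -
    have "(\<lambda>b. ?q b (c *\<^sub>C v)) summable_on B \<longleftrightarrow> (\<lambda>b. (cmod c)\<^sup>2 * ?q b v) summable_on B"
      using that by (intro summable_on_cong) (auto simp: semi_inner_product.norm2_scale[OF sip])
    then show ?thesis using that by (auto simp: V_scale intro: summable_on_cmult_right)
  qed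
  have add: "u + v \<in> ?H" if "u \<in> ?H" "v \<in> ?H" for u v
  proof -
    have "(\<lambda>b. ?q b (u + v)) summable_on B \<longleftrightarrow>
        (\<lambda>b. ?q b u + 2 * Re (p b u v) + ?q b v) summable_on B"
      using that by (intro summable_on_cong) (auto simp: semi_inner_product.norm2_add[OF sip])
    moreover have "(\<lambda>b. Re (p b u v)) summable_on B" using cross[OF that] by (rule summable_on_Re)
    ultimately show ?thesis
      using that by (auto simp: V_add intro!: summable_on_add summable_on_cmult_right)
  qed
  have diff: "u - v \<in> ?H" if "u \<in> ?H" "v \<in> ?H" for u v
    unfolding diff_eq_add_scaleC using that by (intro add scale)
  have partial: "(\<Sum>b\<in>F. ?q b v) \<le> (hnorm ?ip v)\<^sup>2" if "v \<in> ?H" "finite F" "F \<subseteq> B" for F v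
  proof -
    have "(\<Sum>b\<in>F. ?q b v) \<le> (\<Sum>\<^sub>\<infinity>b\<in>B. ?q b v)"
      using that nonneg by (intro finite_sum_le_infsum) auto
    moreover have "0 \<le> (\<Sum>\<^sub>\<infinity>b\<in>B. ?q b v)" using that nonneg by (intro infsum_nonneg) auto
    ultimately show ?thesis using ip_Re[OF that(1)] by (simp add: hnorm_def)
  qed
  show "chilbert_space ?H ?ip"
  proof
    have "p b 0 0 = 0" if "b \<in> B" for b
      using semi_inner_product.zero_left[OF sip[OF that] V_zero] .
    then have "(\<lambda>b. ?q b 0) summable_on B"
      using summable_on_cong[of B "\<lambda>b. ?q b 0" "\<lambda>_. 0"] by simp
    then show "0 \<in> ?H" by (simp add: V_zero)
  next
    fix u v w assume uvw: "u \<in> ?H" "v \<in> ?H" "w \<in> ?H"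
    have "?ip (u + v) w = (\<Sum>\<^sub>\<infinity>b\<in>B. p b u w + p b v w)"
      using uvw by (intro infsum_cong) (auto simp: semi_inner_product.add_left[OF sip])
    also have "\<dots> = ?ip u w + ?ip v w" using uvw by (intro infsum_add cross)
    finally show "?ip (u + v) w = ?ip u w + ?ip v w" .
  next
    fix v w c assume vw: "v \<in> ?H" "w \<in> ?H"
    have "?ip (c *\<^sub>C v) w = (\<Sum>\<^sub>\<infinity>b\<in>B. c * p b v w)"
      using vw by (intro infsum_cong) (auto simp: semi_inner_product.scale_left[OF sip])
    also have "\<dots> = c * ?ip v w" by (rule infsum_cmult_right')
    finally show "?ip (c *\<^sub>C v) w = c * ?ip v w" .
    have "?ip v w = (\<Sum>\<^sub>\<infinity>b\<in>B. cnj (p b w v))"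
      using vw by (intro infsum_cong semi_inner_product.commute[OF sip]) auto
    then show "?ip v w = cnj (?ip w v)" by simp
  next
    fix v assume v: "v \<in> ?H"
    show "0 \<le> Re (?ip v v)" unfolding ip_Re[OF v] using v nonneg by (intro infsum_nonneg) auto
    assume "?ip v v = 0"
    then have "hnorm ?ip v = 0" by (simp add: hnorm_def)
    then have "?q b v = 0" if "b \<in> B" for b
      using partial[OF v, of "{b}"] that nonneg[OF that] v by (auto intro: antisym)
    then have "p b v v = 0" if "b \<in> B" for b
      using that v semi_inner_product.self_real[OF sip[OF that], of v] by auto
    then show "v = 0" using v definite by blast
  next
    fix s :: "nat \<Rightarrow> 'v"
    assume s: "\<And>n. s n \<in> ?H"
      and Cauchy: "\<And>e. 0 < e \<Longrightarrow> \<exists>N. \<forall>m\<ge>N. \<forall>n\<ge>N. hnorm ?ip (s m - s n) < e"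
    have sV: "s n \<in> V" for n using s by blast
    have "\<exists>N. \<forall>m\<ge>N. \<forall>n\<ge>N. hnorm (p b) (s m - s n) < e" if be: "b \<in> B" "0 < e" for b e
    proof -
      obtain N where N: "\<And>m n. m \<ge> N \<Longrightarrow> n \<ge> N \<Longrightarrow> hnorm ?ip (s m - s n) < e" using Cauchy be by blast
      have "hnorm (p b) (s m - s n) \<le> hnorm ?ip (s m - s n)" for m n
      proof (rule power2_le_imp_le)
        show "(hnorm (p b) (s m - s n))\<^sup>2 \<le> (hnorm ?ip (s m - s n))\<^sup>2"
          using partial[OF diff[OF s s], of "{b}" m n] be diff[OF s s, of m n]
          by (simp add: semi_inner_product.hnorm_power2[OF sip])
        show "0 \<le> hnorm ?ip (s m - s n)" by (rule norm_nonneg[OF diff[OF s s]])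
      qed
      then show ?thesis using N by (meson order_le_less_trans)
    qed
    from compl[OF sV this] obtain l where l: "l \<in> V"
      and lim: "\<And>b. b \<in> B \<Longrightarrow> (\<lambda>n. hnorm (p b) (s n - l)) \<longlonglongrightarrow> 0" by blast
    have slV: "s n - l \<in> V" for n using sV l by (simp add: diff_eq_add_scaleC V_add V_scale)
    \<comment> \<open>As in Fatou's lemma, the Cauchy bound passes to the limit in each finite
      partial sum, and the partial sums then control the infinite sum.\<close>
    have part_l: "(\<Sum>b\<in>F. ?q b (s n - l)) \<le> e\<^sup>2"
      if N: "\<And>m n. m \<ge> N \<Longrightarrow> n \<ge> N \<Longrightarrow> hnorm ?ip (s m - s n) < e"
        and n: "n \<ge> N" and F: "finite F" "F \<subseteq> B" for N e n F
    proof (rule LIMSEQ_le_const2)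
      have "(\<lambda>m. ?q b (s n - s m)) \<longlonglongrightarrow> ?q b (s n - l)" if "b \<in> F" for b
      proof -
        interpret semi_inner_product V "p b" using sip that F by blast
        have "(\<lambda>m. (hnorm (p b) (s n - s m))\<^sup>2) \<longlonglongrightarrow> (hnorm (p b) (s n - l))\<^sup>2"
          using that F by (intro tendsto_power hnorm_tendsto sV l lim) auto
        then show ?thesis using sV l by (simp add: hnorm_power2 diff_in)
      qed
      then show "(\<lambda>m. \<Sum>b\<in>F. ?q b (s n - s m)) \<longlonglongrightarrow> (\<Sum>b\<in>F. ?q b (s n - l))"
        by (intro tendsto_sum)
      have "(\<Sum>b\<in>F. ?q b (s n - s m)) \<le> e\<^sup>2" if "m \<ge> N" for m
      proof -
        have "(\<Sum>b\<in>F. ?q b (s n - s m)) \<le> (hnorm ?ip (s n - s m))\<^sup>2"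
          using F by (intro partial diff s)
        also have "\<dots> \<le> e\<^sup>2"
          using less_imp_le[OF N[OF n that]] norm_nonneg[OF diff[OF s s]] by (rule power_mono)
        finally show ?thesis .
      qed
      then show "\<exists>N. \<forall>m\<ge>N. (\<Sum>b\<in>F. ?q b (s n - s m)) \<le> e\<^sup>2" by blast
    qed
    have sl: "s n - l \<in> ?H" "hnorm ?ip (s n - l) \<le> e"
      if N: "\<And>m n. m \<ge> N \<Longrightarrow> n \<ge> N \<Longrightarrow> hnorm ?ip (s m - s n) < e" and n: "n \<ge> N" and e: "0 < e" for N e n
    proof -
      have summ: "(\<lambda>b. ?q b (s n - l)) summable_on B"
        using part_l[OF N n] nonneg slV
        by (intro nonneg_bdd_above_summable_on bdd_aboveI2[where M="e\<^sup>2"]) auto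
      then show mem: "s n - l \<in> ?H" using slV by blast
      have "(\<Sum>\<^sub>\<infinity>b\<in>B. ?q b (s n - l)) \<le> e\<^sup>2"
        using part_l[OF N n] by (intro infsum_le_finite_sums summ) auto
      then show "hnorm ?ip (s n - l) \<le> e"
        using e unfolding hnorm_def ip_Re[OF mem] by (simp add: real_le_lsqrt)
    qed
    obtain N where N: "\<And>m n. m \<ge> N \<Longrightarrow> n \<ge> N \<Longrightarrow> hnorm ?ip (s m - s n) < 1"
      using Cauchy[of 1] by auto
    have "s N - l \<in> ?H" by (rule sl(1)[where N=N and e=1]) (use N in auto)
    then have "s N - (s N - l) \<in> ?H" by (rule diff[OF s])
    then have lH: "l \<in> ?H" by simp
    have "(\<lambda>n. hnorm ?ip (s n - l)) \<longlonglongrightarrow> 0"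
    proof (rule LIMSEQ_I)
      fix r :: real assume r: "0 < r"
      then obtain N where N: "\<And>m n. m \<ge> N \<Longrightarrow> n \<ge> N \<Longrightarrow> hnorm ?ip (s m - s n) < r / 2"
        using Cauchy[of "r / 2"] by auto
      have "norm (hnorm ?ip (s n - l) - 0) < r" if "n \<ge> N" for n
        using norm_nonneg[OF diff[OF s lH], of n] sl(2)[OF N that] r by simp
      then show "\<exists>no. \<forall>n\<ge>no. norm (hnorm ?ip (s n - l) - 0) < r" by blast
    qed
    then show "\<exists>l\<in>?H. (\<lambda>n. hnorm ?ip (s n - l)) \<longlonglongrightarrow> 0" using lH by blast
  qed (use add scale in blast)+
qed

text \<open>Vectors are functions on the whole type; vanishing outside \<open>I\<close> keeps the
  inner product definite.\<close>

definition ell2 :: "'i set \<Rightarrow> ('i \<Rightarrow> complex) set" where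
  "ell2 I = {v. (\<forall>i. i \<notin> I \<longrightarrow> v i = 0) \<and> (\<lambda>i. (cmod (v i))\<^sup>2) summable_on I}"

definition ell2_ip :: "'i set \<Rightarrow> ('i \<Rightarrow> complex) \<Rightarrow> ('i \<Rightarrow> complex) \<Rightarrow> complex" where
  "ell2_ip I u v = (\<Sum>\<^sub>\<infinity>i\<in>I. u i * cnj (v i))"

lemma chilbert_space_ell2: fixes I :: "'i set" shows "chilbert_space (ell2 I) (ell2_ip I)"
proof -
  let ?V = "{v :: 'i \<Rightarrow> complex. \<forall>i. i \<notin> I \<longrightarrow> v i = 0}"
  let ?p = "\<lambda>i u v. u i * cnj (v i) :: complex"
  have sip: "semi_inner_product ?V (?p i)" for i
    by unfold_locales (auto simp: scaleC_simps algebra_simps)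
  have hn: "hnorm (?p i) v = cmod (v i)" for i v
    by (simp add: hnorm_def cmod_def flip: power2_eq_square)
  have "chilbert_space {v \<in> ?V. (\<lambda>i. Re (?p i v v)) summable_on I} (\<lambda>u v. \<Sum>\<^sub>\<infinity>i\<in>I. ?p i u v)"
  proof (rule chilbert_space_direct_sum[OF _ _ _ sip])
    fix s :: "nat \<Rightarrow> 'i \<Rightarrow> complex"
    assume s: "\<And>n. s n \<in> ?V"
      and C: "\<And>i e. i \<in> I \<Longrightarrow> 0 < e \<Longrightarrow> \<exists>N. \<forall>m\<ge>N. \<forall>n\<ge>N. hnorm (?p i) (s m - s n) < e"
    have "convergent (\<lambda>n. s n i)" if "i \<in> I" for i
      using C[OF that] unfolding hn by (simp add: Cauchy_convergent_iff[symmetric] Cauchy_iff)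
    then have conv: "(\<lambda>n. s n i) \<longlonglongrightarrow> lim (\<lambda>n. s n i)" if "i \<in> I" for i
      using that by (simp add: convergent_LIMSEQ_iff)
    define l where "l i = (if i \<in> I then lim (\<lambda>n. s n i) else 0)" for i
    have "(\<lambda>n. hnorm (?p i) (s n - l)) \<longlonglongrightarrow> 0" if "i \<in> I" for i
      unfolding hn using tendsto_norm_zero[OF LIM_zero[OF conv[OF that]]] that by (simp add: l_def)
    then show "\<exists>l\<in>?V. \<forall>i\<in>I. (\<lambda>n. hnorm (?p i) (s n - l)) \<longlonglongrightarrow> 0"
      by (intro bexI[of _ l]) (auto simp: l_def)
  qed (auto simp: fun_eq_iff scaleC_simps)
  moreover have "Re (z * cnj z) = (cmod z)\<^sup>2" for z
    by (simp add: cmod_power2 flip: power2_eq_square)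
  ultimately show ?thesis by (simp add: ell2_def ell2_ip_def[abs_def])
qed

lemma ell2_norm: "v \<in> ell2 I \<Longrightarrow> (hnorm (ell2_ip I) v)\<^sup>2 = (\<Sum>\<^sub>\<infinity>i\<in>I. (cmod (v i))\<^sup>2)"
proof -
  assume v: "v \<in> ell2 I"
  interpret chilbert_space "ell2 I" "ell2_ip I" by (rule chilbert_space_ell2)
  have "ell2_ip I v v = (\<Sum>\<^sub>\<infinity>i\<in>I. of_real ((cmod (v i))\<^sup>2))"
    unfolding ell2_ip_def by (intro infsum_cong) (simp only: complex_norm_square)
  also have "\<dots> = of_real (\<Sum>\<^sub>\<infinity>i\<in>I. (cmod (v i))\<^sup>2)"
    using v by (intro infsumI has_sum_of_real has_sum_infsum) (simp add: ell2_def)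
  finally show ?thesis using v by (simp add: hnorm_power2)
qed

section \<open>Contractive matrices over the algebra\<close>

lemma fun_sum_apply: "(sum f I) x = (\<Sum>i\<in>I. f i x)"
  by (induction I rule: infinite_finite_induct) auto

lemma sum_lessThan_add: "(\<Sum>p<m + n. f p) = (\<Sum>p<m. f p) + (\<Sum>p<n. f (m + p :: nat))"
  by (induction n) (auto simp: ac_simps)

lemma sum_cond_lessThan:
  fixes m m' :: nat
  assumes "m \<le> m'"
  shows "(\<Sum>p<m'. if p < m then f p else 0) = (\<Sum>p<m. f p)"
proof -
  have "(\<Sum>p<m'. if p < m then f p else 0) = (\<Sum>p\<in>{..<m'} \<inter> {p. p < m}. f p)"
    by (simp add: sum.inter_restrict)
  also have "{..<m'} \<inter> {p. p < m} = {..<m}" using assms by auto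
  finally show ?thesis .
qed

lemma sum_mult_assoc:
  fixes a :: "'k \<Rightarrow> complex"
  shows "(\<Sum>j\<in>J. (\<Sum>k\<in>K. a k * b k j) * c j) = (\<Sum>k\<in>K. a k * (\<Sum>j\<in>J. b k j * c j))"
  unfolding sum_distrib_left sum_distrib_right by (subst sum.swap) (simp add: mult.assoc)

section \<open>Scalar contractions over arbitrary index sets\<close>

abbreviation sqsum :: "'i set \<Rightarrow> ('i \<Rightarrow> complex) \<Rightarrow> real" where
  "sqsum I v \<equiv> \<Sum>i\<in>I. (cmod (v i))\<^sup>2"

lemma cmod_sum_mult_le:
  "(cmod (\<Sum>i\<in>I. a i * b i))\<^sup>2 \<le> sqsum I a * sqsum I b"
proof -
  have "(cmod (\<Sum>i\<in>I. a i * b i))\<^sup>2 \<le> (\<Sum>i\<in>I. cmod (a i) * cmod (b i))\<^sup>2"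
    by (intro power_mono order_trans[OF norm_sum]) (auto simp: norm_mult)
  also have "\<dots> \<le> sqsum I a * sqsum I b"
    by (rule Cauchy_Schwarz_ineq_sum)
  finally show ?thesis .
qed

definition scalar_contraction :: "'j set \<Rightarrow> 'k set \<Rightarrow> ('j \<Rightarrow> 'k \<Rightarrow> complex) \<Rightarrow> bool" where
  "scalar_contraction J K a \<longleftrightarrow>
     (\<forall>v. sqsum J (\<lambda>j. \<Sum>k\<in>K. a j k * v k) \<le> sqsum K v)"

lemma scalar_contractionD:
  "scalar_contraction J K a \<Longrightarrow> sqsum J (\<lambda>j. \<Sum>k\<in>K. a j k * v k) \<le> sqsum K v"
  by (simp add: scalar_contraction_def)

lemma scalar_contraction_mult:
  assumes "scalar_contraction I J a" "scalar_contraction J K b"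
  shows "scalar_contraction I K (\<lambda>i k. \<Sum>j\<in>J. a i j * b j k)"
  unfolding scalar_contraction_def
proof
  fix v
  have "sqsum I (\<lambda>i. \<Sum>k\<in>K. (\<Sum>j\<in>J. a i j * b j k) * v k)
      = sqsum I (\<lambda>i. \<Sum>j\<in>J. a i j * (\<Sum>k\<in>K. b j k * v k))" by (simp only: sum_mult_assoc)
  also have "\<dots> \<le> sqsum J (\<lambda>j. \<Sum>k\<in>K. b j k * v k)" using assms(1) by (rule scalar_contractionD)
  also have "\<dots> \<le> sqsum K v" using assms(2) by (rule scalar_contractionD)
  finally show "sqsum I (\<lambda>i. \<Sum>k\<in>K. (\<Sum>j\<in>J. a i j * b j k) * v k) \<le> sqsum K v" .
qed

lemma scalar_contraction_cong:
  assumes "scalar_contraction J K a" "\<And>j k. j \<in> J \<Longrightarrow> k \<in> K \<Longrightarrow> a j k = b j k"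
  shows "scalar_contraction J K b"
  using assms by (simp add: scalar_contraction_def)

text \<open>Testing with \<open>u\<close> the conjugate of \<open>a v\<close> gives
  \<open>W\<^sup>2 \<le> W * sqsum K v\<close>. The bound is bilinear because compressing a matrix
  by a row and a column produces sums of this shape.\<close>

lemma scalar_contraction_of_bilinear_bound:
  assumes "\<And>u v. (cmod (\<Sum>j\<in>J. \<Sum>k\<in>K. u j * a j k * v k))\<^sup>2
    \<le> sqsum J u * sqsum K v"
  shows "scalar_contraction J K a"
  unfolding scalar_contraction_def
proof
  fix v
  define w where "w j = (\<Sum>k\<in>K. a j k * v k)" for j
  define W where "W = sqsum J w"
  have W0: "0 \<le> W" by (simp add: W_def sum_nonneg)
  have "(\<Sum>j\<in>J. \<Sum>k\<in>K. cnj (w j) * a j k * v k) = (\<Sum>j\<in>J. cnj (w j) * w j)"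
    by (simp add: w_def sum_distrib_left mult.assoc)
  also have "\<dots> = of_real W"
    unfolding W_def of_real_sum by (intro sum.cong refl) (simp only: complex_norm_square mult.commute)
  finally have eq: "(\<Sum>j\<in>J. \<Sum>k\<in>K. cnj (w j) * a j k * v k) = of_real W" .
  have "(cmod (of_real W))\<^sup>2 \<le> sqsum J (\<lambda>j. cnj (w j)) * sqsum K v"
    using assms[of "\<lambda>j. cnj (w j)" v] by (simp only: eq)
  then have "W\<^sup>2 \<le> W * sqsum K v"
    by (simp only: complex_mod_cnj norm_of_real power2_abs W_def[symmetric])
  then have "W \<le> sqsum K v"
    using W0 by (cases "W = 0") (auto simp: power2_eq_square sum_nonneg)
  then show "sqsum J (\<lambda>j. \<Sum>k\<in>K. a j k * v k) \<le> sqsum K v"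
    by (simp add: W_def w_def)
qed

text \<open>The bilinear bound treats rows and columns alike, so the transpose serves where the
  adjoint might be expected.\<close>

lemma scalar_contraction_transpose:
  assumes "scalar_contraction J K a"
  shows "scalar_contraction K J (\<lambda>k j. a j k)"
proof (rule scalar_contraction_of_bilinear_bound)
  fix u v
  have "(\<Sum>k\<in>K. \<Sum>j\<in>J. u k * a j k * v j) = (\<Sum>j\<in>J. v j * (\<Sum>k\<in>K. a j k * u k))"
    by (subst sum.swap) (simp add: sum_distrib_left ac_simps)
  then have "(cmod (\<Sum>k\<in>K. \<Sum>j\<in>J. u k * a j k * v j))\<^sup>2
      \<le> sqsum J v * sqsum J (\<lambda>j. \<Sum>k\<in>K. a j k * u k)"
    using cmod_sum_mult_le by simp
  also have "\<dots> \<le> sqsum J v * sqsum K u"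
    using assms by (intro mult_left_mono scalar_contractionD sum_nonneg) auto
  finally show "(cmod (\<Sum>k\<in>K. \<Sum>j\<in>J. u k * a j k * v j))\<^sup>2
      \<le> sqsum K u * sqsum J v" by (simp add: mult.commute)
qed

lemma scalar_contraction_inj:
  assumes "finite J" "finite K" "inj_on \<phi> J"
  shows "scalar_contraction J (K :: 'b set) (\<lambda>j k. if k = \<phi> j then 1 else 0)"
  unfolding scalar_contraction_def
proof
  fix v :: "'b \<Rightarrow> complex"
  have "sqsum J (\<lambda>j. \<Sum>k\<in>K. (if k = \<phi> j then 1 else 0) * v k)
      = (\<Sum>j\<in>J. if \<phi> j \<in> K then (cmod (v (\<phi> j)))\<^sup>2 else 0)"
    using assms by (intro sum.cong) (auto simp: if_distrib[of "\<lambda>x. x * _"] cong: if_cong)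
  also have "\<dots> = (\<Sum>k\<in>\<phi> ` J. if k \<in> K then (cmod (v k))\<^sup>2 else 0)"
    using assms(3) by (simp add: sum.reindex)
  also have "\<dots> = (\<Sum>k\<in>\<phi> ` J \<inter> K. (cmod (v k))\<^sup>2)"
    using assms by (simp add: sum.inter_restrict)
  also have "\<dots> \<le> sqsum K v"
    using assms by (intro sum_mono2) auto
  finally show "sqsum J (\<lambda>j. \<Sum>k\<in>K. (if k = \<phi> j then 1 else 0) * v k) \<le> sqsum K v" .
qed

lemma scalar_contraction_reindex_rows:
  assumes "scalar_contraction J K a" "finite J" "inj_on \<phi> J'" "\<phi> ` J' \<subseteq> J"
  shows "scalar_contraction J' K (\<lambda>j k. a (\<phi> j) k)"
  unfolding scalar_contraction_def
proof
  fix v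
  have "sqsum J' (\<lambda>j. \<Sum>k\<in>K. a (\<phi> j) k * v k) = sqsum (\<phi> ` J') (\<lambda>j. \<Sum>k\<in>K. a j k * v k)"
    using assms(3) by (simp add: sum.reindex)
  also have "\<dots> \<le> sqsum J (\<lambda>j. \<Sum>k\<in>K. a j k * v k)"
    using assms by (intro sum_mono2) auto
  also have "\<dots> \<le> sqsum K v" using assms(1) by (rule scalar_contractionD)
  finally show "sqsum J' (\<lambda>j. \<Sum>k\<in>K. a (\<phi> j) k * v k) \<le> sqsum K v" .
qed

lemma scalar_contraction_reindex:
  assumes "scalar_contraction J K a" "finite J" "finite K"
    "inj_on \<phi> J'" "\<phi> ` J' \<subseteq> J" "inj_on \<psi> K'" "\<psi> ` K' \<subseteq> K"
  shows "scalar_contraction J' K' (\<lambda>j k. a (\<phi> j) (\<psi> k))"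
  using scalar_contraction_transpose[OF scalar_contraction_reindex_rows[OF
      scalar_contraction_transpose[OF scalar_contraction_reindex_rows[OF assms(1,2,4,5)]] assms(3,6,7)]] .

lemma scalar_contraction_extend:
  fixes m :: nat
  assumes "scalar_contraction J {..<m} a"
  shows "scalar_contraction J {..<m'} (\<lambda>j p. if p < m then a j p else 0)"
proof (rule scalar_contraction_cong)
  show "scalar_contraction J {..<m'} (\<lambda>j p. \<Sum>q<m. a j q * (if p = q then 1 else 0))"
    using assms by (intro scalar_contraction_mult scalar_contraction_inj) auto
  show "(\<Sum>q<m. a j q * (if p = q then 1 else 0)) = (if p < m then a j p else 0)" for j p
    by (simp add: if_distrib[of "(*) _"] cong: if_cong)
qed

lemma scalar_contraction_direct_sum:
  fixes m :: nat
  assumes a: "scalar_contraction J1 {..<m} a" and b: "scalar_contraction J2 {..<m} b"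
    and fin: "finite J1" "finite J2" "J1 \<inter> J2 = {}"
  shows "scalar_contraction (J1 \<union> J2) {..<m + m}
    (\<lambda>j p. if j \<in> J1 then (if p < m then a j p else 0) else (if p < m then 0 else b j (p - m)))"
    (is "scalar_contraction _ _ ?c")
  unfolding scalar_contraction_def
proof
  fix v
  have *: "(\<Sum>p<m + m. ?c j p * v p) =
      (if j \<in> J1 then \<Sum>p<m. a j p * v p else \<Sum>p<m. b j p * v (m + p))" for j
    unfolding sum_lessThan_add by simp
  have "sqsum (J1 \<union> J2) (\<lambda>j. \<Sum>p<m + m. ?c j p * v p)
      = sqsum J1 (\<lambda>j. \<Sum>p<m. a j p * v p) + sqsum J2 (\<lambda>j. \<Sum>p<m. b j p * v (m + p))"
    unfolding * using fin by (subst sum.union_disjoint) (auto intro!: sum.cong)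
  also have "\<dots> \<le> sqsum {..<m} v + sqsum {..<m} (\<lambda>p. v (m + p))"
    by (intro add_mono scalar_contractionD a b)
  also have "\<dots> = sqsum {..<m + m} v" by (simp add: sum_lessThan_add)
  finally show "sqsum (J1 \<union> J2) (\<lambda>j. \<Sum>p<m + m. ?c j p * v p) \<le> sqsum {..<m + m} v" .
qed

lemma scalar_mat_norm_le:
  assumes "0 \<le> c" "\<And>v. sqsum {..<m} (\<lambda>i. \<Sum>k<n. a i k * v k) \<le> c\<^sup>2 * sqsum {..<n} v"
  shows "scalar_mat_norm (mat m n (\<lambda>(i, k). a i k)) \<le> c"
    and "0 \<le> scalar_mat_norm (mat m n (\<lambda>(i, k). a i k))"
proof -
  let ?L = "mat m n (\<lambda>(i, k). a i k)"
  let ?S = "{c. 0 \<le> c \<and> (\<forall>v\<in>carrier_vec (dim_col ?L). euclidean_norm (?L *\<^sub>v v) \<le> c * euclidean_norm v)}"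
  have "euclidean_norm (?L *\<^sub>v v) \<le> c * euclidean_norm v" if "v \<in> carrier_vec n" for v
  proof -
    have "sqsum {..<m} (\<lambda>i. (?L *\<^sub>v v) $ i) = sqsum {..<m} (\<lambda>i. \<Sum>k<n. a i k * v $ k)"
      using that by (intro sum.cong) (auto simp: scalar_prod_def lessThan_atLeast0)
    also have "\<dots> \<le> c\<^sup>2 * sqsum {..<n} (\<lambda>k. v $ k)" by (rule assms(2))
    finally have "sqrt (sqsum {..<m} (\<lambda>i. (?L *\<^sub>v v) $ i)) \<le> sqrt (c\<^sup>2 * sqsum {..<n} (($) v))"
      by (rule real_sqrt_le_mono)
    then show ?thesis using that assms(1) by (simp add: euclidean_norm_def real_sqrt_mult)
  qed
  then have c: "c \<in> ?S" using assms(1) by simp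
  then show "scalar_mat_norm ?L \<le> c"
    unfolding scalar_mat_norm_def by (rule cInf_lower) (auto intro: bdd_belowI[of _ 0])
  show "0 \<le> scalar_mat_norm ?L"
    unfolding scalar_mat_norm_def using c by (intro cInf_greatest) auto
qed

lemma matsI: "G \<in> carrier_mat n n \<Longrightarrow> (\<And>i j. i < n \<Longrightarrow> j < n \<Longrightarrow> G $$ (i, j) \<in> A) \<Longrightarrow> G \<in> mats n A"
  unfolding mats_def by (auto dest: elements_matD)

lemma matsD:
  assumes "G \<in> mats n A"
  shows "G \<in> carrier_mat n n" "\<And>i j. i < n \<Longrightarrow> j < n \<Longrightarrow> G $$ (i, j) \<in> A"
proof -
  show G: "G \<in> carrier_mat n n" using assms by (simp add: mats_def)
  show "G $$ (i, j) \<in> A" if "i < n" "j < n" for i j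
    using assms elements_matI[OF G that refl] by (auto simp: mats_def)
qed

section \<open>Matrices over the algebra in coordinates, and evaluations\<close>

context operator_algebra_of_functions
begin

lemma zero_in_alg: "0 \<in> A"
  using const_mem[of 0] by (simp add: zero_fun_def)

lemma sum_in_alg: "(\<And>i. i \<in> I \<Longrightarrow> f i \<in> A) \<Longrightarrow> sum f I \<in> A"
  by (induction I rule: infinite_finite_induct) (auto simp: zero_in_alg add_mem)

lemma mult_in_mats:
  assumes "G \<in> mats n A" "H \<in> mats n A"
  shows "G * H \<in> mats n A"
    and "\<And>i j x. i < n \<Longrightarrow> j < n \<Longrightarrow> ((G * H) $$ (i, j)) x = (\<Sum>k<n. (G $$ (i, k)) x * (H $$ (k, j)) x)"
proof -
  note G = matsD[OF assms(1)] and H = matsD[OF assms(2)]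
  have e: "(G * H) $$ (i, j) = (\<Sum>k<n. G $$ (i, k) * H $$ (k, j))" if "i < n" "j < n" for i j
    using G(1) H(1) that by (auto simp: scalar_prod_def lessThan_atLeast0 intro!: sum.cong)
  have "(G * H) $$ (i, j) \<in> A" if "i < n" "j < n" for i j
    unfolding e[OF that] using that by (intro sum_in_alg mult_mem G(2) H(2)) auto
  then show "G * H \<in> mats n A"
    using G(1) H(1) by (intro matsI) auto
  show "((G * H) $$ (i, j)) x = (\<Sum>k<n. (G $$ (i, k)) x * (H $$ (k, j)) x)" if "i < n" "j < n" for i j x
    by (simp add: e[OF that] fun_sum_apply)
qed

lemma scale_in_mats:
  assumes "G \<in> mats n A"
  shows "(\<lambda>x. c) \<cdot>\<^sub>m G \<in> mats n A"
  using matsD[OF assms] by (intro matsI) (auto intro!: mult_mem const_mem)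

lemma bimodule_exists:
  assumes m: "0 < m'" "0 < m" and G: "G \<in> mats m A"
    and a: "0 \<le> c" "\<And>v. sqsum {..<m'} (\<lambda>i. \<Sum>k<m. a i k * v k) \<le> c\<^sup>2 * sqsum {..<m} v"
    and b: "0 \<le> d" "\<And>v. sqsum {..<m} (\<lambda>i. \<Sum>k<m'. b i k * v k) \<le> d\<^sup>2 * sqsum {..<m'} v"
  shows "\<exists>G'\<in>mats m' A. nrm G' \<le> c * nrm G * d \<and>
    (\<forall>i<m'. \<forall>j<m'. \<forall>x. (G' $$ (i, j)) x = (\<Sum>p<m. \<Sum>q<m. a i p * (G $$ (p, q)) x * b q j))"
proof -
  let ?L = "mat m' m (\<lambda>(i, k). a i k)" and ?M = "mat m m' (\<lambda>(i, k). b i k)"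
  let ?G = "constant_mat ?L * G * constant_mat ?M"
  note G' = matsD[OF G]
  have e: "?G $$ (i, j) = (\<Sum>q<m. (\<Sum>p<m. (\<lambda>x. a i p) * G $$ (p, q)) * (\<lambda>x. b q j))"
    if "i < m'" "j < m'" for i j
    using G'(1) that
    by (auto simp: scalar_prod_def lessThan_atLeast0 constant_mat_def intro!: sum.cong)
  have "?G \<in> mats m' A"
  proof (rule matsI)
    show "?G \<in> carrier_mat m' m'" using G'(1) by (auto simp: constant_mat_def)
  qed (auto simp: e intro!: sum_in_alg mult_mem const_mem G')
  moreover have "nrm ?G \<le> scalar_mat_norm ?L * nrm G * scalar_mat_norm ?M"
    using m G by (intro nrm_bimodule) auto
  then have "nrm ?G \<le> c * nrm G * d"
    by (rule order_trans) (intro mult_mono scalar_mat_norm_le[OF a] scalar_mat_norm_le[OF b] nrm_nonneg[OF m(2) G]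
      mult_nonneg_nonneg a(1) b(1) order_refl)
  moreover have "(?G $$ (i, j)) x = (\<Sum>p<m. \<Sum>q<m. a i p * (G $$ (p, q)) x * b q j)"
    if "i < m'" "j < m'" for i j x
    unfolding e[OF that] by (subst sum.swap) (simp add: fun_sum_apply sum_distrib_right)
  ultimately show ?thesis by blast
qed

lemma compression_exists:
  assumes "0 < m'" "0 < m" "G \<in> mats m A" "nrm G \<le> 1"
    and "scalar_contraction {..<m'} {..<m} a" "scalar_contraction {..<m} {..<m'} b"
  shows "\<exists>G'\<in>mats m' A. nrm G' \<le> 1 \<and>
    (\<forall>i<m'. \<forall>j<m'. \<forall>x. (G' $$ (i, j)) x = (\<Sum>p<m. \<Sum>q<m. a i p * (G $$ (p, q)) x * b q j))"
  using bimodule_exists[OF assms(1-3), of 1 a 1 b] assms(4-6)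
  by (auto simp: scalar_contraction_def) (meson order_trans)

lemma nrm_one_mat: "0 < m \<Longrightarrow> nrm (1\<^sub>m m) = 1 \<and> 1\<^sub>m m \<in> mats m A"
proof (induction m rule: nat_induct_non_zero)
  case 1
  have "1\<^sub>m 1 = mat_of_elem (\<lambda>x :: 'x. 1 :: complex)"
    by (intro eq_matI) (auto simp: mat_of_elem_def one_fun_def)
  moreover have "1\<^sub>m 1 \<in> mats 1 A"
    by (intro matsI) (auto simp: one_fun_def const_mem)
  ultimately show ?case using nrm_one by simp
next
  case (Suc m)
  have 1: "1\<^sub>m 1 = mat_of_elem (\<lambda>x :: 'x. 1 :: complex)"
    by (intro eq_matI) (auto simp: mat_of_elem_def one_fun_def)
  have "1\<^sub>m 1 \<in> mats 1 A"
    by (intro matsI) (auto simp: one_fun_def const_mem)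
  then have "nrm (1\<^sub>m m \<oplus>\<^sub>d 1\<^sub>m 1) = max (nrm (1\<^sub>m m)) (nrm (1\<^sub>m 1))"
    using Suc by (intro nrm_direct_sum) auto
  moreover have "1\<^sub>m m \<oplus>\<^sub>d 1\<^sub>m 1 = (1\<^sub>m (Suc m) :: ('x \<Rightarrow> complex) mat)"
    by (simp add: direct_sum_mat_def)
  moreover have "1\<^sub>m (Suc m) \<in> mats (Suc m) A"
    by (intro matsI) (auto simp: one_fun_def zero_in_alg const_mem one_mat_def)
  moreover have "nrm (1\<^sub>m 1) = 1" unfolding 1 by (rule nrm_one)
  ultimately show ?case using Suc by simp
qed

text \<open>Characters are contractive because \<open>|f(x)|\<^sup>k \<le> c \<parallel>f\<parallel>\<^sup>k\<close> for all \<open>k\<close>.\<close>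

lemma cmod_le_nrm:
  assumes f: "f \<in> A"
  shows "cmod (f x) \<le> nrm (mat_of_elem f)"
proof -
  obtain c where c: "\<And>g. g \<in> A \<Longrightarrow> cmod (g x) \<le> c * nrm (mat_of_elem g)"
    using bounded_evaluations by blast
  let ?r = "nrm (mat_of_elem f)"
  have mem: "mat_of_elem g \<in> mats 1 A" if "g \<in> A" for g
    using that by (intro matsI) (auto simp: mat_of_elem_def)
  have r0: "0 \<le> ?r" using mem[OF f] by (intro nrm_nonneg) auto
  have pow: "(\<lambda>x. f x ^ k) \<in> A \<and> nrm (mat_of_elem (\<lambda>x. f x ^ k)) \<le> ?r ^ k" for k
  proof (induction k)
    case 0
    then show ?case using const_mem[of 1] nrm_one by simp
  next
    case (Suc k)
    have eq: "(\<lambda>x. f x ^ Suc k) = f * (\<lambda>x. f x ^ k)" by auto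
    have "mat_of_elem (f * (\<lambda>x. f x ^ k)) = mat_of_elem f * mat_of_elem (\<lambda>x. f x ^ k)"
      by (intro eq_matI) (auto simp: mat_of_elem_def scalar_prod_def)
    then have "nrm (mat_of_elem (f * (\<lambda>x. f x ^ k))) \<le> ?r * nrm (mat_of_elem (\<lambda>x. f x ^ k))"
      using nrm_mult[OF _ mem[OF f] mem] Suc by simp
    also have "\<dots> \<le> ?r * ?r ^ k" using Suc r0 by (intro mult_left_mono) auto
    finally show ?case using f Suc mult_mem unfolding eq by simp
  qed
  have bound: "cmod (f x) ^ k \<le> c * ?r ^ k" for k
  proof -
    have c0: "0 \<le> c" using c[OF const_mem[of 1]] nrm_one by simp
    have "cmod (f x) ^ k \<le> c * nrm (mat_of_elem (\<lambda>x. f x ^ k))"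
      using c[of "\<lambda>x. f x ^ k"] pow by (simp add: norm_power)
    also have "\<dots> \<le> c * ?r ^ k" using pow c0 by (intro mult_left_mono) auto
    finally show ?thesis .
  qed
  show ?thesis
  proof (rule ccontr)
    assume "\<not> ?thesis"
    then have less: "?r < cmod (f x)" by simp
    then have "?r \<noteq> 0" using bound[of 1] by auto
    with r0 have rpos: "0 < ?r" by simp
    then have "1 < cmod (f x) / ?r" using less by simp
    from real_arch_pow[OF this] obtain k where "c < (cmod (f x) / ?r) ^ k" by blast
    then show False using bound[of k] rpos by (simp add: power_divide field_simps)
  qed
qed

text \<open>A row \<open>u\<close> and a column \<open>v\<close> compress \<open>G\<close> to a
  single element of the algebra, to which contractivity of characters applies: evaluations are
  contractive at every matrix level.\<close>

lemma eval_scalar_contraction: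
  assumes m: "0 < m" and G: "G \<in> mats m A" "nrm G \<le> 1"
  shows "scalar_contraction {..<m} {..<m} (\<lambda>p q. (G $$ (p, q)) x)"
proof (rule scalar_contraction_of_bilinear_bound)
  fix u v :: "nat \<Rightarrow> complex"
  let ?u = "\<Sum>p<m. (cmod (u p))\<^sup>2" and ?v = "\<Sum>q<m. (cmod (v q))\<^sup>2"
  have nn: "0 \<le> ?u" "0 \<le> ?v" by (auto intro: sum_nonneg)
  have "\<exists>G'\<in>mats 1 A. nrm G' \<le> sqrt ?u * nrm G * sqrt ?v \<and>
    (\<forall>i<1. \<forall>j<1. \<forall>x. (G' $$ (i, j)) x = (\<Sum>p<m. \<Sum>q<m. u p * (G $$ (p, q)) x * v q))"
  proof (rule bimodule_exists)
    fix w
    show "sqsum {..<1::nat} (\<lambda>i. \<Sum>k<m. u k * w k) \<le> (sqrt ?u)\<^sup>2 * sqsum {..<m} w"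
      using cmod_sum_mult_le nn by simp
    show "sqsum {..<m} (\<lambda>i. \<Sum>k<1. v i * w k) \<le> (sqrt ?v)\<^sup>2 * sqsum {..<1::nat} w"
      using nn by (simp add: norm_mult power_mult_distrib sum_distrib_right)
  qed (use m G nn in auto)
  then obtain G' where G': "G' \<in> mats 1 A" "nrm G' \<le> sqrt ?u * nrm G * sqrt ?v"
    "(G' $$ (0, 0)) x = (\<Sum>p<m. \<Sum>q<m. u p * (G $$ (p, q)) x * v q)" by auto
  have "mat_of_elem (G' $$ (0, 0)) = G'"
    using matsD(1)[OF G'(1)] by (intro eq_matI) (auto simp: mat_of_elem_def)
  then have "cmod ((G' $$ (0, 0)) x) \<le> nrm G'"
    using cmod_le_nrm[OF matsD(2)[OF G'(1)], of 0 0 x] by simp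
  also have "\<dots> \<le> sqrt ?u * 1 * sqrt ?v"
    using G'(2) G(2) nn nrm_nonneg[OF m G(1)] by (elim order_trans) (intro mult_mono mult_nonneg_nonneg, auto)
  finally have "(cmod ((G' $$ (0, 0)) x))\<^sup>2 \<le> (sqrt ?u * sqrt ?v)\<^sup>2"
    by (intro power_mono) auto
  then show "(cmod (\<Sum>p<m. \<Sum>q<m. u p * (G $$ (p, q)) x * v q))\<^sup>2 \<le> ?u * ?v"
    using nn by (simp add: G'(3) power_mult_distrib)
qed

text \<open>Scalar factors on both sides turn the norms on square matrices into a calculus of rectangular
  matrices over arbitrary finite index sets.\<close>

definition compression_of ::
  "nat \<Rightarrow> 'j set \<Rightarrow> 'k set \<Rightarrow> ('j \<Rightarrow> 'k \<Rightarrow> 'x \<Rightarrow> complex) \<Rightarrow> ('x \<Rightarrow> complex) mat \<Rightarrow>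
    ('j \<Rightarrow> nat \<Rightarrow> complex) \<Rightarrow> (nat \<Rightarrow> 'k \<Rightarrow> complex) \<Rightarrow> bool" where
  "compression_of m J K T G a b \<longleftrightarrow> G \<in> mats m A \<and> nrm G \<le> 1 \<and>
     scalar_contraction J {..<m} a \<and> scalar_contraction {..<m} K b \<and>
     (\<forall>j\<in>J. \<forall>k\<in>K. \<forall>x. T j k x = (\<Sum>p<m. \<Sum>q<m. a j p * (G $$ (p, q)) x * b q k))"

text \<open>For \<open>J = K = {..<n}\<close> with \<open>0 < n\<close> this is the unit ball of
  M_n(A), by \<open>contractive_mat\<close> and \<open>mat_of_contractive\<close>. General index
  sets let sum types and slots express the block structure of a system.\<close>

definition contractive :: "'j set \<Rightarrow> 'k set \<Rightarrow> ('j \<Rightarrow> 'k \<Rightarrow> 'x \<Rightarrow> complex) \<Rightarrow> bool" where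
  "contractive J K T \<longleftrightarrow> finite J \<and> finite K \<and>
     (\<exists>m>0. \<exists>G a b. compression_of m J K T G a b)"

lemma compression_ofD:
  assumes "compression_of m J K T G a b"
  shows "G \<in> mats m A" "nrm G \<le> 1" "scalar_contraction J {..<m} a" "scalar_contraction {..<m} K b"
    and "\<And>j k x. j \<in> J \<Longrightarrow> k \<in> K \<Longrightarrow> T j k x = (\<Sum>p<m. \<Sum>q<m. a j p * (G $$ (p, q)) x * b q k)"
  using assms by (simp_all add: compression_of_def)

lemma contractive_compression:
  "contractive J K T \<Longrightarrow> \<exists>m>0. \<exists>G a b. compression_of m J K T G a b"
  by (simp add: contractive_def)

text \<open>Two matrices factor through middle matrices of different sizes; before they are
  multiplied or added directly, these are brought to a common size by bordering with zeros, a
  compression that does not raise the norm.\<close>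

lemma contractive_padded:
  assumes "contractive J K T"
  shows "\<exists>m0>0. \<forall>m\<ge>m0. \<exists>G a b. compression_of m J K T G a b"
proof -
  obtain m0 G a b where m0: "0 < m0" and c: "compression_of m0 J K T G a b"
    using contractive_compression[OF assms] by blast
  note G = compression_ofD(1,2)[OF c] and a = compression_ofD(3)[OF c]
    and b = compression_ofD(4)[OF c] and T = compression_ofD(5)[OF c]
  have "\<exists>G a b. compression_of m J K T G a b" if m: "m \<ge> m0" for m
  proof -
    let ?i = "\<lambda>p q :: nat. if q = p then 1 else 0 :: complex"
    have "\<exists>G'\<in>mats m A. nrm G' \<le> 1 \<and>
      (\<forall>i<m. \<forall>j<m. \<forall>x. (G' $$ (i, j)) x = (\<Sum>p<m0. \<Sum>q<m0. ?i i p * (G $$ (p, q)) x * ?i q j))"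
      using m m0 G by (intro compression_exists scalar_contraction_inj[where \<phi>="\<lambda>p. p"]) auto
    then obtain G' where G': "G' \<in> mats m A" "nrm G' \<le> 1"
      and e: "\<And>i j x. i < m \<Longrightarrow> j < m \<Longrightarrow>
        (G' $$ (i, j)) x = (\<Sum>p<m0. \<Sum>q<m0. ?i i p * (G $$ (p, q)) x * ?i q j)" by blast
    have e': "(G' $$ (i, j)) x = (G $$ (i, j)) x" if "i < m0" "j < m0" for i j x
    proof -
      have "(G' $$ (i, j)) x = (\<Sum>p<m0. \<Sum>q<m0. if p = i \<and> q = j then (G $$ (p, q)) x else 0)"
        using e[of i j x] that m by (auto intro!: sum.cong)
      also have "\<dots> = (\<Sum>p<m0. if p = i then (G $$ (p, j)) x else 0)"
        using that by (intro sum.cong) auto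
      finally show ?thesis using that by simp
    qed
    define a' where "a' = (\<lambda>j p. if p < m0 then a j p else 0)"
    define b' where "b' = (\<lambda>q k. if q < m0 then b q k else 0)"
    have "scalar_contraction J {..<m} a'"
      unfolding a'_def by (rule scalar_contraction_extend[OF a])
    moreover have "scalar_contraction {..<m} K b'"
      unfolding b'_def
      by (rule scalar_contraction_transpose[OF scalar_contraction_extend[OF scalar_contraction_transpose[OF b]]])
    moreover have "T j k x = (\<Sum>p<m. \<Sum>q<m. a' j p * (G' $$ (p, q)) x * b' q k)"
      if "j \<in> J" "k \<in> K" for j k x
    proof -
      have "(\<Sum>p<m. \<Sum>q<m. a' j p * (G' $$ (p, q)) x * b' q k)
          = (\<Sum>p<m. if p < m0 then \<Sum>q<m. if q < m0 then a j p * (G $$ (p, q)) x * b q k else 0 else 0)"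
        by (intro sum.cong) (auto simp: a'_def b'_def e' intro!: sum.cong)
      also have "\<dots> = T j k x" unfolding T[OF that] by (simp add: sum_cond_lessThan[OF m])
      finally show ?thesis by simp
    qed
    ultimately have "compression_of m J K T G' a' b'" using G' by (simp add: compression_of_def)
    then show ?thesis by blast
  qed
  then show ?thesis using m0 by blast
qed

lemma contractive_finite: "contractive J K T \<Longrightarrow> finite J" "contractive J K T \<Longrightarrow> finite K"
  by (auto simp: contractive_def)

lemma contractive_pair_padded:
  assumes "contractive J K T" "contractive J' K' T'"
  shows "\<exists>m>0. (\<exists>G a b. compression_of m J K T G a b) \<and> (\<exists>G a b. compression_of m J' K' T' G a b)"
proof -
  obtain m1 where m1: "0 < m1" "\<And>m. m1 \<le> m \<Longrightarrow> \<exists>G a b. compression_of m J K T G a b"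
    using contractive_padded[OF assms(1)] by blast
  obtain m2 where m2: "\<And>m. m2 \<le> m \<Longrightarrow> \<exists>G a b. compression_of m J' K' T' G a b"
    using contractive_padded[OF assms(2)] by blast
  from m1 m2[of "max m1 m2"] show ?thesis by (intro exI[of _ "max m1 m2"]) auto
qed

lemma contractive_eval:
  assumes "contractive J K T"
  shows "scalar_contraction J K (\<lambda>j k. T j k x)"
proof -
  obtain m G a b where m: "0 < m" and c: "compression_of m J K T G a b"
    using contractive_compression[OF assms] by blast
  note G = compression_ofD(1,2)[OF c] and a = compression_ofD(3)[OF c]
    and b = compression_ofD(4)[OF c] and T = compression_ofD(5)[OF c]
  have "scalar_contraction J K (\<lambda>j k. \<Sum>q<m. (\<Sum>p<m. a j p * (G $$ (p, q)) x) * b q k)"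
    by (intro scalar_contraction_mult[OF scalar_contraction_mult[OF a eval_scalar_contraction[OF m G]] b])
  then show ?thesis
  proof (rule scalar_contraction_cong)
    show "(\<Sum>q<m. (\<Sum>p<m. a j p * (G $$ (p, q)) x) * b q k) = T j k x" if "j \<in> J" "k \<in> K" for j k
      unfolding T[OF that] sum_distrib_right by (rule sum.swap)
  qed
qed

lemma contractive_reindex:
  assumes T: "contractive J K T"
    and "inj_on \<phi> J'" "\<phi> ` J' \<subseteq> J" "inj_on \<psi> K'" "\<psi> ` K' \<subseteq> K"
    and T': "\<And>j k x. j \<in> J' \<Longrightarrow> k \<in> K' \<Longrightarrow> T' j k x = T (\<phi> j) (\<psi> k) x"
  shows "contractive J' K' T'"
proof -
  obtain m G a b where m: "0 < m" and c: "compression_of m J K T G a b"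
    using contractive_compression[OF T] by blast
  note G = compression_ofD(1,2)[OF c] and a = compression_ofD(3)[OF c]
    and b = compression_ofD(4)[OF c] and e = compression_ofD(5)[OF c]
  note fin = contractive_finite[OF T]
  have "finite J'" "finite K'"
    using fin assms(2-5) by (auto dest: finite_subset intro: finite_imageD)
  moreover have "scalar_contraction J' {..<m} (\<lambda>j. a (\<phi> j))"
    by (rule scalar_contraction_reindex_rows[OF a fin(1) assms(2,3)])
  moreover have "scalar_contraction {..<m} K' (\<lambda>q k. b q (\<psi> k))"
    by (rule scalar_contraction_reindex[OF b, where \<phi>="\<lambda>p. p"]) (use fin assms(4,5) in simp_all)
  moreover have "\<forall>j\<in>J'. \<forall>k\<in>K'. \<forall>x. T' j k x = (\<Sum>p<m. \<Sum>q<m. a (\<phi> j) p * (G $$ (p, q)) x * b q (\<psi> k))"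
  proof (intro ballI allI)
    fix j k x assume jk: "j \<in> J'" "k \<in> K'"
    then have "\<phi> j \<in> J" "\<psi> k \<in> K" using assms(3,5) by auto
    then show "T' j k x = (\<Sum>p<m. \<Sum>q<m. a (\<phi> j) p * (G $$ (p, q)) x * b q (\<psi> k))"
      using T'[OF jk] e by simp
  qed
  ultimately have "compression_of m J' K' T' G (\<lambda>j. a (\<phi> j)) (\<lambda>q k. b q (\<psi> k))" "finite J'" "finite K'"
    using G by (simp_all add: compression_of_def)
  then show ?thesis unfolding contractive_def using m by blast
qed

lemma contractive_cong:
  "contractive J K T \<Longrightarrow> (\<And>j k x. j \<in> J \<Longrightarrow> k \<in> K \<Longrightarrow> T' j k x = T j k x) \<Longrightarrow> contractive J K T'"
  by (rule contractive_reindex[where \<phi>="\<lambda>j. j" and \<psi>="\<lambda>k. k"]) auto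

lemma contractive_mat:
  assumes "0 < n" "G \<in> mats n A" "nrm G \<le> 1"
  shows "contractive {..<n} {..<n} (\<lambda>i j. G $$ (i, j))"
proof -
  let ?i = "\<lambda>p q :: nat. if q = p then 1 else 0 :: complex"
  have id: "scalar_contraction {..<n} {..<n} ?i"
    using scalar_contraction_inj[where \<phi>="\<lambda>p::nat. p" and J="{..<n}" and K="{..<n}"] by simp
  have "(G $$ (j, k)) x = (\<Sum>p<n. \<Sum>q<n. ?i j p * (G $$ (p, q)) x * ?i q k)" if "j < n" "k < n" for j k x
  proof -
    have "(\<Sum>p<n. \<Sum>q<n. ?i j p * (G $$ (p, q)) x * ?i q k)
        = (\<Sum>p<n. \<Sum>q<n. if q = k then if p = j then (G $$ (p, q)) x else 0 else 0)"
      by (intro sum.cong refl) auto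
    then show ?thesis using that by simp
  qed
  then have "compression_of n {..<n} {..<n} (\<lambda>i j. G $$ (i, j)) G ?i ?i"
    using assms id by (simp add: compression_of_def)
  then show ?thesis unfolding contractive_def using assms(1) by blast
qed

lemma mat_of_contractive:
  assumes "0 < n" "contractive {..<n} {..<n} T"
  shows "\<exists>G\<in>mats n A. nrm G \<le> 1 \<and> (\<forall>i<n. \<forall>j<n. G $$ (i, j) = T i j)"
proof -
  obtain m G a b where m: "0 < m" and c: "compression_of m {..<n} {..<n} T G a b"
    using contractive_compression[OF assms(2)] by blast
  obtain G' where G': "G' \<in> mats n A" "nrm G' \<le> 1"
    "\<And>i j x. i < n \<Longrightarrow> j < n \<Longrightarrow> (G' $$ (i, j)) x = (\<Sum>p<m. \<Sum>q<m. a i p * (G $$ (p, q)) x * b q j)"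
    using compression_exists[OF assms(1) m compression_ofD(1-4)[OF c]] by blast
  have "G' $$ (i, j) = T i j" if "i < n" "j < n" for i j
    using that by (intro ext) (simp add: G'(3) compression_ofD(5)[OF c])
  then show ?thesis using G'(1,2) by blast
qed

text \<open>The scalar factors that meet in the middle combine to \<open>s\<close>, which is
  absorbed into the second matrix as \<open>H\<close>; the product is then a compression of
  \<open>G * H\<close>.\<close>

lemma contractive_mult:
  assumes "contractive I J T" "contractive J K T'"
  shows "contractive I K (\<lambda>i k x. \<Sum>j\<in>J. T i j x * T' j k x)"
proof -
  from contractive_pair_padded[OF assms(1,2)] obtain m G a b G' a' b' where m: "0 < m"
    and c1: "compression_of m I J T G a b" and c2: "compression_of m J K T' G' a' b'" by blast
  note G = compression_ofD(1,2)[OF c1] and ab = compression_ofD(3,4)[OF c1] and T = compression_ofD(5)[OF c1]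
  note G' = compression_ofD(1,2)[OF c2] and ab' = compression_ofD(3,4)[OF c2] and T' = compression_ofD(5)[OF c2]
  have J: "finite J" using assms(1) by (rule contractive_finite)
  define s where "s q p = (\<Sum>j\<in>J. b q j * a' j p)" for q p
  let ?i = "\<lambda>p q :: nat. if q = p then 1 else 0 :: complex"
  have s: "scalar_contraction {..<m} {..<m} s"
    unfolding s_def using ab(2) ab'(1) by (rule scalar_contraction_mult)
  have "\<exists>H\<in>mats m A. nrm H \<le> 1 \<and>
      (\<forall>i<m. \<forall>j<m. \<forall>x. (H $$ (i, j)) x = (\<Sum>p<m. \<Sum>q<m. s i p * (G' $$ (p, q)) x * ?i q j))"
    using m G' s by (intro compression_exists scalar_contraction_inj[where \<phi>="\<lambda>p. p"]) auto
  then obtain H where H: "H \<in> mats m A" "nrm H \<le> 1"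
    and e: "\<And>i j x. i < m \<Longrightarrow> j < m \<Longrightarrow>
      (H $$ (i, j)) x = (\<Sum>p<m. \<Sum>q<m. s i p * (G' $$ (p, q)) x * ?i q j)" by blast
  have e': "(H $$ (i, j)) x = (\<Sum>p<m. s i p * (G' $$ (p, j)) x)" if "i < m" "j < m" for i j x
    unfolding e[OF that] using that by (intro sum.cong) (auto simp: if_distrib[of "(*) _"] cong: if_cong)
  have "nrm (G * H) \<le> nrm G * nrm H" using m G H by (intro nrm_mult)
  also have "\<dots> \<le> 1" using G H m by (intro mult_le_one nrm_nonneg) auto
  finally have "nrm (G * H) \<le> 1" .
  moreover have "(\<Sum>j\<in>J. T i j x * T' j k x) = (\<Sum>p<m. \<Sum>q<m. a i p * ((G * H) $$ (p, q)) x * b' q k)"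
    if ik: "i \<in> I" "k \<in> K" for i k x
  proof -
    define \<alpha> where "\<alpha> r = (\<Sum>p<m. a i p * (G $$ (p, r)) x)" for r
    define \<gamma> where "\<gamma> p q = (\<Sum>r<m. (G $$ (p, r)) x * (H $$ (r, q)) x)" for p q
    define \<beta> where "\<beta> t = (\<Sum>q<m. (G' $$ (t, q)) x * b' q k)" for t
    have "T i j x = (\<Sum>r<m. \<alpha> r * b r j)" if "j \<in> J" for j
      unfolding T[OF ik(1) that] \<alpha>_def sum_distrib_right by (rule sum.swap)
    moreover have "T' j k x = (\<Sum>t<m. a' j t * \<beta> t)" if "j \<in> J" for j
      unfolding T'[OF that ik(2)] \<beta>_def by (simp add: sum_distrib_left mult.assoc)
    ultimately have "(\<Sum>j\<in>J. T i j x * T' j k x) = (\<Sum>j\<in>J. (\<Sum>r<m. \<alpha> r * b r j) * (\<Sum>t<m. a' j t * \<beta> t))"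
      by simp
    also have "\<dots> = (\<Sum>r<m. \<alpha> r * (\<Sum>t<m. s r t * \<beta> t))" by (simp only: s_def sum_mult_assoc)
    also have "\<dots> = (\<Sum>r<m. \<alpha> r * (\<Sum>q<m. (H $$ (r, q)) x * b' q k))"
    proof (rule sum.cong[OF refl])
      fix r assume "r \<in> {..<m}"
      then have "(\<Sum>q<m. (H $$ (r, q)) x * b' q k) = (\<Sum>q<m. (\<Sum>t<m. s r t * (G' $$ (t, q)) x) * b' q k)"
        by (simp add: e')
      then show "\<alpha> r * (\<Sum>t<m. s r t * \<beta> t) = \<alpha> r * (\<Sum>q<m. (H $$ (r, q)) x * b' q k)"
        by (simp only: \<beta>_def sum_mult_assoc)
    qed
    also have "\<dots> = (\<Sum>p<m. a i p * (\<Sum>q<m. \<gamma> p q * b' q k))"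
      by (simp only: \<alpha>_def \<gamma>_def sum_mult_assoc)
    also have "\<dots> = (\<Sum>p<m. \<Sum>q<m. a i p * \<gamma> p q * b' q k)" by (simp add: sum_distrib_left mult.assoc)
    also have "\<dots> = (\<Sum>p<m. \<Sum>q<m. a i p * ((G * H) $$ (p, q)) x * b' q k)"
      by (intro sum.cong refl) (simp add: \<gamma>_def mult_in_mats(2)[OF G(1) H(1)])
    finally show ?thesis .
  qed
  ultimately have "compression_of m I K (\<lambda>i k x. \<Sum>j\<in>J. T i j x * T' j k x) (G * H) a b'"
    using ab ab' mult_in_mats(1)[OF G(1) H(1)] by (simp add: compression_of_def)
  then show ?thesis
    unfolding contractive_def
    using contractive_finite[OF assms(1)] contractive_finite[OF assms(2)] m by blast
qed

lemma contractive_scalar: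
  assumes "finite J" "finite K" "scalar_contraction J K a"
  shows "contractive J K (\<lambda>j k x. a j k)"
proof -
  obtain e where e: "inj_on e K" "e ` K \<subseteq> {..<Suc (card K)}"
    using ex_bij_betw_finite_nat[OF assms(2)]
    by (metis atLeast0LessThan bij_betw_def lessThan_Suc subset_insertI)
  \<comment> \<open>A scalar matrix is a compression of an identity matrix. \<open>Suc\<close> keeps
    the size positive when \<open>K\<close> is empty.\<close>
  let ?m = "Suc (card K)"
  define b where "b q k = (if q = e k then 1 else 0 :: complex)" for q k
  define a' where "a' j q = (\<Sum>k\<in>K. a j k * b q k)" for j q
  have bK: "scalar_contraction K {..<?m} (\<lambda>k q. b q k)"
    unfolding b_def using assms(2) e(1) by (intro scalar_contraction_inj) auto
  have a': "scalar_contraction J {..<?m} a'"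
    unfolding a'_def using assms(3) bK by (rule scalar_contraction_mult)
  have "a j k = (\<Sum>p<?m. \<Sum>q<?m. a' j p * ((1\<^sub>m ?m :: ('x \<Rightarrow> complex) mat) $$ (p, q)) x * b q k)"
    if "k \<in> K" for j k x
  proof -
    have ek: "e k < ?m" using that e(2) by auto
    have "(\<Sum>p<?m. \<Sum>q<?m. a' j p * ((1\<^sub>m ?m :: ('x \<Rightarrow> complex) mat) $$ (p, q)) x * b q k)
        = (\<Sum>p<?m. \<Sum>q<?m. if q = p then a' j p * b p k else 0)"
      by (intro sum.cong) (auto simp: one_mat_def)
    also have "\<dots> = (\<Sum>p<?m. a' j p * b p k)" by (intro sum.cong) auto
    also have "\<dots> = (\<Sum>p<?m. if p = e k then a' j p else 0)" by (intro sum.cong) (auto simp: b_def)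
    also have "\<dots> = a' j (e k)" using ek by simp
    also have "\<dots> = (\<Sum>l\<in>K. if l = k then a j l else 0)"
      unfolding a'_def using that e(1) by (intro sum.cong) (auto simp: b_def inj_on_def)
    finally show ?thesis using that assms(2) by simp
  qed
  then have "compression_of ?m J K (\<lambda>j k x. a j k) (1\<^sub>m ?m) a' b"
    using a' scalar_contraction_transpose[OF bK] nrm_one_mat[of ?m] by (simp add: compression_of_def)
  then show ?thesis unfolding contractive_def using assms by blast
qed

lemma contractive_direct_sum:
  assumes "contractive J1 K1 T1" "contractive J2 K2 T2" "J1 \<inter> J2 = {}" "K1 \<inter> K2 = {}"
  shows "contractive (J1 \<union> J2) (K1 \<union> K2)
    (\<lambda>j k x. if j \<in> J1 then (if k \<in> K1 then T1 j k x else 0) else (if k \<in> K1 then 0 else T2 j k x))"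
proof -
  from contractive_pair_padded[OF assms(1,2)] obtain m G a b G' a' b' where m: "0 < m"
    and c1: "compression_of m J1 K1 T1 G a b" and c2: "compression_of m J2 K2 T2 G' a' b'" by blast
  note G = compression_ofD(1,2)[OF c1] and ab = compression_ofD(3,4)[OF c1] and T = compression_ofD(5)[OF c1]
  note G' = compression_ofD(1,2)[OF c2] and ab' = compression_ofD(3,4)[OF c2] and T' = compression_ofD(5)[OF c2]
  note fin = contractive_finite[OF assms(1)] contractive_finite[OF assms(2)]
  define a2 where "a2 = (\<lambda>j p. if j \<in> J1 then (if p < m then a j p else 0) else (if p < m then 0 else a' j (p - m)))"
  define b2 where "b2 = (\<lambda>q k. if k \<in> K1 then (if q < m then b q k else 0) else (if q < m then 0 else b' (q - m) k))"
  have a2: "scalar_contraction (J1 \<union> J2) {..<m + m} a2"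
    unfolding a2_def using ab ab' fin assms(3) by (intro scalar_contraction_direct_sum)
  have "scalar_contraction (K1 \<union> K2) {..<m + m} (\<lambda>k q. b2 q k)"
    unfolding b2_def
    by (rule scalar_contraction_direct_sum[OF scalar_contraction_transpose[OF ab(2)]
          scalar_contraction_transpose[OF ab'(2)] fin(2,4) assms(4)])
  then have b2: "scalar_contraction {..<m + m} (K1 \<union> K2) b2" by (rule scalar_contraction_transpose)
  note GG = matsD[OF G(1)] matsD[OF G'(1)]
  have idx: "(G \<oplus>\<^sub>d G') $$ (p, q) = (if p < m then (if q < m then G $$ (p, q) else 0)
      else (if q < m then 0 else G' $$ (p - m, q - m)))" if "p < m + m" "q < m + m" for p q
    unfolding direct_sum_mat_def using GG(1,3) that by (subst index_mat_four_block) auto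
  have mem: "G \<oplus>\<^sub>d G' \<in> mats (m + m) A"
  proof (rule matsI)
    show "G \<oplus>\<^sub>d G' \<in> carrier_mat (m + m) (m + m)"
      unfolding direct_sum_mat_def using GG by auto
  qed (auto simp: idx zero_in_alg GG)
  have nrm: "nrm (G \<oplus>\<^sub>d G') \<le> 1" using nrm_direct_sum[OF m m G(1) G'(1)] G G' by simp
  have "(if j \<in> J1 then (if k \<in> K1 then T1 j k x else 0) else (if k \<in> K1 then 0 else T2 j k x)) =
      (\<Sum>p<m + m. \<Sum>q<m + m. a2 j p * ((G \<oplus>\<^sub>d G') $$ (p, q)) x * b2 q k)"
    if jk: "j \<in> J1 \<union> J2" "k \<in> K1 \<union> K2" for j k x
  proof -
    have "(\<Sum>p<m + m. \<Sum>q<m + m. a2 j p * ((G \<oplus>\<^sub>d G') $$ (p, q)) x * b2 q k) =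
      (\<Sum>p<m. \<Sum>q<m. a2 j p * (G $$ (p, q)) x * b2 q k) +
      (\<Sum>p<m. \<Sum>q<m. a2 j (m + p) * (G' $$ (p, q)) x * b2 (m + q) k)"
      by (simp add: sum_lessThan_add idx sum.distrib)
    then show ?thesis
      using jk T[of j k x] T'[of j k x] assms(3,4) by (auto simp: a2_def b2_def)
  qed
  then have "compression_of (m + m) (J1 \<union> J2) (K1 \<union> K2)
    (\<lambda>j k x. if j \<in> J1 then (if k \<in> K1 then T1 j k x else 0) else (if k \<in> K1 then 0 else T2 j k x))
    (G \<oplus>\<^sub>d G') a2 b2"
    unfolding compression_of_def using a2 b2 mem nrm by blast
  moreover have "0 < m + m" using m by simp
  ultimately show ?thesis unfolding contractive_def using fin by blast
qed

lemma contractive_id: "finite J \<Longrightarrow> contractive J J (\<lambda>j k x. if k = j then 1 else 0)"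
  using contractive_scalar[OF _ _ scalar_contraction_inj[where \<phi>="\<lambda>j. j"]] by auto

end

section \<open>A mean ergodic argument\<close>

context operator_algebra_of_functions
begin

text \<open>Think of \<open>R\<close> as a linear system with input and output indices \<open>I1\<close> and state indices \<open>I2\<close>.
  Feeding a queue of \<open>M\<close> inputs through it is a contraction, as a product of \<open>M\<close> contractions, each
  of which acts on one slot of the queue and on the state. Constant inputs that leave the state
  fixed produce constant outputs; averaging over the slots, the state contributes \<open>O(1/\<surd>M)\<close>.\<close>

lemma ergodic_compression:
  fixes R :: "'i \<Rightarrow> 'i \<Rightarrow> 'x \<Rightarrow> complex" and M :: nat
  assumes R: "contractive (I1 \<union> I2) (I1 \<union> I2) R"
    and disj: "I1 \<inter> I2 = {}" and E: "E \<subseteq> I1" and M: "0 < M"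
  shows "\<exists>G. contractive E E G \<and> (\<forall>x u w.
    (\<forall>i\<in>I1 \<union> I2. (\<Sum>j\<in>I1 \<union> I2. R i j x * u j) = w i) \<longrightarrow> (\<forall>i\<in>I2. w i = u i) \<longrightarrow>
    sqsum E (\<lambda>i. w i - (\<Sum>j\<in>E. G i j x * u j)) \<le>
      sqsum (I1 - E) u + sqsum I2 u / M)"
proof -
  have fin: "finite I1" "finite I2" using contractive_finite[OF R] by auto
  have finE: "finite E" using E fin(1) by (rule finite_subset)
  \<comment> \<open>The tag \<open>0\<close> on \<open>I2\<close> is a dummy: every slot has its own
    copy of \<open>I1\<close>, and all slots share one state.\<close>
  define slot where "slot k = {k} \<times> I1 \<union> {0} \<times> I2" for k :: nat
  define J where "J = {..<M} \<times> I1 \<union> {0} \<times> I2"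
  have finJ: "finite J" using fin by (simp add: J_def)
  have slot: "slot k \<subseteq> J" "inj_on snd (slot k)" "snd ` slot k = I1 \<union> I2" if "k < M" for k
    using that disj by (auto simp: slot_def J_def inj_on_def image_Un)
  define step where "step k a b x = (if a \<in> slot k then (if b \<in> slot k then R (snd a) (snd b) x else 0)
      else (if b \<in> slot k then 0 else if b = a then 1 else 0))" for k a b x
  have step: "contractive J J (step k)" if k: "k < M" for k
  proof -
    have "contractive (slot k) (slot k) (\<lambda>a b. R (snd a) (snd b))"
      using slot[OF k] by (intro contractive_reindex[OF R, where \<phi>=snd and \<psi>=snd]) auto
    moreover have "contractive (J - slot k) (J - slot k) (\<lambda>a b x. if b = a then 1 else 0)"
      using finJ by (intro contractive_id) auto
    ultimately have "contractive (slot k \<union> (J - slot k)) (slot k \<union> (J - slot k))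
      (\<lambda>a b x. if a \<in> slot k then (if b \<in> slot k then R (snd a) (snd b) x else 0)
        else (if b \<in> slot k then 0 else if b = a then 1 else 0))"
      by (rule contractive_direct_sum) auto
    moreover have "slot k \<union> (J - slot k) = J" using slot(1)[OF k] by blast
    ultimately show ?thesis by (simp add: step_def[abs_def])
  qed
  define W where "W = rec_nat (\<lambda>a b x. if b = a then 1 else 0)
    (\<lambda>k V a b x. \<Sum>c\<in>J. step k a c x * V c b x)"
  have W_0: "W 0 = (\<lambda>a b x. if b = a then 1 else 0)"
    and W_Suc: "W (Suc k) = (\<lambda>a b x. \<Sum>c\<in>J. step k a c x * W k c b x)" for k
    by (simp_all add: W_def)
  have W: "contractive J J (W k)" if "k \<le> M" for k
    using that
  proof (induction k)
    case 0
    then show ?case unfolding W_0 using finJ by (rule_tac contractive_id)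
  next
    case (Suc k)
    then show ?case unfolding W_Suc by (intro contractive_mult step) auto
  qed
  \<comment> \<open>Scaling by \<open>1 / sqrt M\<close> makes summation over the \<open>M\<close>
    slots a contraction; \<open>L\<close> occurs twice in \<open>G\<close>, so the two factors
    combine to an average.\<close>
  define r where "r = complex_of_real (1 / sqrt (real M))"
  have r2: "r * r * of_nat M = 1" "(cmod r)\<^sup>2 = 1 / real M"
    using M by (simp_all add: r_def norm_divide power_divide flip: of_real_mult)
  define L where "L i a = (if snd a = i then r else 0)" for i and a :: "nat \<times> 'i"
  have sum_L: "(\<Sum>a\<in>J. L i a * v a) = r * (\<Sum>s<M. v (s, i))" if i: "i \<in> E" for i v
  proof -
    have "(\<Sum>a\<in>J. L i a * v a) = (\<Sum>a\<in>{..<M} \<times> {i}. r * v a)"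
      using i E finJ disj by (intro sum.mono_neutral_cong_right) (auto simp: L_def J_def)
    also have "\<dots> = (\<Sum>s<M. r * v (s, i))"
      by (rule sum.reindex_bij_witness[where i="\<lambda>s. (s, i)" and j=fst]) auto
    finally show ?thesis by (simp add: sum_distrib_left)
  qed
  have L: "scalar_contraction E J L"
    unfolding scalar_contraction_def
  proof
    fix v
    have "sqsum E (\<lambda>i. \<Sum>a\<in>J. L i a * v a) = (\<Sum>i\<in>E. (1 / M) * (cmod (\<Sum>s<M. 1 * v (s, i)))\<^sup>2)"
      by (intro sum.cong refl) (simp add: sum_L norm_mult power_mult_distrib r2)
    also have "\<dots> \<le> (\<Sum>i\<in>E. (1 / M) * ((\<Sum>s<M. (cmod 1)\<^sup>2) * sqsum {..<M} (\<lambda>s. v (s, i))))"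
      by (intro sum_mono mult_left_mono cmod_sum_mult_le) auto
    also have "\<dots> = (\<Sum>i\<in>E. \<Sum>s<M. (cmod (v (s, i)))\<^sup>2)" using M by simp
    also have "\<dots> = sqsum ({..<M} \<times> E) v"
      by (subst sum.swap) (simp add: sum.cartesian_product)
    also have "\<dots> \<le> sqsum J v"
      using finJ E by (intro sum_mono2) (auto simp: J_def)
    finally show "sqsum E (\<lambda>i. \<Sum>a\<in>J. L i a * v a) \<le> sqsum J v" .
  qed
  define G where "G i j x = (\<Sum>b\<in>J. (\<Sum>a\<in>J. L i a * W M a b x) * L j b)" for i j x
  have G: "contractive E E G"
    unfolding G_def
    by (intro contractive_mult[OF contractive_mult[OF contractive_scalar W[OF order_refl]]
          contractive_scalar[OF finJ finE scalar_contraction_transpose]] finE finJ L)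
  have bound: "sqsum E (\<lambda>i. w i - (\<Sum>j\<in>E. G i j x * u j)) \<le>
      sqsum (I1 - E) u + sqsum I2 u / M"
    if w: "\<And>i. i \<in> I1 \<union> I2 \<Longrightarrow> (\<Sum>j\<in>I1 \<union> I2. R i j x * u j) = w i"
      and st: "\<And>i. i \<in> I2 \<Longrightarrow> w i = u i" for x u w
  proof -
    \<comment> \<open>The queue after \<open>k\<close> steps: slots before \<open>k\<close> already
      hold outputs, the others still inputs, and the state is unchanged because \<open>w = u\<close>
      on \<open>I2\<close>.\<close>
    define \<xi> where "\<xi> k a = (if snd a \<in> I1 \<and> fst a < k then w (snd a) else u (snd a))"
      for k :: nat and a :: "nat \<times> 'i"
    have step_\<xi>: "(\<Sum>c\<in>J. step k a c x * \<xi> k c) = \<xi> (Suc k) a" if k: "k < M" and a: "a \<in> J" for k a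
    proof (cases "a \<in> slot k")
      case True
      have "(\<Sum>c\<in>J. step k a c x * \<xi> k c) = (\<Sum>c\<in>slot k. R (snd a) (snd c) x * u (snd c))"
        using True slot(1)[OF k] finJ disj
        by (intro sum.mono_neutral_cong_right) (auto simp: step_def \<xi>_def slot_def)
      also have "\<dots> = (\<Sum>j\<in>I1 \<union> I2. R (snd a) j x * u j)"
        unfolding slot(3)[OF k, symmetric] by (simp add: sum.reindex[OF slot(2)[OF k]])
      also have "\<dots> = w (snd a)" using True by (intro w) (auto simp: slot_def)
      also have "\<dots> = \<xi> (Suc k) a" using True st by (auto simp: \<xi>_def slot_def)
      finally show ?thesis .
    next
      case False
      have "(\<Sum>c\<in>J. step k a c x * \<xi> k c) = (\<Sum>c\<in>J. if c = a then \<xi> k c else 0)"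
        using False by (intro sum.cong) (auto simp: step_def)
      also have "\<dots> = \<xi> k a" using a finJ by simp
      also have "\<dots> = \<xi> (Suc k) a" using False a by (auto simp: \<xi>_def slot_def J_def less_Suc_eq)
      finally show ?thesis .
    qed
    have W_\<xi>: "(\<Sum>b\<in>J. W k a b x * \<xi> 0 b) = \<xi> k a" if "k \<le> M" "a \<in> J" for k a
      using that
    proof (induction k arbitrary: a)
      case 0
      have "(\<Sum>b\<in>J. W 0 a b x * \<xi> 0 b) = (\<Sum>b\<in>J. if b = a then \<xi> 0 b else 0)"
        unfolding W_0 by (intro sum.cong) auto
      then show ?case using 0 finJ by simp
    next
      case (Suc k)
      have "(\<Sum>b\<in>J. W (Suc k) a b x * \<xi> 0 b) = (\<Sum>c\<in>J. step k a c x * (\<Sum>b\<in>J. W k c b x * \<xi> 0 b))"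
        unfolding W_Suc by (rule sum_mult_assoc)
      also have "\<dots> = (\<Sum>c\<in>J. step k a c x * \<xi> k c)"
        using Suc by (intro sum.cong) auto
      also have "\<dots> = \<xi> (Suc k) a" using Suc.prems by (intro step_\<xi>) auto
      finally show ?case .
    qed
    \<comment> \<open>\<open>L\<close> transposed feeds only the inputs in \<open>E\<close>;
      \<open>v\<close> is the part of the scaled start \<open>\<xi> 0\<close> that it misses. There
      are \<open>M\<close> copies of each remaining input but a single copy of the state, whence the
      two terms of the bound.\<close>
    define v where "v b = (if snd b \<in> E then 0 else r * u (snd b))" for b :: "nat \<times> 'i"
    have err: "w i - (\<Sum>j\<in>E. G i j x * u j) = (\<Sum>a\<in>J. L i a * (\<Sum>b\<in>J. W M a b x * v b))"
      if i: "i \<in> E" for i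
    proof -
      have Lu: "(\<Sum>j\<in>E. L j b * u j) = r * \<xi> 0 b - v b" for b
      proof -
        have "(\<Sum>j\<in>E. L j b * u j) = (\<Sum>j\<in>E. if j = snd b then r * u (snd b) else 0)"
          by (intro sum.cong) (auto simp: L_def)
        then show ?thesis using finE by (simp add: v_def \<xi>_def)
      qed
      have "(\<Sum>j\<in>E. G i j x * u j) = (\<Sum>a\<in>J. L i a * (\<Sum>b\<in>J. W M a b x * (r * \<xi> 0 b - v b)))"
        unfolding Lu[symmetric] by (simp only: G_def sum_mult_assoc)
      also have "\<dots> = (\<Sum>a\<in>J. L i a * (r * (\<Sum>b\<in>J. W M a b x * \<xi> 0 b) - (\<Sum>b\<in>J. W M a b x * v b)))"
        by (simp add: sum_distrib_left right_diff_distrib sum_subtractf ac_simps)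
      also have "\<dots> = (\<Sum>a\<in>J. L i a * (r * \<xi> M a)) - (\<Sum>a\<in>J. L i a * (\<Sum>b\<in>J. W M a b x * v b))"
        by (simp add: W_\<xi> right_diff_distrib sum_subtractf)
      also have "(\<Sum>a\<in>J. L i a * (r * \<xi> M a)) = r * (\<Sum>s<M. r * \<xi> M (s, i))"
        by (rule sum_L[OF i])
      also have "\<dots> = r * r * of_nat M * w i" using i E by (simp add: \<xi>_def subset_iff mult.assoc)
      finally show ?thesis by (simp add: r2)
    qed
    have "sqsum E (\<lambda>i. w i - (\<Sum>j\<in>E. G i j x * u j))
        = sqsum E (\<lambda>i. \<Sum>a\<in>J. L i a * (\<Sum>b\<in>J. W M a b x * v b))"
      by (simp add: err)
    also have "\<dots> \<le> sqsum J (\<lambda>a. \<Sum>b\<in>J. W M a b x * v b)" using L by (rule scalar_contractionD)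
    also have "\<dots> \<le> sqsum J v"
      using contractive_eval[OF W[OF order_refl]] by (rule scalar_contractionD)
    also have "\<dots> = sqsum ({..<M} \<times> I1) v + sqsum ({0} \<times> I2) v"
      unfolding J_def using fin disj by (intro sum.union_disjoint) auto
    also have "sqsum ({0::nat} \<times> I2) v = sqsum I2 (\<lambda>i. v (0, i))"
      by (rule sum.reindex_bij_witness[where i="\<lambda>i. (0, i)" and j=snd]) auto
    also have "\<dots> = (\<Sum>i\<in>I2. (cmod (u i))\<^sup>2 / M)"
      using E disj by (intro sum.cong) (auto simp: v_def norm_mult power_mult_distrib r2)
    also have "sqsum ({..<M} \<times> I1) v = (\<Sum>s<M. \<Sum>i\<in>I1. (cmod (v (s, i)))\<^sup>2)"
      by (simp add: sum.cartesian_product)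
    also have "\<dots> = (\<Sum>s<M. \<Sum>i\<in>I1 - E. (cmod (u i))\<^sup>2 / M)"
      using fin by (intro sum.cong sum.mono_neutral_cong_right)
        (auto simp: v_def norm_mult power_mult_distrib r2)
    also have "\<dots> = sqsum (I1 - E) u"
      using M by (simp add: sum_divide_distrib[symmetric])
    finally show ?thesis by (simp add: sum_divide_distrib)
  qed
  show ?thesis using G bound by blast
qed

end

section \<open>Douglas factorization in finite dimensions\<close>

lemma finite_ell2: "finite K \<Longrightarrow> v \<in> ell2 K \<longleftrightarrow> (\<forall>k. k \<notin> K \<longrightarrow> v k = 0)"
  by (simp add: ell2_def)

lemma finite_ell2_ip: "finite K \<Longrightarrow> ell2_ip K u v = (\<Sum>k\<in>K. u k * cnj (v k))"
  by (simp add: ell2_ip_def)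

text \<open>By the inequality, sending a combination of columns of \<open>B\<close> to the
  combination of columns of \<open>A\<close> with the same coefficients is a well-defined
  contraction; \<open>U\<close> is its extension by 0 to the orthogonal complement.\<close>

lemma Douglas_factorization:
  fixes A :: "'j \<Rightarrow> 'z \<Rightarrow> complex" and B :: "'k \<Rightarrow> 'z \<Rightarrow> complex"
  assumes fin: "finite K" "finite Z"
    and le: "\<And>c. sqsum J (\<lambda>j. \<Sum>z\<in>Z. c z * A j z) \<le> sqsum K (\<lambda>k. \<Sum>z\<in>Z. c z * B k z)"
    and finJ: "finite J"
  shows "\<exists>U. scalar_contraction J K U \<and> (\<forall>j\<in>J. \<forall>z\<in>Z. (\<Sum>k\<in>K. U j k * B k z) = A j z)"
proof -
  let ?p = "\<lambda>u v. \<Sum>l\<in>K. u l * cnj (v l)"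
  have Re_p: "Re (?p u u) = sqsum K u" for u
    by (simp add: cmod_power2 flip: power2_eq_square)
  interpret semi_inner_product UNIV ?p
    by unfold_locales (auto simp: Re_p scaleC_simps algebra_simps sum.distrib
        sum_distrib_left intro!: add_nonneg_nonneg sum_nonneg)
  \<comment> \<open>\<open>c\<close> holds coefficients of the orthogonal projection of the
    \<open>k\<close>-th unit vector onto the span of the columns of \<open>B\<close>.\<close>
  define orth where "orth k c \<longleftrightarrow>
    (\<forall>y\<in>Z. ?p ((\<lambda>l. if l = k then 1 else 0) - (\<Sum>z\<in>Z. c z *\<^sub>C (\<lambda>l. B l z))) (\<lambda>l. B l y) = 0)" for k c
  have "\<exists>c. orth k c" for k
    unfolding orth_def using fin(2) by (intro orthogonal_projection) auto
  then obtain C0 where "\<And>k. orth k (C0 k)" by metis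
  then obtain C where C: "\<And>k y. y \<in> Z \<Longrightarrow>
      (\<Sum>l\<in>K. ((if l = k then 1 else 0) - (\<Sum>z\<in>Z. C k z * B l z)) * cnj (B l y)) = 0"
    by (auto simp: orth_def fun_sum_apply scaleC_simps)
  define d where "d v z = (\<Sum>k\<in>K. v k * C k z)" for v z
  define w where "w v l = v l - (\<Sum>z\<in>Z. d v z * B l z)" for v l
  have w_orth: "(\<Sum>l\<in>K. w v l * cnj (\<Sum>z\<in>Z. c z * B l z)) = 0" for v c
  proof -
    have w: "w v l = (\<Sum>k\<in>K. v k * ((if l = k then 1 else 0) - (\<Sum>z\<in>Z. C k z * B l z)))" if "l \<in> K" for l
    proof -
      have "(\<Sum>k\<in>K. v k * (if l = k then 1 else 0)) = (\<Sum>k\<in>K. if k = l then v k else 0)"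
        by (intro sum.cong) auto
      moreover have "(\<Sum>k\<in>K. v k * (\<Sum>z\<in>Z. C k z * B l z)) = (\<Sum>z\<in>Z. d v z * B l z)"
        unfolding d_def sum_distrib_left sum_distrib_right by (subst sum.swap) (simp add: mult.assoc)
      ultimately show ?thesis using that fin(1) by (simp add: w_def right_diff_distrib sum_subtractf)
    qed
    have "(\<Sum>l\<in>K. w v l * cnj (B l y)) = 0" if "y \<in> Z" for y
    proof -
      have "(\<Sum>l\<in>K. w v l * cnj (B l y)) = (\<Sum>l\<in>K. \<Sum>k\<in>K.
          v k * (((if l = k then 1 else 0) - (\<Sum>z\<in>Z. C k z * B l z)) * cnj (B l y)))"
        by (simp add: w sum_distrib_right mult.assoc)
      also have "\<dots> = (\<Sum>k\<in>K. v k * (\<Sum>l\<in>K. ((if l = k then 1 else 0) - (\<Sum>z\<in>Z. C k z * B l z)) * cnj (B l y)))"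
        by (subst sum.swap) (simp only: sum_distrib_left)
      finally show ?thesis using C[OF that] by simp
    qed
    then have "(\<Sum>z\<in>Z. cnj (c z) * (\<Sum>l\<in>K. w v l * cnj (B l z))) = 0" by simp
    then show ?thesis
      unfolding cnj_sum sum_distrib_left by (subst sum.swap) (simp add: ac_simps)
  qed
  define U where "U j k = (\<Sum>z\<in>Z. C k z * A j z)" for j k
  have U_app: "(\<Sum>k\<in>K. U j k * v k) = (\<Sum>z\<in>Z. d v z * A j z)" for j v
    unfolding U_def d_def sum_distrib_right by (subst sum.swap) (simp add: ac_simps)
  have "scalar_contraction J K U"
    unfolding scalar_contraction_def
  proof
    fix v
    define P where "P l = (\<Sum>z\<in>Z. d v z * B l z)" for l
    have "sqsum J (\<lambda>j. \<Sum>k\<in>K. U j k * v k) \<le> sqsum K P"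
      unfolding U_app P_def by (rule le)
    also have "\<dots> \<le> sqsum K P + sqsum K (\<lambda>l. w v l)"
      by (simp add: sum_nonneg)
    also have "\<dots> = Re (?p (w v + P) (w v + P))"
      using w_orth[of v "d v"] by (subst norm2_add) (simp_all only: UNIV_I Re_p P_def, simp)
    also have "w v + P = v" by (simp add: w_def P_def fun_eq_iff)
    finally show "sqsum J (\<lambda>j. \<Sum>k\<in>K. U j k * v k) \<le> sqsum K v" by (simp only: Re_p)
  qed
  moreover have "(\<Sum>k\<in>K. U j k * B k z) = A j z" if jz: "j \<in> J" "z \<in> Z" for j z
  proof -
    let ?v = "\<lambda>k. B k z"
    \<comment> \<open>The difference of two coefficient vectors for column \<open>z\<close>, the
      trivial one and that of its projection. The columns of \<open>B\<close> so combined give a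
      vector in their span and orthogonal to it, hence 0; by \<open>le\<close> the columns of
      \<open>A\<close> so combined vanish as well.\<close>
    define c where "c y = (if y = z then 1 else 0) - d ?v y" for y
    have sum_c: "(\<Sum>y\<in>Z. c y * f y) = f z - (\<Sum>y\<in>Z. d ?v y * f y)" for f
    proof -
      have "(\<Sum>y\<in>Z. (if y = z then 1 else 0) * f y) = (\<Sum>y\<in>Z. if y = z then f y else 0)"
        by (intro sum.cong) auto
      then show ?thesis using jz fin by (simp add: c_def left_diff_distrib sum_subtractf)
    qed
    have w: "w ?v = (\<lambda>l. \<Sum>y\<in>Z. c y * B l y)" by (simp add: w_def sum_c fun_eq_iff)
    have "sqsum J (\<lambda>j. \<Sum>y\<in>Z. c y * A j y) \<le> Re (?p (w ?v) (w ?v))"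
      unfolding Re_p unfolding w by (rule le)
    also have "\<dots> = 0" using w_orth[of ?v c] by (simp add: w)
    finally have "sqsum J (\<lambda>j. \<Sum>y\<in>Z. c y * A j y) = 0"
      by (intro antisym sum_nonneg) auto
    then have "(\<Sum>y\<in>Z. c y * A j y) = 0" using finJ jz by (subst (asm) sum_nonneg_eq_0_iff) auto
    then show ?thesis unfolding sum_c U_app by simp
  qed
  ultimately show ?thesis by blast
qed

section \<open>Separation by admissible forms\<close>

definition hform :: "'z set \<Rightarrow> ('z \<Rightarrow> 'z \<Rightarrow> complex) \<Rightarrow> ('z \<Rightarrow> complex) \<Rightarrow> ('z \<Rightarrow> complex) \<Rightarrow> complex" where
  "hform Z c f g = (\<Sum>z\<in>Z. \<Sum>w\<in>Z. c z w * f z * cnj (g w))"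

lemma hform_diagonal:
  assumes "finite Z"
  shows "hform Z (\<lambda>z w. if z = w then 1 else 0) f f = of_real (sqsum Z f)"
proof -
  have "hform Z (\<lambda>z w. if z = w then 1 else 0) f f = (\<Sum>z\<in>Z. \<Sum>w\<in>Z. if w = z then f z * cnj (f z) else 0)"
    unfolding hform_def by (intro sum.cong refl) auto
  also have "\<dots> = (\<Sum>z\<in>Z. f z * cnj (f z))" using assms by simp
  also have "\<dots> = of_real (sqsum Z f)" by (simp only: of_real_sum complex_norm_square)
  finally show ?thesis .
qed

text \<open>Functions on X with values in C^n are written on pairs of a point and a coordinate.
  \<open>T\<close> mixes the members of a tuple of such functions and leaves the coordinates
  alone.\<close>

definition act :: "('j \<Rightarrow> 'k \<Rightarrow> 'x \<Rightarrow> complex) \<Rightarrow> 'k set \<Rightarrow> ('k \<Rightarrow> 'x \<times> nat \<Rightarrow> complex) \<Rightarrow> 'j \<Rightarrow> 'x \<times> nat \<Rightarrow> complex" where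
  "act T K f j z = (\<Sum>k\<in>K. T j k (fst z) * f k z)"

context operator_algebra_of_functions
begin

text \<open>Up to the normalization in the second condition, these are the Hilbert space norms that make the
  functions \<open>S \<rightarrow> \<complex>\<^sup>n\<close> a completely contractive module over \<open>A\<close>.\<close>

definition admissible :: "'x set \<Rightarrow> nat \<Rightarrow> ('x \<times> nat \<Rightarrow> 'x \<times> nat \<Rightarrow> complex) \<Rightarrow> bool" where
  "admissible S n c \<longleftrightarrow> (\<forall>z w. c w z = cnj (c z w)) \<and>
     (\<forall>f. sqsum (S \<times> {..<n}) f \<le> Re (hform (S \<times> {..<n}) c f f)) \<and>
     (\<forall>(m::nat) T f. contractive {..<m} {..<m} T \<longrightarrow>
        (\<Sum>i<m. Re (hform (S \<times> {..<n}) c (act T {..<m} f i) (act T {..<m} f i)))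
          \<le> (\<Sum>j<m. Re (hform (S \<times> {..<n}) c (f j) (f j))))"

text \<open>Evaluations are contractive, so the plain square sum satisfies the contractivity
  condition of \<open>admissible\<close>; it may be added to other forms to make them
  definite.\<close>

lemma act_diagonal_bound:
  assumes "contractive J K T"
  shows "(\<Sum>j\<in>J. \<Sum>z\<in>Z. (cmod (act T K f j z))\<^sup>2) \<le> (\<Sum>k\<in>K. \<Sum>z\<in>Z. (cmod (f k z))\<^sup>2)"
proof -
  have "(\<Sum>z\<in>Z. \<Sum>j\<in>J. (cmod (act T K f j z))\<^sup>2) \<le> (\<Sum>z\<in>Z. \<Sum>k\<in>K. (cmod (f k z))\<^sup>2)"
    unfolding act_def by (intro sum_mono scalar_contractionD contractive_eval[OF assms])
  then show ?thesis by (subst (1 2) sum.swap)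
qed

text \<open>Written as tuples of rows, \<open>e\<close> is the identity matrix and \<open>g\<close>
  is \<open>F\<close>. The error term with \<open>d\<close> in the inequality is paid for by
  auxiliary inputs; their effect and that of the state on the average are at most \<open>d\<close>
  each.\<close>

lemma contractive_transfer:
  fixes T :: "nat \<Rightarrow> nat \<Rightarrow> 'x \<Rightarrow> complex" and S :: "'x set" and F :: "nat \<Rightarrow> nat \<Rightarrow> 'x \<Rightarrow> complex"
  defines "e \<equiv> \<lambda>i z. if snd z = i then 1 else 0 :: complex"
    and "g \<equiv> \<lambda>i z. F i (snd z) (fst z)"
  assumes S: "finite S" and n: "0 < n" and T: "contractive {..<m} {..<m} T" and d: "0 < d"
    and le: "\<And>c. sqsum {..<n} (\<lambda>i. \<Sum>z\<in>S \<times> {..<n}. c z * g i z) +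
        sqsum {..<m} (\<lambda>j. \<Sum>z\<in>S \<times> {..<n}. c z * f j z) \<le>
      sqsum {..<n} (\<lambda>i. \<Sum>z\<in>S \<times> {..<n}. c z * e i z) +
        sqsum {..<m} (\<lambda>j. \<Sum>z\<in>S \<times> {..<n}. c z * act T {..<m} f j z) +
        d * sqsum (S \<times> {..<n}) c"
  shows "\<exists>G\<in>mats n A. nrm G \<le> 1 \<and>
    (\<forall>x\<in>S. \<forall>i<n. \<forall>j<n. (cmod ((G $$ (i, j)) x - F i j x))\<^sup>2 \<le> 2 * d)"
proof -
  define Z where "Z = S \<times> {..<n}"
  have Z: "finite Z" using S by (simp add: Z_def)
  \<comment> \<open>The auxiliary inputs are \<open>sqrt d\<close> times the unit vectors of the
    cells. Their square sum is exactly the error term, so Douglas factorization applies without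
    error.\<close>
  define r where "r = complex_of_real (sqrt d)"
  have r: "(cmod r)\<^sup>2 = d" using d by (simp add: r_def)
  define b where "b y z = (if z = y then r else 0)" for y z :: "'x \<times> nat"
  define I where "I = {..<n} <+> ({..<m} <+> Z)"
  have I: "finite I" using Z by (simp add: I_def)
  have sum_I: "sum h I = (\<Sum>i<n. h (Inl i)) + ((\<Sum>j<m. h (Inr (Inl j))) + (\<Sum>z\<in>Z. h (Inr (Inr z))))"
    for h :: "_ \<Rightarrow> 'c::comm_monoid_add"
    unfolding I_def using Z by (simp add: sum.Plus)
  \<comment> \<open>\<open>vpre\<close> collects inputs, state and auxiliary inputs;
    \<open>vin\<close> is the same after \<open>T\<close> has acted on the state, and
    \<open>vout\<close> is what the scalar contraction makes of it: the outputs, the original state,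
    and zeros.\<close>
  define vin :: "nat + nat + 'x \<times> nat \<Rightarrow> 'x \<times> nat \<Rightarrow> complex"
    where "vin = case_sum e (case_sum (act T {..<m} f) b)"
  define vout :: "nat + nat + 'x \<times> nat \<Rightarrow> 'x \<times> nat \<Rightarrow> complex"
    where "vout = case_sum g (case_sum f (\<lambda>y z. 0))"
  define vpre :: "nat + nat + 'x \<times> nat \<Rightarrow> 'x \<times> nat \<Rightarrow> complex"
    where "vpre = case_sum e (case_sum f b)"
  have sum_b: "(\<Sum>z\<in>Z. c z * b y z) = c y * r" if "y \<in> Z" for c y
  proof -
    have "(\<Sum>z\<in>Z. c z * b y z) = (\<Sum>z\<in>Z. if z = y then c z * r else 0)"
      by (intro sum.cong) (auto simp: b_def)
    then show ?thesis using that Z by simp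
  qed
  have "sqsum I (\<lambda>k. \<Sum>z\<in>Z. c z * vout k z) \<le> sqsum I (\<lambda>k. \<Sum>z\<in>Z. c z * vin k z)" for c
  proof -
    have "sqsum Z (\<lambda>y. \<Sum>z\<in>Z. c z * b y z) = d * sqsum Z c"
      by (simp add: sum_b norm_mult power_mult_distrib r sum_distrib_left mult.commute)
    then show ?thesis using le[of c] unfolding sum_I vin_def vout_def Z_def by simp
  qed
  from Douglas_factorization[OF I Z this I] obtain U where U: "scalar_contraction I I U"
    and U_app: "\<And>i z. i \<in> I \<Longrightarrow> z \<in> Z \<Longrightarrow> (\<Sum>k\<in>I. U i k * vin k z) = vout i z" by blast
  define I2 :: "(nat + nat + 'x \<times> nat) set" where "I2 = (\<lambda>j. Inr (Inl j)) ` {..<m}"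
  define I1 where "I1 = I - I2"
  have I12: "I1 \<union> I2 = I" "I1 \<inter> I2 = {}" by (auto simp: I1_def I2_def I_def)
  define E :: "(nat + nat + 'x \<times> nat) set" where "E = Inl ` {..<n}"
  have E: "E \<subseteq> I1" by (auto simp: E_def I1_def I2_def I_def)
  define pr :: "nat + nat + 'x \<times> nat \<Rightarrow> nat" where "pr k = (case k of Inr (Inl j) \<Rightarrow> j | _ \<Rightarrow> 0)" for k
  define D where "D j k x = (if j \<in> I2 then (if k \<in> I2 then T (pr j) (pr k) x else 0)
      else (if k \<in> I2 then 0 else if k = j then 1 else 0))" for j k x
  have D: "contractive I I D"
  proof -
    have "contractive I2 I2 (\<lambda>j k. T (pr j) (pr k))"
      by (intro contractive_reindex[OF T, where \<phi>=pr and \<psi>=pr]) (auto simp: I2_def pr_def inj_on_def)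
    moreover have "contractive I1 I1 (\<lambda>j k x. if k = j then 1 else 0)"
      using I by (intro contractive_id) (simp add: I1_def)
    ultimately have "contractive (I2 \<union> I1) (I2 \<union> I1) D"
      unfolding D_def[abs_def] using I12 by (intro contractive_direct_sum) auto
    then show ?thesis using I12 by (simp add: Un_commute)
  qed
  \<comment> \<open>One step of the system: \<open>T\<close> acts on the state through
    \<open>D\<close>, then \<open>U\<close> acts on everything.\<close>
  define R where "R i k x = (\<Sum>j\<in>I. U i j * D j k x)" for i k x
  have R: "contractive (I1 \<union> I2) (I1 \<union> I2) R"
    unfolding R_def I12(1) by (rule contractive_mult[OF contractive_scalar[OF I I U] D])
  have D_app: "(\<Sum>k\<in>I. D j k (fst z) * vpre k z) = vin j z" if j: "j \<in> I" for j z
  proof (cases "j \<in> I2")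
    case True
    then obtain j' where j': "j = Inr (Inl j')" "j' < m" by (auto simp: I2_def)
    have "(\<Sum>k\<in>I. D j k (fst z) * vpre k z) = (\<Sum>k\<in>I2. T j' (pr k) (fst z) * vpre k z)"
      using True I I12 j' by (intro sum.mono_neutral_cong_right) (auto simp: D_def pr_def)
    also have "\<dots> = (\<Sum>k<m. T j' k (fst z) * f k z)"
      unfolding I2_def by (subst sum.reindex) (auto simp: inj_on_def pr_def vpre_def)
    finally show ?thesis using j' by (simp add: vin_def act_def)
  next
    case False
    have "(\<Sum>k\<in>I. D j k (fst z) * vpre k z) = (\<Sum>k\<in>I. if k = j then vpre j z else 0)"
      using False by (intro sum.cong) (auto simp: D_def)
    also have "\<dots> = vpre j z" using I j by simp
    also have "\<dots> = vin j z" using False j by (auto simp: vpre_def vin_def I2_def I_def)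
    finally show ?thesis .
  qed
  have R_app: "(\<Sum>k\<in>I1 \<union> I2. R i k (fst z) * vpre k z) = vout i z" if "i \<in> I1 \<union> I2" "z \<in> Z" for i z
  proof -
    have "(\<Sum>k\<in>I. R i k (fst z) * vpre k z) = (\<Sum>j\<in>I. U i j * (\<Sum>k\<in>I. D j k (fst z) * vpre k z))"
      unfolding R_def by (rule sum_mult_assoc)
    also have "\<dots> = (\<Sum>j\<in>I. U i j * vin j z)" by (simp add: D_app)
    finally show ?thesis using U_app that I12 by simp
  qed
  define B where "B = (\<Sum>z\<in>Z. \<Sum>j<m. (cmod (f j z))\<^sup>2)"
  \<comment> \<open>The run is long enough for the state, whose energy at a cell is at most
    \<open>B\<close>, to contribute at most \<open>d\<close>.\<close>
  obtain M :: nat where M: "B / d < M" using reals_Archimedean2 by blast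
  have B0: "0 \<le> B" by (auto simp: B_def intro!: sum_nonneg)
  then have M0: "0 < M" using M d by (metis divide_nonneg_pos gr0I not_less of_nat_0)
  obtain G where G: "contractive E E G"
    and G_app: "\<And>x u w. (\<And>i. i \<in> I1 \<union> I2 \<Longrightarrow> (\<Sum>j\<in>I1 \<union> I2. R i j x * u j) = w i) \<Longrightarrow>
      (\<And>i. i \<in> I2 \<Longrightarrow> w i = u i) \<Longrightarrow> sqsum E (\<lambda>i. w i - (\<Sum>j\<in>E. G i j x * u j)) \<le>
      sqsum (I1 - E) u + sqsum I2 u / M"
    using ergodic_compression[OF R I12(2) E M0] by blast
  have "contractive {..<n} {..<n} (\<lambda>i j. G (Inl i) (Inl j))"
    by (intro contractive_reindex[OF G, where \<phi>=Inl and \<psi>=Inl]) (auto simp: E_def)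
  from mat_of_contractive[OF n this] obtain H where H: "H \<in> mats n A" "nrm H \<le> 1"
    "\<And>i j. i < n \<Longrightarrow> j < n \<Longrightarrow> H $$ (i, j) = G (Inl i) (Inl j)" by blast
  have "(cmod ((H $$ (i, j)) x - F i j x))\<^sup>2 \<le> 2 * d" if xij: "x \<in> S" "i < n" "j < n" for x i j
  proof -
    \<comment> \<open>Evaluating the tuples of rows at \<open>(x, j)\<close> singles out column
      \<open>j\<close> at the point \<open>x\<close>.\<close>
    let ?z = "(x, j)"
    have z: "?z \<in> Z" using xij by (simp add: Z_def)
    have sum_e: "(\<Sum>l\<in>E. G (Inl i) l x * vpre l ?z) = G (Inl i) (Inl j) x" for i
    proof -
      have "(\<Sum>l\<in>E. G (Inl i) l x * vpre l ?z) = (\<Sum>l<n. G (Inl i) (Inl l) x * e l ?z)"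
        unfolding E_def by (subst sum.reindex) (auto simp: vpre_def)
      also have "\<dots> = (\<Sum>l<n. if l = j then G (Inl i) (Inl j) x else 0)"
        by (intro sum.cong) (auto simp: e_def)
      finally show ?thesis using xij by simp
    qed
    have "(cmod (vout (Inl i) ?z - (\<Sum>l\<in>E. G (Inl i) l x * vpre l ?z)))\<^sup>2 \<le>
        sqsum E (\<lambda>k. vout k ?z - (\<Sum>l\<in>E. G k l x * vpre l ?z))"
      using xij by (intro member_le_sum[where f="\<lambda>k. (cmod (vout k ?z - (\<Sum>l\<in>E. G k l x * vpre l ?z)))\<^sup>2"])
        (auto simp: E_def)
    also have "\<dots> \<le> sqsum (I1 - E) (\<lambda>k. vpre k ?z) + sqsum I2 (\<lambda>k. vpre k ?z) / M"
      using R_app[OF _ z] by (intro G_app) (auto simp: I2_def vpre_def vout_def)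
    also have "sqsum (I1 - E) (\<lambda>k. vpre k ?z) = d"
    proof -
      have "I1 - E = (\<lambda>y. Inr (Inr y)) ` Z" by (auto simp: I1_def I2_def I_def E_def)
      then have "sqsum (I1 - E) (\<lambda>k. vpre k ?z) = sqsum Z (\<lambda>y. b y ?z)"
        by (simp add: sum.reindex inj_on_def vpre_def)
      also have "\<dots> = (\<Sum>y\<in>Z. if y = ?z then d else 0)"
        by (intro sum.cong) (auto simp: b_def r)
      finally show ?thesis using z Z by simp
    qed
    also have "sqsum I2 (\<lambda>k. vpre k ?z) / M \<le> d"
    proof -
      have "sqsum I2 (\<lambda>k. vpre k ?z) = sqsum {..<m} (\<lambda>j. f j ?z)"
        unfolding I2_def by (subst sum.reindex) (auto simp: inj_on_def vpre_def)
      also have "\<dots> \<le> B" unfolding B_def using z Z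
        by (intro member_le_sum[where f="\<lambda>z. \<Sum>j<m. (cmod (f j z))\<^sup>2"] sum_nonneg) auto
      also have "\<dots> \<le> d * M" using M d by (simp add: field_simps)
      finally show ?thesis using M0 by (simp add: field_simps)
    qed
    finally show ?thesis
      using sum_e H(3) xij by (simp add: vout_def g_def norm_minus_commute)
  qed
  then show ?thesis using H by blast
qed

text \<open>If \<open>D\<close> had positive distance from the cone \<open>Q\<close>, the separating
  functional would yield an admissible form contradicting \<open>adm\<close>. A point of
  \<open>Q\<close> near \<open>D\<close> is what \<open>contractive_transfer\<close> takes as
  input.\<close>

lemma admissible_separation:
  fixes F :: "nat \<Rightarrow> nat \<Rightarrow> 'x \<Rightarrow> complex"
  defines "e \<equiv> \<lambda>i z. if snd z = i then 1 else 0 :: complex"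
    and "g \<equiv> \<lambda>i z. F i (snd z) (fst z)"
  assumes S: "finite S" and n: "0 < n"
    and adm: "\<And>c. admissible S n c \<Longrightarrow>
      (\<Sum>i<n. Re (hform (S \<times> {..<n}) c (g i) (g i))) \<le> (\<Sum>i<n. Re (hform (S \<times> {..<n}) c (e i) (e i)))"
    and \<epsilon>: "0 < \<epsilon>"
  shows "\<exists>G\<in>mats n A. nrm G \<le> 1 \<and> (\<forall>x\<in>S. \<forall>i<n. \<forall>j<n. cmod ((G $$ (i, j)) x - F i j x) < \<epsilon>)"
proof -
  define Z where "Z = S \<times> {..<n}"
  have Z: "finite Z" using S by (simp add: Z_def)
  define ZZ where "ZZ = Z \<times> Z"
  have ZZ: "finite ZZ" using Z by (simp add: ZZ_def)
  interpret HS: chilbert_space "ell2 ZZ" "ell2_ip ZZ" by (rule chilbert_space_ell2)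
  \<comment> \<open>The sum of the rank-one matrices \<open>f j\<close> times its adjoint, as a
    vector in the Hilbert space of matrices over the cells.\<close>
  define gram where "gram m f p = (if p \<in> ZZ then \<Sum>j<m. f j (fst p) * cnj (f j (snd p)) else 0)"
    for m :: nat and f :: "nat \<Rightarrow> 'x \<times> nat \<Rightarrow> complex" and p
  have gram_in: "gram m f \<in> ell2 ZZ" for m f using ZZ by (simp add: finite_ell2 gram_def)
  define q where "q u f = Re (\<Sum>z\<in>Z. \<Sum>w\<in>Z. cnj (u (z, w)) * f z * cnj (f w))" for u f
  have ip_gram: "Re (ell2_ip ZZ (gram m f) u) = (\<Sum>j<m. q u (f j))" for m f u
  proof -
    have "ell2_ip ZZ (gram m f) u = (\<Sum>p\<in>ZZ. \<Sum>j<m. cnj (u p) * f j (fst p) * cnj (f j (snd p)))"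
      using ZZ by (simp add: finite_ell2_ip gram_def sum_distrib_left sum_distrib_right ac_simps)
    also have "\<dots> = (\<Sum>j<m. \<Sum>p\<in>ZZ. cnj (u p) * f j (fst p) * cnj (f j (snd p)))" by (rule sum.swap)
    also have "\<dots> = (\<Sum>j<m. \<Sum>z\<in>Z. \<Sum>w\<in>Z. cnj (u (z, w)) * f j z * cnj (f j w))"
      by (simp add: ZZ_def sum.cartesian_product case_prod_beta)
    finally show ?thesis by (simp add: q_def)
  qed
  define Q where "Q = {gram m f - gram m (act T {..<m} f) | m T f. contractive {..<m} {..<m} T}"
  define D where "D = gram n e - gram n g"
  have D_in: "D \<in> ell2 ZZ" unfolding D_def by (intro HS.diff_in gram_in)
  have contr_zero: "contractive {..<m} {..<m} (\<lambda>i j x. 0)" for m :: nat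
    by (rule contractive_cong[OF contractive_scalar[where a="\<lambda>_ _. 0"]])
      (auto simp: scalar_contraction_def sum_nonneg)
  have not_separated: "\<exists>z\<in>Q. hnorm (ell2_ip ZZ) (D - z) < d" if d: "0 < d" for d
  proof (rule ccontr)
    assume "\<not> ?thesis"
    then have far: "\<And>z. z \<in> Q \<Longrightarrow> d \<le> hnorm (ell2_ip ZZ) (D - z)" by (auto simp: not_less)
    have Q_in: "Q \<subseteq> ell2 ZZ" unfolding Q_def by (auto intro: HS.diff_in gram_in)
    have Q_ne: "Q \<noteq> {}" unfolding Q_def using contr_zero by blast
    have Q_add: "u + v \<in> Q" if "u \<in> Q" "v \<in> Q" for u v
    proof -
      from that obtain m1 T1 f1 m2 T2 f2 where
        u: "u = gram m1 f1 - gram m1 (act T1 {..<m1} f1)" "contractive {..<m1} {..<m1} T1" and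
        v: "v = gram m2 f2 - gram m2 (act T2 {..<m2} f2)" "contractive {..<m2} {..<m2} T2"
        unfolding Q_def by blast
      \<comment> \<open>Addition in \<open>Q\<close> concatenates the tuples and takes the direct
        sum of the matrices.\<close>
      define f where "f j = (if j < m1 then f1 j else f2 (j - m1))" for j
      define T where "T i j x = (if i \<in> {..<m1} then (if j \<in> {..<m1} then T1 i j x else 0)
        else (if j \<in> {..<m1} then 0 else T2 (i - m1) (j - m1) x))" for i j x
      have "contractive {m1..<m1 + m2} {m1..<m1 + m2} (\<lambda>i j. T2 (i - m1) (j - m1))"
        by (intro contractive_reindex[OF v(2), where \<phi>="\<lambda>i. i - m1" and \<psi>="\<lambda>i. i - m1"])
          (auto simp: inj_on_def)
      with u(2) have "contractive ({..<m1} \<union> {m1..<m1 + m2}) ({..<m1} \<union> {m1..<m1 + m2}) T"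
        unfolding T_def[abs_def] by (rule contractive_direct_sum) auto
      moreover have "{..<m1} \<union> {m1..<m1 + m2} = {..<m1 + m2}" by auto
      ultimately have "contractive {..<m1 + m2} {..<m1 + m2} T" by simp
      moreover have "u + v = gram (m1 + m2) f - gram (m1 + m2) (act T {..<m1 + m2} f)"
        unfolding u(1) v(1)
        by (auto simp: fun_eq_iff gram_def sum_lessThan_add f_def T_def act_def)
      ultimately show ?thesis unfolding Q_def by blast
    qed
    have Q_scale: "complex_of_real t *\<^sub>C u \<in> Q" if "u \<in> Q" "0 < t" for u t
    proof -
      from that obtain m T f where
        u: "u = gram m f - gram m (act T {..<m} f)" "contractive {..<m} {..<m} T"
        unfolding Q_def by blast
      define h where "h j z = complex_of_real (sqrt t) * f j z" for j z
      have act_h: "act T {..<m} h i z = complex_of_real (sqrt t) * act T {..<m} f i z" for i z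
        by (simp add: act_def h_def sum_distrib_left ac_simps)
      have st: "complex_of_real (sqrt t) * complex_of_real (sqrt t) = complex_of_real t"
        using that(2) by (simp flip: of_real_mult)
      have scaled: "complex_of_real (sqrt t) * a * cnj (complex_of_real (sqrt t) * b) = complex_of_real t * (a * cnj b)"
        for a b by (simp add: st[symmetric] ac_simps)
      have "complex_of_real t *\<^sub>C u = gram m h - gram m (act T {..<m} h)"
        unfolding u(1)
        by (auto simp: fun_eq_iff gram_def act_h scaled h_def scaleC_simps
            sum_distrib_left right_diff_distrib simp del: complex_cnj_mult)
      then show ?thesis unfolding Q_def using u(2) by blast
    qed
    from HS.cone_separation[OF Q_in Q_ne Q_add Q_scale D_in d far] obtain u where
      uQ: "\<And>z. z \<in> Q \<Longrightarrow> 0 \<le> Re (ell2_ip ZZ z u)" and uD: "Re (ell2_ip ZZ D u) < 0" by blast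
    have q_contr: "(\<Sum>i<m. q u (act T {..<m} f i)) \<le> (\<Sum>j<m. q u (f j))"
      if "contractive {..<m} {..<m} T" for m :: nat and T f
    proof -
      have "0 \<le> Re (ell2_ip ZZ (gram m f - gram m (act T {..<m} f)) u)"
        using that by (intro uQ) (auto simp: Q_def)
      then show ?thesis
        using ZZ by (simp add: ip_gram[symmetric] finite_ell2_ip left_diff_distrib sum_subtractf)
    qed
    \<comment> \<open>The zero matrix is contractive, so \<open>Q\<close> contains every Gram
      matrix, and the functional is nonnegative there.\<close>
    have q_nonneg: "0 \<le> q u f" for f
      using q_contr[OF contr_zero[of 1], of "\<lambda>_. f"] by (simp add: act_def q_def)
    have q_D: "(\<Sum>i<n. q u (e i)) < (\<Sum>i<n. q u (g i))"
      using uD ZZ by (simp add: D_def ip_gram[symmetric] finite_ell2_ip left_diff_distrib sum_subtractf)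
    define s where "s f = sqsum Z f" for f :: "'x \<times> nat \<Rightarrow> complex"
    have s_nonneg: "0 \<le> s f" for f by (auto simp: s_def intro: sum_nonneg)
    \<comment> \<open>\<open>u\<close> need not be Hermitian; symmetrizing keeps the real part of
      its quadratic form. The identity supplies the lower bound that admissibility demands.\<close>
    define c where "c t z w = complex_of_real t * (cnj (u (z, w)) + u (w, z)) / 2 + (if z = w then 1 else 0)" for t z w
    have form_c: "Re (hform Z (c t) f f) = t * q u f + s f" for t f
    proof -
      define P where "P = (\<Sum>z\<in>Z. \<Sum>w\<in>Z. cnj (u (z, w)) * f z * cnj (f w))"
      have P': "(\<Sum>z\<in>Z. \<Sum>w\<in>Z. u (w, z) * f z * cnj (f w)) = cnj P"
        unfolding P_def by (subst sum.swap) (simp add: ac_simps)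
      have diag: "(\<Sum>z\<in>Z. \<Sum>w\<in>Z. (if z = w then 1 else 0) * f z * cnj (f w)) = of_real (s f)"
        using hform_diagonal[OF Z, of f] by (simp only: hform_def s_def)
      have "hform Z (c t) f f = (\<Sum>z\<in>Z. \<Sum>w\<in>Z.
          of_real t / 2 * (cnj (u (z, w)) * f z * cnj (f w)) + of_real t / 2 * (u (w, z) * f z * cnj (f w))
          + (if z = w then 1 else 0) * f z * cnj (f w))"
        unfolding hform_def c_def by (intro sum.cong refl) (simp add: field_simps)
      also have "\<dots> = of_real t / 2 * P + of_real t / 2 * cnj P + of_real (s f)"
        unfolding sum.distrib diag sum_distrib_left[symmetric] P' P_def[symmetric] ..
      also have "Re \<dots> = t * Re P + s f" by simp
      finally show ?thesis by (simp add: q_def P_def)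
    qed
    have c_adm: "admissible S n (c t)" if t: "0 \<le> t" for t
      unfolding admissible_def Z_def[symmetric] form_c
    proof (intro conjI allI impI)
      show "c t w z = cnj (c t z w)" for z w by (simp add: c_def add.commute)
      show "sqsum Z f \<le> t * q u f + s f" for f
        using t q_nonneg[of f] by (simp add: s_def)
      fix m :: nat and T f assume T: "contractive {..<m} {..<m} T"
      have "t * (\<Sum>i<m. q u (act T {..<m} f i)) + (\<Sum>i<m. s (act T {..<m} f i))
          \<le> t * (\<Sum>j<m. q u (f j)) + (\<Sum>j<m. s (f j))"
        unfolding s_def using t q_contr[OF T] act_diagonal_bound[OF T] by (intro add_mono mult_left_mono) auto
      then show "(\<Sum>i<m. t * q u (act T {..<m} f i) + s (act T {..<m} f i)) \<le> (\<Sum>j<m. t * q u (f j) + s (f j))"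
        by (simp add: sum.distrib sum_distrib_left)
    qed
    \<comment> \<open>Large enough for the strict gap in \<open>q\<close> to outweigh the sum of the
      \<open>s (e i)\<close>, the most that the identity part can compensate; the extra 1 makes the
      contradiction strict.\<close>
    define t where "t = ((\<Sum>i<n. s (e i)) + 1) / ((\<Sum>i<n. q u (g i)) - (\<Sum>i<n. q u (e i)))"
    have t: "0 \<le> t" unfolding t_def using q_D s_nonneg by (intro divide_nonneg_pos add_nonneg_nonneg sum_nonneg) auto
    have "t * ((\<Sum>i<n. q u (g i)) - (\<Sum>i<n. q u (e i))) = (\<Sum>i<n. s (e i)) + 1"
      using q_D by (simp add: t_def)
    moreover have "t * (\<Sum>i<n. q u (g i)) + (\<Sum>i<n. s (g i)) \<le> t * (\<Sum>i<n. q u (e i)) + (\<Sum>i<n. s (e i))"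
      using adm[OF c_adm[OF t]] unfolding Z_def[symmetric] form_c by (simp add: sum.distrib sum_distrib_left)
    moreover have "0 \<le> (\<Sum>i<n. s (g i))" using s_nonneg by (intro sum_nonneg) auto
    ultimately show False by (simp add: right_diff_distrib)
  qed
  \<comment> \<open>\<open>contractive_transfer\<close> leaves the squared error
    \<open>2 * d\<close>, which has to stay below \<open>\<epsilon>\<^sup>2\<close>.\<close>
  define d where "d = \<epsilon>\<^sup>2 / 4"
  have d: "0 < d" using \<epsilon> by (simp add: d_def)
  from not_separated[OF d] obtain m T f where T: "contractive {..<m} {..<m} T"
    and near: "hnorm (ell2_ip ZZ) (D - (gram m f - gram m (act T {..<m} f))) < d"
    unfolding Q_def by blast
  have "sqsum {..<n} (\<lambda>i. \<Sum>z\<in>Z. c z * g i z) + sqsum {..<m} (\<lambda>j. \<Sum>z\<in>Z. c z * f j z) \<le>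
      sqsum {..<n} (\<lambda>i. \<Sum>z\<in>Z. c z * e i z) +
        sqsum {..<m} (\<lambda>j. \<Sum>z\<in>Z. c z * act T {..<m} f j z) + d * sqsum Z c" for c
  proof -
    let ?E = "D - (gram m f - gram m (act T {..<m} f))"
    \<comment> \<open>Pairing with this rank-one matrix turns Gram matrices into the square sums of
      the inequality. Its norm is \<open>sqsum Z c\<close>, so the distance to \<open>Q\<close>
      costs at most \<open>d * sqsum Z c\<close>.\<close>
    define k where "k p = (if p \<in> ZZ then cnj (c (fst p)) * c (snd p) else 0)" for p
    have k_in: "k \<in> ell2 ZZ" using ZZ by (simp add: finite_ell2 k_def)
    have ip_k: "Re (ell2_ip ZZ (gram l h) k) = sqsum {..<l} (\<lambda>j. \<Sum>z\<in>Z. c z * h j z)" for l h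
    proof -
      have "q k f = (cmod (\<Sum>z\<in>Z. c z * f z))\<^sup>2" for f
      proof -
        have "(\<Sum>z\<in>Z. \<Sum>w\<in>Z. cnj (k (z, w)) * f z * cnj (f w))
            = (\<Sum>z\<in>Z. c z * f z) * cnj (\<Sum>w\<in>Z. c w * f w)"
          unfolding cnj_sum sum_product by (intro sum.cong refl) (auto simp: k_def ZZ_def)
        also have "\<dots> = of_real ((cmod (\<Sum>z\<in>Z. c z * f z))\<^sup>2)" by (simp only: complex_norm_square)
        finally show ?thesis by (simp add: q_def)
      qed
      then show ?thesis by (simp add: ip_gram)
    qed
    have "(hnorm (ell2_ip ZZ) k)\<^sup>2 = (\<Sum>p\<in>ZZ. (cmod (c (fst p)))\<^sup>2 * (cmod (c (snd p)))\<^sup>2)"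
      using ZZ by (simp add: ell2_norm[OF k_in] k_def norm_mult power_mult_distrib)
    also have "\<dots> = (sqsum Z c)\<^sup>2"
      by (simp add: ZZ_def power2_eq_square sum_product sum.cartesian_product case_prod_beta)
    finally have k_norm: "hnorm (ell2_ip ZZ) k = sqsum Z c"
      by (rule power2_eq_imp_eq) (auto intro: HS.hnorm_nonneg k_in sum_nonneg)
    have E_in: "?E \<in> ell2 ZZ" by (intro HS.diff_in D_in gram_in)
    have "- Re (ell2_ip ZZ ?E k) \<le> cmod (ell2_ip ZZ ?E k)"
      using abs_Re_le_cmod[of "ell2_ip ZZ ?E k"] by linarith
    also have "\<dots> \<le> hnorm (ell2_ip ZZ) ?E * hnorm (ell2_ip ZZ) k"
      by (rule HS.cmod_le_hnorm[OF E_in k_in])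
    also have "\<dots> \<le> d * sqsum Z c"
      unfolding k_norm using near by (intro mult_right_mono sum_nonneg) auto
    finally have *: "- Re (ell2_ip ZZ ?E k) \<le> d * sqsum Z c" .
    have "Re (ell2_ip ZZ ?E k) = sqsum {..<n} (\<lambda>i. \<Sum>z\<in>Z. c z * e i z) - sqsum {..<n} (\<lambda>i. \<Sum>z\<in>Z. c z * g i z)
      - (sqsum {..<m} (\<lambda>j. \<Sum>z\<in>Z. c z * f j z) - sqsum {..<m} (\<lambda>j. \<Sum>z\<in>Z. c z * act T {..<m} f j z))"
      by (simp add: D_def HS.diff_left HS.diff_in gram_in k_in ip_k)
    with * show ?thesis by linarith
  qed
  then have "\<exists>G\<in>mats n A. nrm G \<le> 1 \<and>
    (\<forall>x\<in>S. \<forall>i<n. \<forall>j<n. (cmod ((G $$ (i, j)) x - F i j x))\<^sup>2 \<le> 2 * d)"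
    unfolding Z_def e_def g_def by (rule contractive_transfer[OF S n T d])
  moreover have "cmod w < \<epsilon>" if "(cmod w)\<^sup>2 \<le> 2 * d" for w
  proof (rule power2_less_imp_less)
    have "2 * d < \<epsilon>\<^sup>2" using \<epsilon> by (simp add: d_def)
    then show "(cmod w)\<^sup>2 < \<epsilon>\<^sup>2" using that by linarith
  qed (use \<epsilon> in simp)
  ultimately show ?thesis by blast
qed

end

section \<open>Kernels from spaces of functions\<close>

text \<open>The kernel is an evaluation composed with the adjoint of another; its quadratic form is
  the squared norm of the vector \<open>g\<close> below.\<close>

lemma kernel_of_bounded_evaluations:
  assumes C: "chilbert_space C ip" and L: "chilbert_space L ipL"
    and ev: "\<And>x. bounded_op L ipL C ip (\<lambda>f. f x)"
  shows "\<exists>K. positive_definite_kernel C ip K \<and> is_kernel_space C ip K L ipL"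
proof -
  interpret C: chilbert_space C ip by fact
  interpret L: chilbert_space L ipL by fact
  have "\<exists>S. is_adjoint L ipL C ip (\<lambda>f. f y) S" for y
    using C L ev by (intro adjoint_exists)
  then obtain S where S: "\<And>y. is_adjoint L ipL C ip (\<lambda>f. f y) (S y)" by metis
  have S_op: "bounded_op C ip L ipL (S y)" for y using S[of y] by (simp add: is_adjoint_def)
  have adj: "ip (f y) v = ipL f (S y v)" if "f \<in> L" "v \<in> C" for f y v
    using S[of y] that by (simp add: is_adjoint_def)
  have S_in: "S y v \<in> L" if "v \<in> C" for y v using S_op[of y] that by (simp add: bounded_op_def)
  have ev_in: "f x \<in> C" if "f \<in> L" for f x using ev[of x] that by (simp add: bounded_op_def)
  define K where "K x y v = S y v x" for x y v
  have "bounded_op C ip C ip (K x y)" for x y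
  proof -
    obtain b where b: "\<And>v. v \<in> C \<Longrightarrow> hnorm ipL (S y v) \<le> b * hnorm ip v"
      using S_op[of y] unfolding bounded_op_def by blast
    obtain b' where b': "\<And>f. f \<in> L \<Longrightarrow> hnorm ip (f x) \<le> b' * hnorm ipL f"
      using ev[of x] unfolding bounded_op_def by blast
    have "hnorm ip (K x y v) \<le> (\<bar>b'\<bar> * b) * hnorm ip v" if v: "v \<in> C" for v
    proof -
      have "hnorm ip (K x y v) \<le> b' * hnorm ipL (S y v)" unfolding K_def using S_in[OF v] by (rule b')
      also have "\<dots> \<le> \<bar>b'\<bar> * hnorm ipL (S y v)"
        using L.hnorm_nonneg[OF S_in[OF v]] by (intro mult_right_mono) auto
      also have "\<dots> \<le> \<bar>b'\<bar> * (b * hnorm ip v)" using b[OF v] by (intro mult_left_mono) auto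
      finally show ?thesis by (simp add: mult.assoc)
    qed
    then show ?thesis
      using S_op[of y] S_in ev_in by (auto simp: bounded_op_def K_def scaleC_fun_def)
  qed
  moreover have "(\<Sum>x\<in>F. ip (\<Sum>y\<in>F. K x y (v y)) (v x)) \<in> \<real>\<^sub>\<ge>\<^sub>0"
    if F: "finite F" "\<forall>x\<in>F. v x \<in> C" for F v
  proof -
    define g where "g = (\<Sum>y\<in>F. S y (v y))"
    have g: "g \<in> L" unfolding g_def using F S_in by (intro L.sum_in) auto
    have "(\<Sum>x\<in>F. ip (\<Sum>y\<in>F. K x y (v y)) (v x)) = (\<Sum>x\<in>F. ip (g x) (v x))"
      by (simp add: K_def g_def fun_sum_apply)
    also have "\<dots> = (\<Sum>x\<in>F. ipL g (S x (v x)))" using F g by (simp add: adj)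
    also have "\<dots> = ipL g g" using F g S_in by (subst (2) g_def) (simp add: L.sum_right)
    also have "\<dots> = of_real (Re (ipL g g))" by (rule L.self_real[OF g])
    finally show ?thesis using L.nonneg[OF g] by (metis nonneg_Reals_of_real_iff)
  qed
  ultimately have "positive_definite_kernel C ip K" unfolding positive_definite_kernel_def by blast
  moreover have "is_kernel_space C ip K L ipL"
    unfolding is_kernel_space_def using L ev S by (auto simp: K_def)
  ultimately show ?thesis by blast
qed

section \<open>Hermitian forms\<close>

lemma hform_add_left: "hform Z c (\<lambda>z. f z + g z) h = hform Z c f h + hform Z c g h"
  by (simp add: hform_def algebra_simps sum.distrib)

lemma hform_scale_left: "hform Z c (\<lambda>z. a * f z) h = a * hform Z c f h"
  by (simp add: hform_def sum_distrib_left ac_simps)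

lemma hform_commute:
  assumes "\<And>z w. c w z = cnj (c z w)"
  shows "hform Z c f g = cnj (hform Z c g f)"
proof -
  have "hform Z c f g = (\<Sum>w\<in>Z. \<Sum>z\<in>Z. c z w * f z * cnj (g w))"
    unfolding hform_def by (rule sum.swap)
  also have "\<dots> = cnj (hform Z c g f)"
    unfolding hform_def cnj_sum by (intro sum.cong refl) (simp add: assms[symmetric] ac_simps)
  finally show ?thesis .
qed

lemma hform_cong:
  "(\<And>z. z \<in> Z \<Longrightarrow> f z = f' z) \<Longrightarrow> (\<And>z. z \<in> Z \<Longrightarrow> g z = g' z) \<Longrightarrow> hform Z c f g = hform Z c f' g'"
  unfolding hform_def by (intro sum.cong refl) auto

lemma hform_tendsto:
  assumes "\<And>z w. z \<in> Z \<Longrightarrow> w \<in> Z \<Longrightarrow> ((\<lambda>t. c t z w) \<longlongrightarrow> c' z w) F"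
    and "\<And>z. z \<in> Z \<Longrightarrow> ((\<lambda>t. f t z) \<longlongrightarrow> f' z) F"
    and "\<And>z. z \<in> Z \<Longrightarrow> ((\<lambda>t. g t z) \<longlongrightarrow> g' z) F"
  shows "((\<lambda>t. hform Z (c t) (f t) (g t)) \<longlongrightarrow> hform Z c' f' g') F"
  unfolding hform_def using assms by (intro tendsto_intros) auto

lemma LIMSEQ_of_dist_bound:
  assumes "\<And>t. dist (s t) l < 1 / Suc t"
  shows "s \<longlonglongrightarrow> (l :: 'a :: metric_space)"
proof (rule metric_tendsto_imp_tendsto[OF LIMSEQ_Suc[OF lim_1_over_n]])
  show "\<forall>\<^sub>F t in sequentially. dist (s t) l \<le> dist (1 / of_nat (Suc t)) (0 :: real)"
    using assms by (intro always_eventually allI) (simp add: less_imp_le)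
qed

lemma summable_on_finite_sum:
  fixes f :: "'i \<Rightarrow> 'b \<Rightarrow> real"
  shows "(\<And>i. i \<in> I \<Longrightarrow> f i summable_on B) \<Longrightarrow> (\<lambda>b. \<Sum>i\<in>I. f i b) summable_on B"
  by (induction I rule: infinite_finite_induct) (auto intro: summable_on_add)

lemma infsum_finite_sum:
  fixes f :: "'i \<Rightarrow> 'b \<Rightarrow> real"
  shows "(\<And>i. i \<in> I \<Longrightarrow> f i summable_on B) \<Longrightarrow> (\<Sum>\<^sub>\<infinity>b\<in>B. \<Sum>i\<in>I. f i b) = (\<Sum>i\<in>I. \<Sum>\<^sub>\<infinity>b\<in>B. f i b)"
  by (induction I rule: infinite_finite_induct) (auto simp: infsum_add summable_on_finite_sum)

text \<open>The points of a countable dense set of functions on \<open>Z\<close> need not lie in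
  \<open>P\<close>. For each such point and each tolerance a member of \<open>P\<close> that near is
  selected if there is one, and an arbitrary member otherwise; the selections are dense in
  \<open>P\<close>.\<close>

lemma countable_dense_sequence:
  fixes P :: "('z \<Rightarrow> complex) set"
  assumes Z: "finite Z" and P: "P \<noteq> {}"
  shows "\<exists>r :: nat \<Rightarrow> 'z \<Rightarrow> complex. range r \<subseteq> P \<and>
    (\<forall>c\<in>P. \<forall>\<epsilon>>0. \<exists>k. \<forall>z\<in>Z. cmod (r k z - c z) < \<epsilon>)"
proof -
  define D where "D = range (\<lambda>(p, q). Complex (of_rat p) (of_rat q))"
  have D: "countable D" by (auto simp: D_def)
  have dense: "\<exists>d\<in>D. cmod (z - d) < e" if "0 < e" for z e
  proof -
    have "r - e / 2 < r + e / 2" for r :: real using that by simp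
    then have near: "\<exists>q. r - e / 2 < of_rat q \<and> of_rat q < r + e / 2" for r by (intro of_rat_dense)
    obtain p q where p: "Re z - e / 2 < of_rat p" "of_rat p < Re z + e / 2"
      and q: "Im z - e / 2 < of_rat q" "of_rat q < Im z + e / 2"
      using near[of "Re z"] near[of "Im z"] by blast
    have "cmod (z - Complex (of_rat p) (of_rat q)) \<le> \<bar>of_rat p - Re z\<bar> + \<bar>of_rat q - Im z\<bar>"
      using cmod_le[of "z - Complex (of_rat p) (of_rat q)"] by (simp add: abs_minus_commute)
    also have "\<dots> < e / 2 + e / 2" using p q by (intro add_strict_mono) (simp_all only: abs_diff_less_iff)
    finally show ?thesis by (auto simp: D_def)
  qed
  define near where "near d t c \<longleftrightarrow> c \<in> P \<and> (\<forall>z\<in>Z. cmod (c z - d z) < 1 / Suc t)" for d t c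
  define sel where "sel p = (if \<exists>c. near (fst p) (snd p) c then SOME c. near (fst p) (snd p) c else SOME c. c \<in> P)" for p
  have "\<exists>T :: ('z \<Rightarrow> complex) set. countable T \<and> (\<forall>c e. 0 < e \<longrightarrow> (\<exists>d\<in>T. \<forall>z\<in>Z. cmod (c z - d z) < e))"
    using Z
  proof (induction Z rule: finite_induct)
    case empty
    show ?case by (intro exI[of _ "{\<lambda>_. 0}"]) simp
  next
    case (insert y Z)
    then obtain T :: "('z \<Rightarrow> complex) set" where T: "countable T"
      "\<And>c e. 0 < e \<Longrightarrow> \<exists>d\<in>T. \<forall>z\<in>Z. cmod (c z - d z) < e" by blast
    have "\<exists>d\<in>(\<lambda>(d, q). d(y := q)) ` (T \<times> D). \<forall>z\<in>insert y Z. cmod (c z - d z) < e"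
      if e: "0 < e" for c :: "'z \<Rightarrow> complex" and e
    proof -
      obtain d q where "d \<in> T" "\<forall>z\<in>Z. cmod (c z - d z) < e" "q \<in> D" "cmod (c y - q) < e"
        using T(2)[OF e, of c] dense[OF e, of "c y"] by blast
      then show ?thesis using insert.hyps(2) by (intro bexI[of _ "d(y := q)"]) auto
    qed
    then show ?case using T(1) D by (intro exI[of _ "(\<lambda>(d, q). d(y := q)) ` (T \<times> D)"]) auto
  qed
  then obtain T0 :: "('z \<Rightarrow> complex) set" where T0: "countable T0"
    "\<And>c e. 0 < e \<Longrightarrow> \<exists>d\<in>T0. \<forall>z\<in>Z. cmod (c z - d z) < e" by blast
  define T where "T = T0 \<times> (UNIV :: nat set)"
  have selP: "sel p \<in> P" for p
  proof (cases "\<exists>c. near (fst p) (snd p) c")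
    case True
    then have "near (fst p) (snd p) (sel p)" using someI_ex[OF True] by (simp only: sel_def if_True)
    then show ?thesis by (simp add: near_def)
  next
    case False
    then show ?thesis using P some_in_eq[of P] by (simp add: sel_def)
  qed
  have "T0 \<noteq> {}" using T0(2)[of 1] by auto
  then have T: "T \<noteq> {}" "countable T" using T0(1) by (auto simp: T_def)
  define r where "r = from_nat_into (sel ` T)"
  have range: "range r = sel ` T" unfolding r_def using T by (intro range_from_nat_into) auto
  have "\<exists>k. \<forall>z\<in>Z. cmod (r k z - c z) < \<epsilon>" if c: "c \<in> P" and \<epsilon>: "0 < \<epsilon>" for c \<epsilon>
  proof -
    obtain t where t: "1 / Suc t < \<epsilon> / 2" using \<epsilon> nat_approx_posE[of "\<epsilon> / 2"] by auto
    have "0 < 1 / real (Suc t)" by simp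
    from T0(2)[OF this] obtain d where d: "d \<in> T0" "\<And>z. z \<in> Z \<Longrightarrow> cmod (c z - d z) < 1 / Suc t" by blast
    have "near d t c" using c d(2) by (simp add: near_def)
    then have ne: "\<exists>c. near (fst (d, t)) (snd (d, t)) c" by auto
    then have "near (fst (d, t)) (snd (d, t)) (sel (d, t))" using someI_ex[OF ne] by (simp only: sel_def if_True)
    then have sel: "near d t (sel (d, t))" by simp
    have "(d, t) \<in> T" using d(1) by (simp add: T_def)
    then obtain k where k: "r k = sel (d, t)" using range by (metis imageI rangeE)
    have "cmod (r k z - c z) < \<epsilon>" if "z \<in> Z" for z
    proof -
      have "cmod (r k z - c z) \<le> cmod (r k z - d z) + cmod (d z - c z)"
        using norm_triangle_ineq[of "r k z - d z" "d z - c z"] by simp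
      moreover have "cmod (r k z - d z) < 1 / Suc t" using sel that by (simp add: near_def k)
      moreover have "cmod (d z - c z) < 1 / Suc t"
        using d(2)[OF that] by (simp add: norm_minus_commute)
      ultimately show ?thesis using t by simp
    qed
    then show ?thesis by blast
  qed
  then show ?thesis using range selP by (intro exI[of _ r]) auto
qed

section \<open>Dense sequences of admissible forms\<close>

context operator_algebra_of_functions
begin

lemma admissible_form:
  assumes "admissible S n c"
  shows "semi_inner_product UNIV (hform (S \<times> {..<n}) c)"
proof
  have comm: "\<And>z w. c w z = cnj (c z w)" using assms unfolding admissible_def by blast
  show "hform (S \<times> {..<n}) c v w = cnj (hform (S \<times> {..<n}) c w v)" for v w
    using comm by (rule hform_commute)
  show "0 \<le> Re (hform (S \<times> {..<n}) c v v)" for v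
  proof -
    have "0 \<le> sqsum (S \<times> {..<n}) v" by (intro sum_nonneg) auto
    also have "\<dots> \<le> Re (hform (S \<times> {..<n}) c v v)" using assms unfolding admissible_def by blast
    finally show ?thesis .
  qed
qed (auto simp: plus_fun_def hform_add_left scaleC_simps hform_scale_left)

lemma admissible_ge:
  "admissible S n c \<Longrightarrow> sqsum (S \<times> {..<n}) f \<le> Re (hform (S \<times> {..<n}) c f f)"
  unfolding admissible_def by blast

lemma admissible_contractive:
  fixes m :: nat
  shows "admissible S n c \<Longrightarrow> contractive {..<m} {..<m} T \<Longrightarrow>
    (\<Sum>i<m. Re (hform (S \<times> {..<n}) c (act T {..<m} f i) (act T {..<m} f i)))
      \<le> (\<Sum>j<m. Re (hform (S \<times> {..<n}) c (f j) (f j)))"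
  unfolding admissible_def by blast

lemma admissible_diagonal:
  assumes "finite S"
  shows "admissible S n (\<lambda>z w. if z = w then 1 else 0)"
proof -
  have "Re (hform (S \<times> {..<n}) (\<lambda>z w. if z = w then 1 else 0) f f) = sqsum (S \<times> {..<n}) f" for f
    using assms by (simp only: hform_diagonal finite_cartesian_product finite_lessThan Re_complex_of_real)
  then show ?thesis unfolding admissible_def using act_diagonal_bound by auto
qed

definition dense_admissible :: "'x set \<Rightarrow> nat \<Rightarrow> (nat \<Rightarrow> 'x \<times> nat \<Rightarrow> 'x \<times> nat \<Rightarrow> complex) \<Rightarrow> bool" where
  "dense_admissible S n cs \<longleftrightarrow> (\<forall>r. admissible S n (cs r)) \<and> (\<forall>c. admissible S n c \<longrightarrow>
    (\<forall>\<epsilon>>0. \<exists>r. \<forall>z\<in>S \<times> {..<n}. \<forall>w\<in>S \<times> {..<n}. cmod (cs r z w - c z w) < \<epsilon>))"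

lemma admissible_sequence_exists:
  assumes "finite S"
  shows "\<exists>cs. dense_admissible S n cs"
proof -
  let ?Z = "S \<times> {..<n}"
  let ?P = "{c. admissible S n (curry c)}"
  have "(\<lambda>(z, w). if z = w then 1 else 0) \<in> ?P"
    using admissible_diagonal[OF assms] by (simp add: curry_def)
  then have "?P \<noteq> {}" by blast
  from countable_dense_sequence[OF _ this, of "?Z \<times> ?Z"] assms
  obtain r :: "nat \<Rightarrow> _" where r: "range r \<subseteq> ?P"
    "\<And>c \<epsilon>. c \<in> ?P \<Longrightarrow> 0 < \<epsilon> \<Longrightarrow> \<exists>k. \<forall>z\<in>?Z \<times> ?Z. cmod (r k z - c z) < \<epsilon>" by auto
  have "\<exists>k. \<forall>z\<in>?Z. \<forall>w\<in>?Z. cmod (curry (r k) z w - c z w) < \<epsilon>"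
    if "admissible S n c" "0 < \<epsilon>" for c \<epsilon>
  proof -
    have "case_prod c \<in> ?P" using that by simp
    from r(2)[OF this that(2)] show ?thesis by fastforce
  qed
  moreover have "admissible S n (curry (r k))" for k using subsetD[OF r(1) rangeI[of r k]] by simp
  ultimately show ?thesis unfolding dense_admissible_def by (intro exI[of _ "\<lambda>k. curry (r k)"]) auto
qed

end

section \<open>The direct sum of the admissible forms\<close>

type_synonym 'x block = "'x set \<times> nat \<times> nat \<times> nat"

text \<open>The sequences are parameters, so that the space below is defined outright; the choice is
  made once, in the final theorem.\<close>

locale admissible_sequences = operator_algebra_of_functions A nrm
  for A :: "('x \<Rightarrow> complex) set" and nrm +
  fixes cs :: "'x set \<Rightarrow> nat \<Rightarrow> nat \<Rightarrow> 'x \<times> nat \<Rightarrow> 'x \<times> nat \<Rightarrow> complex"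
  assumes cs: "finite S \<Longrightarrow> dense_admissible S n (cs S n)"
begin

lemma cs_admissible: "finite S \<Longrightarrow> admissible S n (cs S n r)"
  using cs[of S n] by (simp add: dense_admissible_def)

lemma cs_dense:
  assumes "finite S" "admissible S n c" "0 < \<epsilon>"
  shows "\<exists>r. \<forall>z\<in>S \<times> {..<n}. \<forall>w\<in>S \<times> {..<n}. cmod (cs S n r z w - c z w) < \<epsilon>"
  using cs[OF assms(1), of n, unfolded dense_admissible_def, THEN conjunct2, THEN spec, THEN mp, OF assms(2),
      THEN spec, THEN mp, OF assms(3)] .

text \<open>A block \<open>(S, n, r, k)\<close> stands for the \<open>k\<close>-th copy of the \<open>r\<close>-th form on functions
  \<open>S \<rightarrow> \<complex>\<^sup>n\<close>. Having infinitely many copies makes multipliers automatically bounded.\<close>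

definition blocks :: "'x block set" where
  "blocks = {(S, n, r, k). finite S \<and> S \<noteq> {} \<and> 0 < n}"

definition pts :: "'x block \<Rightarrow> 'x set" where "pts b = fst b"

definition dm :: "'x block \<Rightarrow> nat" where "dm b = fst (snd b)"

abbreviation cells :: "'x block \<Rightarrow> ('x \<times> nat) set" where "cells b \<equiv> pts b \<times> {..<dm b}"

definition frm :: "'x block \<Rightarrow> ('x \<times> nat \<Rightarrow> complex) \<Rightarrow> ('x \<times> nat \<Rightarrow> complex) \<Rightarrow> complex" where
  "frm b = hform (cells b) (cs (pts b) (dm b) (fst (snd (snd b))))"

definition sq :: "'x block \<Rightarrow> ('x \<times> nat \<Rightarrow> complex) \<Rightarrow> real" where
  "sq b f = Re (frm b f f)"

text \<open>The \<open>a\<close>-th coordinate of block \<open>b\<close> is indexed by a function on \<open>X\<close> that is supported on the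
  points of the block and has a code of the remaining data as its value.\<close>

definition idx :: "'x block \<times> nat \<Rightarrow> 'x \<Rightarrow> complex" where
  "idx p = (\<lambda>x. if x \<in> pts (fst p) then of_nat (Suc (to_nat (snd (fst p), snd p))) else 0)"

definition supported :: "'x \<Rightarrow> ('x \<Rightarrow> complex) \<Rightarrow> bool" where
  "supported x \<iota> \<longleftrightarrow> (\<exists>b\<in>blocks. \<exists>a<dm b. x \<in> pts b \<and> \<iota> = idx (b, a))"

definition crd :: "'x block \<Rightarrow> ('x \<Rightarrow> ('x \<Rightarrow> complex) \<Rightarrow> complex) \<Rightarrow> 'x \<times> nat \<Rightarrow> complex" where
  "crd b h z = h (fst z) (idx (b, snd z))"

text \<open>The inverse of \<open>crd\<close>: a family of functions on the blocks is assembled to a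
  function on X, with block and coordinate decoded from \<open>\<iota>\<close>.\<close>

definition asm :: "('x block \<Rightarrow> 'x \<times> nat \<Rightarrow> complex) \<Rightarrow> 'x \<Rightarrow> ('x \<Rightarrow> complex) \<Rightarrow> complex" where
  "asm G x \<iota> = (if supported x \<iota> then
     (let p = inv_into {p. fst p \<in> blocks} idx \<iota> in G (fst p) (x, snd p)) else 0)"

text \<open>Entries seen by no block would spoil definiteness; once they vanish, elements are
  determined by their coordinates (\<open>V_ext\<close>).\<close>

definition V :: "('x \<Rightarrow> ('x \<Rightarrow> complex) \<Rightarrow> complex) set" where
  "V = {h. \<forall>x \<iota>. \<not> supported x \<iota> \<longrightarrow> h x \<iota> = 0}"

definition L :: "('x \<Rightarrow> ('x \<Rightarrow> complex) \<Rightarrow> complex) set" where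
  "L = {h \<in> V. (\<lambda>b. sq b (crd b h)) summable_on blocks}"

definition ipL :: "('x \<Rightarrow> ('x \<Rightarrow> complex) \<Rightarrow> complex) \<Rightarrow> ('x \<Rightarrow> ('x \<Rightarrow> complex) \<Rightarrow> complex) \<Rightarrow> complex" where
  "ipL u v = (\<Sum>\<^sub>\<infinity>b\<in>blocks. frm b (crd b u) (crd b v))"

lemma blocksD: "b \<in> blocks \<Longrightarrow> finite (pts b)" "b \<in> blocks \<Longrightarrow> pts b \<noteq> {}" "b \<in> blocks \<Longrightarrow> 0 < dm b"
  by (auto simp: blocks_def pts_def dm_def)

lemma block_admissible: "b \<in> blocks \<Longrightarrow> admissible (pts b) (dm b) (cs (pts b) (dm b) (fst (snd (snd b))))"
  using cs_admissible blocksD by simp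

lemma frm_form: "b \<in> blocks \<Longrightarrow> semi_inner_product UNIV (frm b)"
  unfolding frm_def by (rule admissible_form[OF block_admissible])

lemma sq_ge: "b \<in> blocks \<Longrightarrow> sqsum (cells b) f \<le> sq b f"
  unfolding sq_def frm_def by (rule admissible_ge[OF block_admissible])

lemma sq_nonneg: "b \<in> blocks \<Longrightarrow> 0 \<le> sq b f"
  using semi_inner_product.nonneg[OF frm_form] by (simp add: sq_def)

lemma sq_cong: "(\<And>z. z \<in> cells b \<Longrightarrow> f z = g z) \<Longrightarrow> sq b f = sq b g"
  unfolding sq_def frm_def by (intro arg_cong[where f=Re] hform_cong)

lemma sq_scale: "b \<in> blocks \<Longrightarrow> sq b (\<lambda>z. c * f z) = (cmod c)\<^sup>2 * sq b f"
  using semi_inner_product.norm2_scale[OF frm_form, of b f c]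
  by (simp add: sq_def scaleC_simps)

text \<open>The support of \<open>idx p\<close> gives back the point set, and its value there the
  remaining data: \<open>Suc\<close> keeps that value nonzero, and the point set of a block is
  nonempty.\<close>

lemma inj_idx: "inj_on idx {p. fst p \<in> blocks}"
proof (rule inj_onI)
  fix p q assume "p \<in> {p. fst p \<in> blocks}" "q \<in> {p. fst p \<in> blocks}" and eq: "idx p = idx q"
  then have p: "fst p \<in> blocks" and q: "fst q \<in> blocks" by auto
  have supp: "pts (fst p) = {x. idx p x \<noteq> 0}" for p
    by (auto simp: idx_def simp del: of_nat_Suc)
  have pts: "pts (fst p) = pts (fst q)" unfolding supp eq ..
  obtain x where x: "x \<in> pts (fst p)" using blocksD(2)[OF p] by blast
  have "idx p x = idx q x" using eq by simp
  then have "(snd (fst p), snd p) = (snd (fst q), snd q)"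
    using x pts by (simp add: idx_def del: of_nat_Suc)
  then show "p = q" using pts by (simp add: pts_def prod_eq_iff)
qed

lemma supportedI: "b \<in> blocks \<Longrightarrow> a < dm b \<Longrightarrow> x \<in> pts b \<Longrightarrow> supported x (idx (b, a))"
  unfolding supported_def by blast

lemma crd_asm:
  assumes "b \<in> blocks" "z \<in> cells b"
  shows "crd b (asm G) z = G b z"
proof -
  have "inv_into {p. fst p \<in> blocks} idx (idx (b, snd z)) = (b, snd z)"
    using assms by (intro inv_into_f_f inj_idx) auto
  moreover have "supported (fst z) (idx (b, snd z))" using assms by (auto intro: supportedI)
  ultimately show ?thesis by (simp add: crd_def asm_def)
qed

lemma asm_in_V: "asm G \<in> V"
  by (simp add: V_def asm_def)

lemma asm_in_L: "asm G \<in> L \<longleftrightarrow> (\<lambda>b. sq b (G b)) summable_on blocks"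
  using asm_in_V by (auto simp: L_def crd_asm intro!: summable_on_cong sq_cong)

lemma V_ext:
  assumes "u \<in> V" "v \<in> V" "\<And>b z. b \<in> blocks \<Longrightarrow> z \<in> cells b \<Longrightarrow> crd b u z = crd b v z"
  shows "u = v"
proof (intro ext)
  fix x \<iota>
  show "u x \<iota> = v x \<iota>"
  proof (cases "supported x \<iota>")
    case True
    then obtain b a where "b \<in> blocks" "a < dm b" "x \<in> pts b" "\<iota> = idx (b, a)" by (auto simp: supported_def)
    then show ?thesis using assms(3)[of b "(x, a)"] by (simp add: crd_def)
  qed (use assms in \<open>simp add: V_def\<close>)
qed

lemma crd_add: "crd b (u + v) = crd b u + crd b v"
  by (simp add: crd_def fun_eq_iff)

lemma crd_scale: "crd b (c *\<^sub>C v) = c *\<^sub>C crd b v"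
  by (simp add: crd_def fun_eq_iff scaleC_fun_def)

lemma crd_diff: "crd b (u - v) = crd b u - crd b v"
  by (simp add: crd_def fun_eq_iff)

lemma block_form: "b \<in> blocks \<Longrightarrow> semi_inner_product V (\<lambda>u v. frm b (crd b u) (crd b v))"
proof -
  assume b: "b \<in> blocks"
  interpret semi_inner_product UNIV "frm b" using frm_form[OF b] .
  show ?thesis
  proof
    show "frm b (crd b (u + v)) (crd b w) = frm b (crd b u) (crd b w) + frm b (crd b v) (crd b w)" for u v w
      unfolding crd_add by (rule add_left) auto
    show "frm b (crd b (c *\<^sub>C v)) (crd b w) = c * frm b (crd b v) (crd b w)" for c v w
      unfolding crd_scale by (rule scale_left) auto
    show "frm b (crd b v) (crd b w) = cnj (frm b (crd b w) (crd b v))" for v w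
      by (rule commute) auto
    show "0 \<le> Re (frm b (crd b v) (crd b v))" for v by (rule nonneg) auto
  qed (auto simp: V_def scaleC_simps)
qed

text \<open>Admissible forms dominate the plain square sum, so blockwise Cauchy sequences converge
  at every cell; blocks are finite, so cellwise limits are limits for the forms.\<close>

lemma chilbert_space_L: "chilbert_space L ipL"
proof -
  let ?n = "\<lambda>b. hnorm (\<lambda>u v. frm b (crd b u) (crd b v))"
  have "chilbert_space {v \<in> V. (\<lambda>b. Re (frm b (crd b v) (crd b v))) summable_on blocks}
    (\<lambda>u v. \<Sum>\<^sub>\<infinity>b\<in>blocks. frm b (crd b u) (crd b v))"
  proof (rule chilbert_space_direct_sum[OF _ _ _ block_form])
    fix v assume v: "v \<in> V" and 0: "\<And>b. b \<in> blocks \<Longrightarrow> frm b (crd b v) (crd b v) = 0"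
    show "v = 0"
    proof (rule V_ext[OF v])
      show "0 \<in> V" by (simp add: V_def)
      fix b z assume bz: "b \<in> blocks" "z \<in> cells b"
      have "sqsum (cells b) (crd b v) \<le> 0"
        using sq_ge[OF bz(1), of "crd b v"] 0[OF bz(1)] by (simp add: sq_def)
      then have "sqsum (cells b) (crd b v) = 0" by (intro antisym sum_nonneg) auto
      then have "crd b v z = 0" using blocksD(1)[OF bz(1)] bz(2) by (subst (asm) sum_nonneg_eq_0_iff) auto
      then show "crd b v z = crd b 0 z" by (simp add: crd_def)
    qed
  next
    fix s :: "nat \<Rightarrow> 'x \<Rightarrow> ('x \<Rightarrow> complex) \<Rightarrow> complex"
    assume s: "\<And>n. s n \<in> V" and Cauchy: "\<And>b e. b \<in> blocks \<Longrightarrow> 0 < e \<Longrightarrow>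
      \<exists>N. \<forall>m\<ge>N. \<forall>n\<ge>N. ?n b (s m - s n) < e"
    have conv: "\<exists>l. (\<lambda>n. crd b (s n) z) \<longlonglongrightarrow> l" if b: "b \<in> blocks" and z: "z \<in> cells b" for b z
    proof -
      have le: "cmod (crd b h z) \<le> ?n b h" for h
      proof -
        have "(cmod (crd b h z))\<^sup>2 \<le> sqsum (cells b) (crd b h)"
          using blocksD(1)[OF b] z by (intro member_le_sum[where f="\<lambda>z. (cmod (crd b h z))\<^sup>2"]) auto
        also have "\<dots> \<le> sq b (crd b h)" by (rule sq_ge[OF b])
        finally show ?thesis unfolding hnorm_def sq_def by (rule real_le_rsqrt)
      qed
      have "Cauchy (\<lambda>n. crd b (s n) z)"
      proof (rule CauchyI)
        fix e :: real assume "0 < e"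
        from Cauchy[OF b this] obtain N where
          N: "\<And>m n. m \<ge> N \<Longrightarrow> n \<ge> N \<Longrightarrow> ?n b (s m - s n) < e" by blast
        have "norm (crd b (s m) z - crd b (s n) z) < e" if "m \<ge> N" "n \<ge> N" for m n
          using le[of "s m - s n"] N[OF that] by (simp add: crd_diff)
        then show "\<exists>M. \<forall>m\<ge>M. \<forall>n\<ge>M. norm (crd b (s m) z - crd b (s n) z) < e" by blast
      qed
      then show ?thesis by (simp add: Cauchy_convergent_iff convergent_def)
    qed
    then obtain l0 where l0: "\<And>b z. b \<in> blocks \<Longrightarrow> z \<in> cells b \<Longrightarrow> (\<lambda>n. crd b (s n) z) \<longlonglongrightarrow> l0 b z"
      by metis
    have "(\<lambda>n. ?n b (s n - asm l0)) \<longlonglongrightarrow> 0" if b: "b \<in> blocks" for b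
    proof -
      have "(\<lambda>n. crd b (s n - asm l0) z) \<longlonglongrightarrow> 0" if "z \<in> cells b" for z
        using LIM_zero[OF l0[OF b that]] by (simp add: crd_diff crd_asm[OF b that])
      then have "(\<lambda>n. frm b (crd b (s n - asm l0)) (crd b (s n - asm l0))) \<longlonglongrightarrow> frm b (\<lambda>_. 0) (\<lambda>_. 0)"
        unfolding frm_def by (intro hform_tendsto tendsto_const)
      moreover have "frm b (\<lambda>_. 0) (\<lambda>_. 0) = 0" by (simp add: frm_def hform_def)
      ultimately have "(\<lambda>n. sqrt (Re (frm b (crd b (s n - asm l0)) (crd b (s n - asm l0))))) \<longlonglongrightarrow> sqrt (Re 0)"
        by (intro tendsto_real_sqrt tendsto_Re) simp
      then show ?thesis by (simp add: hnorm_def)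
    qed
    then show "\<exists>l\<in>V. \<forall>b\<in>blocks. (\<lambda>n. ?n b (s n - l)) \<longlonglongrightarrow> 0"
      using asm_in_V by blast
  qed (auto simp: V_def scaleC_simps)
  then show ?thesis by (simp add: L_def ipL_def[abs_def] sq_def)
qed

sublocale L: chilbert_space L ipL
  by (rule chilbert_space_L)

lemma L_norm: "h \<in> L \<Longrightarrow> (hnorm ipL h)\<^sup>2 = (\<Sum>\<^sub>\<infinity>b\<in>blocks. sq b (crd b h))"
proof -
  assume h: "h \<in> L"
  have "frm b (crd b h) (crd b h) = of_real (sq b (crd b h))" if "b \<in> blocks" for b
    using semi_inner_product.self_real[OF frm_form[OF that], of "crd b h"] by (simp add: sq_def)
  then have "ipL h h = (\<Sum>\<^sub>\<infinity>b\<in>blocks. of_real (sq b (crd b h)))"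
    unfolding ipL_def by (intro infsum_cong)
  also have "\<dots> = of_real (\<Sum>\<^sub>\<infinity>b\<in>blocks. sq b (crd b h))"
    using h by (intro infsumI has_sum_of_real has_sum_infsum) (simp add: L_def)
  finally show ?thesis using h by (simp add: L.hnorm_power2)
qed

text \<open>The lower bound in \<open>admissible\<close> makes the sum of squared coordinates at
  \<open>x\<close> at most the squared norm, so evaluations have norm at most 1.\<close>

lemma evaluation_bounded: "bounded_op L ipL (ell2 UNIV) (ell2_ip UNIV) (\<lambda>h. h x)"
proof -
  have partial: "sqsum F (h x) \<le> (hnorm ipL h)\<^sup>2" if h: "h \<in> L" and F: "finite F" for h F
  proof -
    define F' where "F' = {\<iota> \<in> F. supported x \<iota>}"
    \<comment> \<open>Finitely many supported indices involve finitely many blocks, each with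
      \<open>x\<close> among its points.\<close>
    have "F' \<subseteq> idx ` {p. fst p \<in> blocks \<and> snd p < dm (fst p) \<and> x \<in> pts (fst p)}"
      by (force simp: F'_def supported_def)
    from finite_subset_image[OF _ this] F obtain D where D: "finite D" "F' = idx ` D"
      "\<And>p. p \<in> D \<Longrightarrow> fst p \<in> blocks \<and> snd p < dm (fst p) \<and> x \<in> pts (fst p)"
      by (auto simp: F'_def subset_iff)
    define B where "B = fst ` D"
    have B: "finite B" "B \<subseteq> blocks" "\<And>b. b \<in> B \<Longrightarrow> x \<in> pts b" using D(1,3) by (auto simp: B_def)
    have "sqsum F (h x) = sqsum F' (h x)"
      using F h by (intro sum.mono_neutral_right) (auto simp: F'_def L_def V_def)
    also have "\<dots> = sqsum D (\<lambda>p. h x (idx p))"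
      unfolding D(2) using D(3) by (intro sum.reindex[unfolded comp_def] inj_on_subset[OF inj_idx]) auto
    also have "\<dots> \<le> sqsum (SIGMA b:B. {..<dm b}) (\<lambda>p. h x (idx p))"
      using B(1) D(3) by (intro sum_mono2) (force simp: B_def)+
    also have "\<dots> = (\<Sum>b\<in>B. \<Sum>a<dm b. (cmod (h x (idx (b, a))))\<^sup>2)"
      using B(1) by (simp add: sum.Sigma case_prod_beta)
    also have "\<dots> \<le> (\<Sum>b\<in>B. sq b (crd b h))"
    proof (rule sum_mono)
      fix b assume b: "b \<in> B"
      have "sqsum {..<dm b} (\<lambda>a. h x (idx (b, a))) = (\<Sum>z\<in>{x} \<times> {..<dm b}. (cmod (crd b h z))\<^sup>2)"
        by (rule sum.reindex_bij_witness[where i=snd and j="\<lambda>a. (x, a)"]) (auto simp: crd_def)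
      also have "\<dots> \<le> sqsum (cells b) (crd b h)"
      proof (rule sum_mono2)
        show "finite (cells b)" using b B(2) blocksD(1)[of b] by auto
        show "{x} \<times> {..<dm b} \<subseteq> cells b" using B(3)[OF b] by blast
      qed simp
      also have "\<dots> \<le> sq b (crd b h)" using b B(2) by (intro sq_ge) blast
      finally show "sqsum {..<dm b} (\<lambda>a. h x (idx (b, a))) \<le> sq b (crd b h)" .
    qed
    also have "\<dots> \<le> (\<Sum>\<^sub>\<infinity>b\<in>blocks. sq b (crd b h))"
      using B(1,2) h by (intro finite_sum_le_infsum sq_nonneg) (auto simp: L_def)
    finally show ?thesis by (simp add: L_norm[OF h])
  qed
  have summ: "(\<lambda>\<iota>. (cmod (h x \<iota>))\<^sup>2) summable_on UNIV" if "h \<in> L" for h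
    using partial[OF that] by (intro nonneg_bdd_above_summable_on bdd_aboveI2) auto
  then have mem: "h x \<in> ell2 UNIV" if "h \<in> L" for h using that by (simp add: ell2_def)
  have "hnorm (ell2_ip UNIV) (h x) \<le> 1 * hnorm ipL h" if h: "h \<in> L" for h
  proof -
    have "(hnorm (ell2_ip UNIV) (h x))\<^sup>2 \<le> (hnorm ipL h)\<^sup>2"
      unfolding ell2_norm[OF mem[OF h]] using partial[OF h] by (intro infsum_le_finite_sums summ[OF h]) auto
    then have "hnorm (ell2_ip UNIV) (h x) \<le> hnorm ipL h"
      using L.hnorm_nonneg[OF h] by (rule power2_le_imp_le)
    then show ?thesis by simp
  qed
  then show ?thesis unfolding bounded_op_def using mem by (auto simp: scaleC_fun_def intro!: exI[of _ 1])
qed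

section \<open>Multipliers\<close>

text \<open>A bound on each summand separately, which mediates between bounds for approximating nets
  and operator norms.\<close>

definition blockwise :: "(nat \<Rightarrow> nat \<Rightarrow> 'x \<Rightarrow> complex) \<Rightarrow> nat \<Rightarrow> real \<Rightarrow> bool" where
  "blockwise F n C \<longleftrightarrow> (\<forall>b\<in>blocks. \<forall>f. (\<Sum>i<n. sq b (act F {..<n} f i)) \<le> C\<^sup>2 * (\<Sum>j<n. sq b (f j)))"

lemma blockwise_one:
  "blockwise (\<lambda>_ _. f) 1 C \<longleftrightarrow> (\<forall>b\<in>blocks. \<forall>g. sq b (\<lambda>z. f (fst z) * g z) \<le> C\<^sup>2 * sq b g)"
proof -
  have "act (\<lambda>_ _. f) {..<1::nat} g i = (\<lambda>z. f (fst z) * g 0 z)" for g and i :: nat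
    by (simp add: act_def fun_eq_iff)
  then have "blockwise (\<lambda>_ _. f) 1 C \<longleftrightarrow>
      (\<forall>b\<in>blocks. \<forall>g :: nat \<Rightarrow> _. sq b (\<lambda>z. f (fst z) * g 0 z) \<le> C\<^sup>2 * sq b (g 0))"
    by (simp add: blockwise_def)
  also have "\<dots> \<longleftrightarrow> (\<forall>b\<in>blocks. \<forall>g. sq b (\<lambda>z. f (fst z) * g z) \<le> C\<^sup>2 * sq b g)"
  proof -
    have "(\<forall>g :: nat \<Rightarrow> 'x \<times> nat \<Rightarrow> complex. P (g 0)) \<longleftrightarrow> (\<forall>g. P g)" for P
    proof
      assume *: "\<forall>g :: nat \<Rightarrow> 'x \<times> nat \<Rightarrow> complex. P (g 0)"
      show "\<forall>g. P g"
      proof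
        fix g show "P g" using spec[OF *, of "\<lambda>_. g"] by simp
      qed
    qed simp
    then show ?thesis by (intro ball_cong refl)
  qed
  finally show ?thesis .
qed

lemma blockwise_cong:
  assumes "\<And>i j. i < n \<Longrightarrow> j < n \<Longrightarrow> F i j = F' i j"
  shows "blockwise F n C \<longleftrightarrow> blockwise F' n C"
proof -
  have "(\<Sum>i<n. sq b (act F {..<n} f i)) = (\<Sum>i<n. sq b (act F' {..<n} f i))" for b f
    using assms by (intro sum.cong refl arg_cong[where f="sq b"] ext) (simp add: act_def)
  then show ?thesis by (simp add: blockwise_def)
qed

lemma blockwise_mono:
  assumes "blockwise F n C" "0 \<le> C" "C \<le> C'"
  shows "blockwise F n C'"
  unfolding blockwise_def
proof (intro ballI allI)
  fix b f assume b: "b \<in> blocks"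
  have "(\<Sum>i<n. sq b (act F {..<n} f i)) \<le> C\<^sup>2 * (\<Sum>j<n. sq b (f j))"
    using assms(1) b by (simp add: blockwise_def)
  also have "\<dots> \<le> C'\<^sup>2 * (\<Sum>j<n. sq b (f j))"
    using assms b by (intro mult_right_mono power_mono sum_nonneg sq_nonneg) auto
  finally show "(\<Sum>i<n. sq b (act F {..<n} f i)) \<le> C'\<^sup>2 * (\<Sum>j<n. sq b (f j))" .
qed

lemma blockwise_of_bpw_bound:
  assumes n: "0 < n" and F: "F \<in> carrier_mat n n" and C: "C \<in> bpw_bounds A nrm F"
  shows "0 \<le> C \<and> blockwise (\<lambda>i j. F $$ (i, j)) n C"
proof -
  from C obtain I :: "('x set \<times> nat) set" and prec \<Phi> where net: "bounded_approx_net A nrm F C I prec \<Phi>"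
    unfolding bpw_bounds_def by blast
  have dir: "directed_set I prec"
    and \<Phi>: "\<And>i. i \<in> I \<Longrightarrow> \<Phi> i \<in> mats n A" "\<And>i. i \<in> I \<Longrightarrow> nrm (\<Phi> i) \<le> C"
    and lim: "\<And>j k x. j < n \<Longrightarrow> k < n \<Longrightarrow> net_tendsto I prec (\<lambda>i. (\<Phi> i $$ (j, k)) x) ((F $$ (j, k)) x)"
    using net by (simp_all add: bounded_approx_net_def carrier_matD(1)[OF F])
  obtain i0 where i0: "i0 \<in> I" using dir by (auto simp: directed_set_def)
  have refl: "prec i i" if "i \<in> I" for i using dir that by (simp add: directed_set_def)
  \<comment> \<open>The net as a filter, so that limit theorems for filters apply.\<close>
  define tail where "tail = (INF i\<in>I. principal {l \<in> I. prec i l})"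
  have ev_tail: "eventually P tail \<longleftrightarrow> (\<exists>i\<in>I. \<forall>l\<in>I. prec i l \<longrightarrow> P l)" for P
    unfolding tail_def
  proof (subst eventually_INF_base)
    fix i j assume "i \<in> I" "j \<in> I"
    then obtain k where k: "k \<in> I" "prec i k" "prec j k" using dir unfolding directed_set_def by meson
    have sub: "prec i l \<and> prec j l" if "l \<in> I" "prec k l" for l
      using dir that k \<open>i \<in> I\<close> \<open>j \<in> I\<close> unfolding directed_set_def by meson
    then show "\<exists>k\<in>I. principal {l \<in> I. prec k l} \<le> inf (principal {l \<in> I. prec i l}) (principal {l \<in> I. prec j l})"
      using sub by (intro bexI[OF _ k(1)]) auto
  next
    show "I \<noteq> {}" using i0 by blast
    show "(\<exists>i\<in>I. eventually P (principal {l \<in> I. prec i l})) \<longleftrightarrow> (\<exists>i\<in>I. \<forall>l\<in>I. prec i l \<longrightarrow> P l)"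
      unfolding eventually_principal by blast
  qed
  have conv: "((\<lambda>l. (\<Phi> l $$ (j, k)) x) \<longlongrightarrow> (F $$ (j, k)) x) tail" if "j < n" "k < n" for j k x
    using lim[OF that] by (simp add: tendsto_iff ev_tail net_tendsto_def)
  from i0 have C0: "0 \<le> C" using \<Phi> nrm_nonneg[OF n] by (meson order_trans)
  have bound: "(\<Sum>k<n. sq b (act (\<lambda>i j. G $$ (i, j)) {..<n} f k)) \<le> C\<^sup>2 * (\<Sum>k<n. sq b (f k))"
    if G: "G \<in> mats n A" "nrm G \<le> C" and b: "b \<in> blocks" for G b f
  proof (cases "C = 0")
    \<comment> \<open>Rescaling to norm 1 is impossible here, but \<open>G\<close> is 0 by
      definiteness of the norm.\<close>
    case True
    then have "nrm G = 0" using G nrm_nonneg[OF n G(1)] by simp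
    then have "G = 0\<^sub>m n n" using nrm_eq_0_iff[OF n G(1)] by simp
    then have "sq b (act (\<lambda>i j. G $$ (i, j)) {..<n} f k) = 0" if "k < n" for k
      using that by (simp add: act_def sq_def frm_def hform_def)
    then show ?thesis using True by simp
  next
    case False
    have Cpos: "0 < C" using C0 False by simp
    define H where "H = (\<lambda>x::'x. complex_of_real (1 / C)) \<cdot>\<^sub>m G"
    have H: "H \<in> mats n A" unfolding H_def by (rule scale_in_mats[OF G(1)])
    have "nrm H = 1 / C * nrm G"
      unfolding H_def using nrm_scale[OF n G(1), of "complex_of_real (1 / C)"] Cpos
      by (simp add: norm_divide)
    also have "\<dots> \<le> 1" using Cpos G(2) by (simp add: field_simps)
    finally have "contractive {..<n} {..<n} (\<lambda>i j. H $$ (i, j))" using contractive_mat[OF n H] by simp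
    from admissible_contractive[OF block_admissible[OF b] this, of "\<lambda>k z. of_real C * f k z"]
    have "(\<Sum>k<n. sq b (act (\<lambda>i j. H $$ (i, j)) {..<n} (\<lambda>k z. of_real C * f k z) k))
        \<le> (\<Sum>k<n. sq b (\<lambda>z. of_real C * f k z))" by (simp add: sq_def frm_def)
    moreover have "act (\<lambda>i j. H $$ (i, j)) {..<n} (\<lambda>k z. of_real C * f k z) k = act (\<lambda>i j. G $$ (i, j)) {..<n} f k"
      if "k < n" for k
      using that matsD(1)[OF G(1)] Cpos by (auto simp: act_def H_def fun_eq_iff intro!: sum.cong)
    ultimately show ?thesis using b by (simp add: sq_scale sum_distrib_left)
  qed
  have "blockwise (\<lambda>i j. F $$ (i, j)) n C"
    unfolding blockwise_def
  proof (intro ballI allI)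
    fix b f assume b: "b \<in> blocks"
    have "((\<lambda>l. \<Sum>k<n. sq b (act (\<lambda>i j. \<Phi> l $$ (i, j)) {..<n} f k))
        \<longlongrightarrow> (\<Sum>k<n. sq b (act (\<lambda>i j. F $$ (i, j)) {..<n} f k))) tail"
      unfolding sq_def frm_def act_def
      by (intro tendsto_sum tendsto_Re hform_tendsto tendsto_mult tendsto_const conv) auto
    then show "(\<Sum>k<n. sq b (act (\<lambda>i j. F $$ (i, j)) {..<n} f k)) \<le> C\<^sup>2 * (\<Sum>k<n. sq b (f k))"
    proof (rule tendsto_upperbound)
      show "\<forall>\<^sub>F l in tail. (\<Sum>k<n. sq b (act (\<lambda>i j. \<Phi> l $$ (i, j)) {..<n} f k)) \<le> C\<^sup>2 * (\<Sum>k<n. sq b (f k))"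
        unfolding ev_tail using i0 bound[OF \<Phi> b] by blast
      show "tail \<noteq> bot"
        using ev_tail[of "\<lambda>_. False"] refl by (auto simp: trivial_limit_def)
    qed
  qed
  then show ?thesis using C0 by blast
qed

text \<open>Tested on the rows of the identity matrix, the block bound for \<open>F\<close> divided
  by \<open>C\<close> is the hypothesis of \<open>admissible_separation\<close> for the forms of the
  chosen sequence.\<close>

lemma approximation_of_blockwise:
  assumes n: "0 < n" and C: "0 < C" and bw: "blockwise F n C" and S: "finite S" and \<epsilon>: "0 < \<epsilon>"
  shows "\<exists>G\<in>mats n A. nrm G \<le> C \<and> (\<forall>x\<in>S. \<forall>i<n. \<forall>j<n. cmod ((G $$ (i, j)) x - F i j x) < \<epsilon>)"
proof -
  \<comment> \<open>Blocks have nonempty point sets, so an arbitrary point is added in case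
    \<open>S\<close> is empty.\<close>
  define S' where "S' = insert undefined S"
  have S': "finite S'" "S' \<noteq> {}" using S by (auto simp: S'_def)
  let ?Z = "S' \<times> {..<n}"
  define e where "e = (\<lambda>i z :: 'x \<times> nat. if snd z = i then 1 else 0 :: complex)"
  define g where "g = (\<lambda>i z. F i (snd z) (fst z) / of_real C)"
  have seq: "(\<Sum>i<n. Re (hform ?Z (cs S' n r) (g i) (g i))) \<le> (\<Sum>i<n. Re (hform ?Z (cs S' n r) (e i) (e i)))" for r
  proof -
    let ?b = "(S', n, r, 0)"
    have b: "?b \<in> blocks" using S' n by (simp add: blocks_def)
    have "(\<Sum>i<n. sq ?b (act F {..<n} e i)) \<le> C\<^sup>2 * (\<Sum>i<n. sq ?b (e i))"
      using bw b by (simp add: blockwise_def)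
    moreover have "sq ?b (act F {..<n} e i) = C\<^sup>2 * sq ?b (g i)" for i
    proof -
      have "sq ?b (act F {..<n} e i) = sq ?b (\<lambda>z. of_real C * g i z)"
      proof (rule sq_cong)
        fix z assume z: "z \<in> cells ?b"
        have "act F {..<n} e i z = (\<Sum>k<n. if k = snd z then F i (snd z) (fst z) else 0)"
          unfolding act_def e_def by (intro sum.cong) auto
        then show "act F {..<n} e i z = of_real C * g i z"
          using z C by (auto simp: g_def dm_def)
      qed
      then show ?thesis using b by (simp add: sq_scale)
    qed
    ultimately have "C\<^sup>2 * (\<Sum>i<n. sq ?b (g i)) \<le> C\<^sup>2 * (\<Sum>i<n. sq ?b (e i))"
      by (simp add: sum_distrib_left)
    then have "(\<Sum>i<n. sq ?b (g i)) \<le> (\<Sum>i<n. sq ?b (e i))" using C by simp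
    then show ?thesis by (simp add: sq_def frm_def pts_def dm_def)
  qed
  \<comment> \<open>Density extends the inequality from the sequence to every admissible form: both
    sides are continuous in finitely many coefficients.\<close>
  have adm: "(\<Sum>i<n. Re (hform ?Z c (g i) (g i))) \<le> (\<Sum>i<n. Re (hform ?Z c (e i) (e i)))"
    if c: "admissible S' n c" for c
  proof -
    have "\<exists>r. \<forall>z\<in>?Z. \<forall>w\<in>?Z. cmod (cs S' n r z w - c z w) < 1 / Suc t" for t
      by (rule cs_dense[OF S'(1) c]) simp
    then obtain r where r: "\<And>t z w. z \<in> ?Z \<Longrightarrow> w \<in> ?Z \<Longrightarrow> cmod (cs S' n (r t) z w - c z w) < 1 / Suc t" by metis
    have conv: "(\<lambda>t. cs S' n (r t) z w) \<longlonglongrightarrow> c z w" if "z \<in> ?Z" "w \<in> ?Z" for z w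
      using r[OF that] by (intro LIMSEQ_of_dist_bound) (simp add: dist_norm)
    have "(\<lambda>t. \<Sum>i<n. Re (hform ?Z (cs S' n (r t)) (h i) (h i))) \<longlonglongrightarrow> (\<Sum>i<n. Re (hform ?Z c (h i) (h i)))" for h
      by (intro tendsto_sum tendsto_Re hform_tendsto tendsto_const conv)
    from this[of g] this[of e] seq show ?thesis by (intro LIMSEQ_le) auto
  qed
  have "\<exists>G\<in>mats n A. nrm G \<le> 1 \<and>
      (\<forall>x\<in>S'. \<forall>i<n. \<forall>j<n. cmod ((G $$ (i, j)) x - F i j x / of_real C) < \<epsilon> / C)"
    using adm C \<epsilon> unfolding e_def g_def
    by (intro admissible_separation[OF S'(1) n, of "\<lambda>i j x. F i j x / of_real C"]) auto
  then obtain G where G: "G \<in> mats n A" "nrm G \<le> 1"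
    "\<And>x i j. x \<in> S \<Longrightarrow> i < n \<Longrightarrow> j < n \<Longrightarrow> cmod ((G $$ (i, j)) x - F i j x / of_real C) < \<epsilon> / C"
    by (auto simp: S'_def)
  define H where "H = (\<lambda>x::'x. complex_of_real C) \<cdot>\<^sub>m G"
  have "H \<in> mats n A" unfolding H_def by (rule scale_in_mats[OF G(1)])
  moreover have "nrm H \<le> C"
    unfolding H_def using nrm_scale[OF n G(1), of "complex_of_real C"] C G(2) by simp
  moreover have "cmod ((H $$ (i, j)) x - F i j x) < \<epsilon>" if "x \<in> S" "i < n" "j < n" for x i j
  proof -
    have "(H $$ (i, j)) x - F i j x = of_real C * ((G $$ (i, j)) x - F i j x / of_real C)"
      using that matsD(1)[OF G(1)] C by (auto simp: H_def right_diff_distrib)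
    then have "cmod ((H $$ (i, j)) x - F i j x) = C * cmod ((G $$ (i, j)) x - F i j x / of_real C)"
      using C by (simp add: norm_mult)
    also have "\<dots> < C * (\<epsilon> / C)" using G(3)[OF that] C by (intro mult_strict_left_mono)
    finally show ?thesis using C by simp
  qed
  ultimately show ?thesis by blast
qed

text \<open>The index type allowed in \<open>bpw_bounds\<close> fits exactly: a pair consists of a
  finite set of points and a tolerance for the approximation there.\<close>

lemma bpw_bound_of_blockwise:
  assumes n: "0 < n" and C: "0 < C" and F: "F \<in> carrier_mat n n" and bw: "blockwise (\<lambda>i j. F $$ (i, j)) n C"
  shows "C \<in> bpw_bounds A nrm F"
proof -
  define I :: "('x set \<times> nat) set" where "I = {p. finite (fst p)}"
  define prec :: "'x set \<times> nat \<Rightarrow> 'x set \<times> nat \<Rightarrow> bool"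
    where "prec p q \<longleftrightarrow> fst p \<subseteq> fst q \<and> snd p \<le> snd q" for p q
  have "\<exists>G\<in>mats n A. nrm G \<le> C \<and>
      (\<forall>x\<in>fst p. \<forall>i<n. \<forall>j<n. cmod ((G $$ (i, j)) x - (F $$ (i, j)) x) < 1 / Suc (snd p))"
    if "p \<in> I" for p
    using that by (intro approximation_of_blockwise[OF n C bw]) (auto simp: I_def)
  then obtain \<Phi> where \<Phi>: "\<And>p. p \<in> I \<Longrightarrow> \<Phi> p \<in> mats n A" "\<And>p. p \<in> I \<Longrightarrow> nrm (\<Phi> p) \<le> C"
    "\<And>p x i j. p \<in> I \<Longrightarrow> x \<in> fst p \<Longrightarrow> i < n \<Longrightarrow> j < n \<Longrightarrow>
      cmod ((\<Phi> p $$ (i, j)) x - (F $$ (i, j)) x) < 1 / Suc (snd p)" by metis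
  have "directed_set I prec"
    unfolding directed_set_def
  proof (intro conjI ballI impI)
    have "({}, 0) \<in> I" by (simp add: I_def)
    then show "I \<noteq> {}" by blast
  next
    fix p q assume pq: "p \<in> I" "q \<in> I"
    have "(fst p \<union> fst q, max (snd p) (snd q)) \<in> I" using pq by (simp add: I_def)
    then show "\<exists>r\<in>I. prec p r \<and> prec q r" by (rule bexI[rotated]) (auto simp: prec_def)
  qed (auto simp: prec_def)
  moreover have "net_tendsto I prec (\<lambda>p. (\<Phi> p $$ (j, k)) x) ((F $$ (j, k)) x)" if jk: "j < n" "k < n" for j k x
    unfolding net_tendsto_def
  proof (intro allI impI)
    fix e :: real assume "0 < e"
    then obtain m where m: "1 / Suc m < e" using nat_approx_posE by blast
    have "dist ((\<Phi> q $$ (j, k)) x) ((F $$ (j, k)) x) < e" if q: "q \<in> I" "prec ({x}, m) q" for q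
    proof -
      have "dist ((\<Phi> q $$ (j, k)) x) ((F $$ (j, k)) x) < 1 / Suc (snd q)"
        using \<Phi>(3)[OF q(1) _ jk, of x] q(2) by (simp add: dist_norm prec_def)
      also have "\<dots> \<le> 1 / Suc m" using q(2) by (simp add: prec_def frac_le)
      finally show ?thesis using m by simp
    qed
    then show "\<exists>p\<in>I. \<forall>q\<in>I. prec p q \<longrightarrow> dist ((\<Phi> q $$ (j, k)) x) ((F $$ (j, k)) x) < e"
      by (intro bexI[of _ "({x}, m)"]) (auto simp: I_def)
  qed
  ultimately have "bounded_approx_net A nrm F C I prec \<Phi>"
    unfolding bounded_approx_net_def using F \<Phi>(1,2) by auto
  then show ?thesis unfolding bpw_bounds_def by blast
qed

section \<open>Block bounds and operator norms\<close>

lemma crd_mult: "crd b (\<Sum>j<n. mult_op (F i j) (h j)) = act F {..<n} (\<lambda>j. crd b (h j)) i"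
  for n :: nat
  by (simp add: fun_eq_iff crd_def act_def fun_sum_apply mult_op_def scaleC_simps)

text \<open>Multiplication preserves the blocks, so the bound on each block may be summed over all
  of them.\<close>

lemma multiplication_bound:
  assumes bw: "blockwise F n C" and h: "\<And>j. j < n \<Longrightarrow> h j \<in> L"
  shows "i < n \<Longrightarrow> (\<Sum>j<n. mult_op (F i j) (h j)) \<in> L"
    and "(\<Sum>i<n. (hnorm ipL (\<Sum>j<n. mult_op (F i j) (h j)))\<^sup>2) \<le> C\<^sup>2 * (\<Sum>j<n. (hnorm ipL (h j))\<^sup>2)"
proof -
  define y where "y i = (\<Sum>j<n. mult_op (F i j) (h j))" for i
  have summ: "(\<lambda>b. C\<^sup>2 * (\<Sum>j<n. sq b (crd b (h j)))) summable_on blocks"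
    using h by (intro summable_on_cmult_right summable_on_finite_sum) (auto simp: L_def)
  have le: "(\<Sum>i<n. sq b (crd b (y i))) \<le> C\<^sup>2 * (\<Sum>j<n. sq b (crd b (h j)))" if "b \<in> blocks" for b
    using bw that unfolding y_def crd_mult by (simp add: blockwise_def)
  have "y i \<in> V" for i
    using h unfolding V_def y_def
    by (auto simp: fun_sum_apply mult_op_def scaleC_simps L_def V_def intro!: sum.neutral)
  moreover have "(\<lambda>b. sq b (crd b (y i))) summable_on blocks" if i: "i < n" for i
  proof (rule summable_on_comparison_test[OF summ])
    fix b assume b: "b \<in> blocks"
    have "sq b (crd b (y i)) \<le> (\<Sum>i<n. sq b (crd b (y i)))"
      using i b by (intro member_le_sum[where f="\<lambda>i. sq b (crd b (y i))"] sq_nonneg) auto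
    then show "sq b (crd b (y i)) \<le> C\<^sup>2 * (\<Sum>j<n. sq b (crd b (h j)))" using le[OF b] by linarith
  qed (rule sq_nonneg)
  ultimately have yL: "y i \<in> L" if "i < n" for i using that by (simp add: L_def)
  then show "i < n \<Longrightarrow> (\<Sum>j<n. mult_op (F i j) (h j)) \<in> L" by (simp add: y_def)
  have "(\<Sum>i<n. (hnorm ipL (y i))\<^sup>2) = (\<Sum>i<n. \<Sum>\<^sub>\<infinity>b\<in>blocks. sq b (crd b (y i)))"
    using yL by (simp add: L_norm)
  also have "\<dots> = (\<Sum>\<^sub>\<infinity>b\<in>blocks. \<Sum>i<n. sq b (crd b (y i)))"
    using yL by (intro infsum_finite_sum[symmetric]) (auto simp: L_def)
  also have "\<dots> \<le> (\<Sum>\<^sub>\<infinity>b\<in>blocks. C\<^sup>2 * (\<Sum>j<n. sq b (crd b (h j))))"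
    using yL by (intro infsum_mono summ le summable_on_finite_sum) (auto simp: L_def)
  also have "\<dots> = C\<^sup>2 * (\<Sum>\<^sub>\<infinity>b\<in>blocks. \<Sum>j<n. sq b (crd b (h j)))" by (rule infsum_cmult_right')
  also have "(\<Sum>\<^sub>\<infinity>b\<in>blocks. \<Sum>j<n. sq b (crd b (h j))) = (\<Sum>j<n. \<Sum>\<^sub>\<infinity>b\<in>blocks. sq b (crd b (h j)))"
    using h by (intro infsum_finite_sum) (auto simp: L_def)
  also have "\<dots> = (\<Sum>j<n. (hnorm ipL (h j))\<^sup>2)" using h by (simp add: L_norm)
  finally show "(\<Sum>i<n. (hnorm ipL (\<Sum>j<n. mult_op (F i j) (h j)))\<^sup>2) \<le> C\<^sup>2 * (\<Sum>j<n. (hnorm ipL (h j))\<^sup>2)"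
    by (simp add: y_def)
qed

text \<open>Each block embeds isometrically into \<open>L\<close> by extension with 0, and
  multiplication commutes with the embedding; the bound is tested on embedded tuples.\<close>

lemma blockwise_of_multiplication_bound:
  assumes "\<And>h. (\<And>j. j < n \<Longrightarrow> h j \<in> L) \<Longrightarrow>
    (\<Sum>i<n. (hnorm ipL (\<Sum>j<n. mult_op (F i j) (h j)))\<^sup>2) \<le> C\<^sup>2 * (\<Sum>j<n. (hnorm ipL (h j))\<^sup>2)"
  shows "blockwise F n C"
  unfolding blockwise_def
proof (intro ballI allI)
  fix b f assume b: "b \<in> blocks"
  define emb where "emb g = asm (\<lambda>b'. if b' = b then g else (\<lambda>_. 0))" for g
  have sq0: "sq b' (\<lambda>_. 0) = 0" for b' by (simp add: sq_def frm_def hform_def)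
  have emb_sum: "((\<lambda>b'. sq b' (if b' = b then g else (\<lambda>_. 0))) has_sum sq b g) blocks" for g
  proof -
    have "((\<lambda>b'. sq b' (if b' = b then g else (\<lambda>_. 0))) has_sum sq b g) {b}"
      using has_sum_finite[of "{b}" "\<lambda>b'. sq b' (if b' = b then g else (\<lambda>_. 0))"] by simp
    then show ?thesis
      using b by (subst has_sum_cong_neutral[where T="{b}"]) (auto simp: sq0)
  qed
  have emb_L: "emb g \<in> L" for g
    unfolding emb_def asm_in_L using emb_sum by (rule has_sum_imp_summable)
  have emb_norm: "(hnorm ipL (emb g))\<^sup>2 = sq b g" for g
  proof -
    have "(hnorm ipL (emb g))\<^sup>2 = (\<Sum>\<^sub>\<infinity>b'\<in>blocks. sq b' (if b' = b then g else (\<lambda>_. 0)))"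
      unfolding L_norm[OF emb_L] by (intro infsum_cong sq_cong) (simp add: emb_def crd_asm)
    also have "\<dots> = sq b g" using emb_sum by (rule infsumI)
    finally show ?thesis .
  qed
  have emb_mult: "(\<Sum>j<n. mult_op (F i j) (emb (f j))) = emb (act F {..<n} f i)" for i
  proof (rule V_ext)
    show "(\<Sum>j<n. mult_op (F i j) (emb (f j))) \<in> V"
      using emb_L unfolding V_def
      by (auto simp: fun_sum_apply mult_op_def scaleC_simps L_def V_def intro!: sum.neutral)
    show "emb (act F {..<n} f i) \<in> V" using emb_L by (simp add: L_def)
    fix b' z assume bz: "b' \<in> blocks" "z \<in> cells b'"
    show "crd b' (\<Sum>j<n. mult_op (F i j) (emb (f j))) z = crd b' (emb (act F {..<n} f i)) z"
      unfolding crd_mult[where F=F and i=i and h="\<lambda>j. emb (f j)"]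
      unfolding emb_def act_def crd_asm[OF bz] by simp
  qed
  show "(\<Sum>i<n. sq b (act F {..<n} f i)) \<le> C\<^sup>2 * (\<Sum>j<n. sq b (f j))"
    using assms[of "\<lambda>j. emb (f j)"] emb_L by (simp add: emb_mult emb_norm)
qed

text \<open>A gliding hump: if \<open>f\<close> were unbounded, there would be \<open>g\<^sub>k\<close> in the \<open>k\<close>-th copy of some form
  with \<open>\<parallel>g\<^sub>k\<parallel> < 2\<^sup>-\<^sup>k\<close> and \<open>\<parallel>f g\<^sub>k\<parallel> = 1\<close>, and \<open>f\<close> would not map \<open>\<Sum>\<^sub>k g\<^sub>k \<in> L\<close> into \<open>L\<close>.\<close>

lemma multiplier_blockwise:
  assumes f: "f \<in> multipliers L"
  shows "\<exists>C>0. blockwise (\<lambda>_ _. f) 1 C"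
proof (rule ccontr)
  assume unbdd: "\<not> ?thesis"
  define hump where "hump k b g \<longleftrightarrow> b \<in> blocks \<and> snd (snd (snd b)) = k \<and> sq b g < (1/4) ^ k \<and>
    sq b (\<lambda>z. f (fst z) * g z) = 1" for k b g
  have "\<exists>b g. hump k b g" for k
  proof -
    have "\<not> blockwise (\<lambda>_ _. f) 1 (2 ^ k)" using unbdd by auto
    then obtain b g where b: "b \<in> blocks"
      and big: "(2 ^ k)\<^sup>2 * sq b g < sq b (\<lambda>z. f (fst z) * g z)"
      unfolding blockwise_one by (auto simp: not_le)
    obtain S n r k' where bb: "b = (S, n, r, k')" by (metis prod_cases4)
    \<comment> \<open>The form ignores the copy number, so the block may be replaced by its
      \<open>k\<close>-th copy; this makes the blocks of the humps distinct.\<close>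
    define b' where "b' = (S, n, r, k)"
    have b': "b' \<in> blocks" using b by (simp add: bb b'_def blocks_def)
    have sq_b': "sq b' = sq b" by (simp add: fun_eq_iff sq_def frm_def pts_def dm_def bb b'_def)
    define t where "t = sq b (\<lambda>z. f (fst z) * g z)"
    have t: "0 < t" unfolding t_def
      using big sq_nonneg[OF b, of g] by (meson mult_nonneg_nonneg order_le_less_trans zero_le_power2)
    define g' where "g' z = of_real (1 / sqrt t) * g z" for z
    have c: "(cmod (of_real (1 / sqrt t)))\<^sup>2 = 1 / t" using t by (simp add: norm_divide power_divide)
    have "sq b' g' = 1 / t * sq b g"
      unfolding g'_def sq_b' sq_scale[OF b] c ..
    also have "\<dots> < (1/4) ^ k"
    proof -
      have "(2 ^ k)\<^sup>2 = (4 :: real) ^ k" by (simp add: power2_eq_square flip: power_mult_distrib)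
      then have "4 ^ k * sq b g < t" using big by (simp only: t_def)
      then show ?thesis using t by (simp add: power_divide field_simps)
    qed
    finally have "sq b' g' < (1/4) ^ k" .
    moreover have "sq b' (\<lambda>z. f (fst z) * g' z) = 1"
    proof -
      have "sq b' (\<lambda>z. f (fst z) * g' z) = sq b (\<lambda>z. of_real (1 / sqrt t) * (f (fst z) * g z))"
        unfolding sq_b' g'_def by (simp add: ac_simps)
      also have "\<dots> = 1 / t * t" by (simp only: sq_scale[OF b] c t_def[symmetric])
      finally show ?thesis using t by simp
    qed
    ultimately have "hump k b' g'" using b' by (simp add: hump_def b'_def)
    then show ?thesis by blast
  qed
  then obtain bk gk where "\<And>k. hump k (bk k) (gk k)" by metis
  then have bk: "\<And>k. bk k \<in> blocks" "\<And>k. snd (snd (snd (bk k))) = k"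
    and gk: "\<And>k. sq (bk k) (gk k) < (1/4) ^ k" "\<And>k. sq (bk k) (\<lambda>z. f (fst z) * gk k z) = 1"
    by (simp_all only: hump_def)
  have inj: "inj bk" using bk(2) by (metis injI)
  define G where "G b = (if b \<in> range bk then gk (snd (snd (snd b))) else (\<lambda>_. 0))" for b
  have G_bk: "G (bk k) = gk k" for k by (simp add: G_def bk(2))
  have sq0: "sq b (\<lambda>_. 0) = 0" for b by (simp add: sq_def frm_def hform_def)
  have "(\<lambda>k. sq (bk k) (gk k)) summable_on UNIV"
  proof (rule summable_on_comparison_test)
    have "summable (\<lambda>k. (1/4 :: real) ^ k)" by (rule summable_geometric) simp
    then show "(\<lambda>k. (1/4 :: real) ^ k) summable_on UNIV" by (rule summable_nonneg_imp_summable_on) simp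
  qed (use gk(1) bk(1) in \<open>auto intro: less_imp_le sq_nonneg\<close>)
  then have "(\<lambda>b. sq b (G b)) summable_on range bk"
    using summable_on_reindex[OF inj, of "\<lambda>b. sq b (G b)"] by (simp add: comp_def G_bk)
  then have "(\<lambda>b. sq b (G b)) summable_on blocks"
    by (subst summable_on_cong_neutral[where S=blocks and T="range bk"]) (use bk(1) in \<open>auto simp: G_def sq0\<close>)
  then have "asm G \<in> L" by (simp add: asm_in_L)
  then have "mult_op f (asm G) \<in> L" using f by (auto simp: multipliers_def)
  then have summ: "(\<lambda>b. sq b (crd b (mult_op f (asm G)))) summable_on blocks" by (simp add: L_def)
  have crd1: "sq (bk k) (crd (bk k) (mult_op f (asm G))) = 1" for k
  proof -
    have "sq (bk k) (crd (bk k) (mult_op f (asm G))) = sq (bk k) (\<lambda>z. f (fst z) * gk k z)"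
    proof (rule sq_cong)
      fix z assume z: "z \<in> cells (bk k)"
      have "crd (bk k) (mult_op f (asm G)) z = f (fst z) * crd (bk k) (asm G) z"
        by (simp add: crd_def mult_op_def scaleC_simps)
      then show "crd (bk k) (mult_op f (asm G)) z = f (fst z) * gk k z"
        by (simp add: crd_asm[OF bk(1) z] G_bk)
    qed
    then show ?thesis by (simp add: gk(2))
  qed
  obtain N :: nat where N: "(\<Sum>\<^sub>\<infinity>b\<in>blocks. sq b (crd b (mult_op f (asm G)))) < N" using reals_Archimedean2 by blast
  have "(\<Sum>b\<in>bk ` {..<N}. sq b (crd b (mult_op f (asm G)))) \<le> (\<Sum>\<^sub>\<infinity>b\<in>blocks. sq b (crd b (mult_op f (asm G))))"
    using bk(1) by (intro finite_sum_le_infsum summ sq_nonneg) auto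
  moreover have "(\<Sum>b\<in>bk ` {..<N}. sq b (crd b (mult_op f (asm G)))) = N"
    using inj by (subst sum.reindex) (auto simp: crd1 intro: inj_on_subset)
  ultimately show False using N by simp
qed

lemma multipliers_eq_bpw_completion: "multipliers L = bpw_completion A nrm"
proof (intro equalityI subsetI)
  fix f assume "f \<in> multipliers L"
  from multiplier_blockwise[OF this] obtain C where C: "0 < C" "blockwise (\<lambda>_ _. f) 1 C" by blast
  have "blockwise (\<lambda>i j. mat_of_elem f $$ (i, j)) 1 C"
    using C(2) by (subst blockwise_cong[where F'="\<lambda>_ _. f"]) (auto simp: mat_of_elem_def)
  then have "C \<in> bpw_bounds A nrm (mat_of_elem f)"
    using C(1) by (intro bpw_bound_of_blockwise[of 1]) (auto simp: mat_of_elem_def)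
  then show "f \<in> bpw_completion A nrm" by (auto simp: bpw_completion_def)
next
  fix f assume "f \<in> bpw_completion A nrm"
  then obtain C where "C \<in> bpw_bounds A nrm (mat_of_elem f)" by (auto simp: bpw_completion_def)
  then have "blockwise (\<lambda>i j. mat_of_elem f $$ (i, j)) 1 C"
    using blockwise_of_bpw_bound[of 1 "mat_of_elem f" C] by (simp add: mat_of_elem_def)
  then have bw: "blockwise (\<lambda>_ _. f) 1 C"
    by (subst blockwise_cong[where F'="\<lambda>i j. mat_of_elem f $$ (i, j)"]) (auto simp: mat_of_elem_def)
  have "mult_op f h \<in> L" if "h \<in> L" for h
    using multiplication_bound(1)[OF bw, of "\<lambda>_. h" 0] that by simp
  then show "f \<in> multipliers L" by (auto simp: multipliers_def)
qed

text \<open>Any finite constant will do: its purpose is to make the sets of bounds nonempty, so that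
  their infima are meaningful. The factor \<open>n\<close> comes from Cauchy--Schwarz for a sum of
  \<open>n\<close> vectors.\<close>

lemma blockwise_of_entries:
  assumes "\<And>i j. i < n \<Longrightarrow> j < n \<Longrightarrow> blockwise (\<lambda>_ _. F i j) 1 (C i j)"
  shows "\<exists>C>0. blockwise F n C"
proof -
  define D where "D = 1 + (\<Sum>i<n. \<Sum>j<n. (C i j)\<^sup>2)"
  have D: "1 \<le> D" by (auto simp: D_def intro!: sum_nonneg)
  have "blockwise F n (sqrt (n * D))"
    unfolding blockwise_def
  proof (intro ballI allI)
    fix b f assume b: "b \<in> blocks"
    interpret semi_inner_product UNIV "frm b" using frm_form[OF b] .
    define s where "s = (\<Sum>l<n. sq b (f l))"
    have entry: "sq b (\<lambda>z. F i j (fst z) * f j z) \<le> (C i j)\<^sup>2 * sq b (f j)" if "i < n" "j < n" for i j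
      using assms[OF that] b unfolding blockwise_one by blast
    have "(\<Sum>i<n. sq b (act F {..<n} f i)) \<le> (\<Sum>i<n. n * (\<Sum>j<n. sq b (\<lambda>z. F i j (fst z) * f j z)))"
    proof (rule sum_mono)
      fix i
      have "act F {..<n} f i = (\<Sum>j<n. (\<lambda>z. F i j (fst z) * f j z))"
        by (simp add: act_def fun_eq_iff fun_sum_apply)
      then show "sq b (act F {..<n} f i) \<le> n * (\<Sum>j<n. sq b (\<lambda>z. F i j (fst z) * f j z))"
        using norm2_sum_le[of "{..<n}" "\<lambda>j z. F i j (fst z) * f j z"] by (simp add: sq_def)
    qed
    also have "\<dots> \<le> (\<Sum>i<n. n * (\<Sum>j<n. (C i j)\<^sup>2 * s))"
      unfolding s_def using b
      by (intro sum_mono mult_left_mono order_trans[OF entry] member_le_sum[where f="\<lambda>l. sq b (f l)"] sq_nonneg) auto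
    also have "\<dots> = n * (\<Sum>i<n. \<Sum>j<n. (C i j)\<^sup>2) * s"
      by (simp add: sum_distrib_left sum_distrib_right mult.assoc)
    also have "\<dots> \<le> n * D * s"
      unfolding s_def using b by (intro mult_right_mono mult_left_mono sum_nonneg sq_nonneg) (auto simp: D_def)
    finally show "(\<Sum>i<n. sq b (act F {..<n} f i)) \<le> (sqrt (n * D))\<^sup>2 * (\<Sum>j<n. sq b (f j))"
      using D by (simp add: s_def)
  qed
  \<comment> \<open>Adding 1 makes the constant positive even for \<open>n = 0\<close>.\<close>
  then have "blockwise F n (1 + sqrt (n * D))"
    using D by (elim blockwise_mono) auto
  moreover have "0 < 1 + sqrt (n * D)" using D by (intro add_pos_nonneg) auto
  ultimately show ?thesis by blast
qed

lemma bpw_norm_eq_multiplier_norm: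
  assumes n: "0 < n" and F: "F \<in> mats n (bpw_completion A nrm)"
  shows "bpw_norm A nrm F = multiplier_norm L ipL F"
proof -
  note FD = matsD[OF F]
  let ?F = "\<lambda>i j. F $$ (i, j)"
  let ?B = "bpw_bounds A nrm F"
  define M where "M = {c. 0 \<le> c \<and> blockwise ?F n c}"
  have op: "{c. 0 \<le> c \<and> (\<forall>h. (\<forall>j<dim_col (map_mat mult_op F). h j \<in> L) \<longrightarrow>
     sqrt (\<Sum>i<dim_row (map_mat mult_op F). (hnorm ipL (\<Sum>j<dim_col (map_mat mult_op F).
       (map_mat mult_op F $$ (i, j)) (h j)))\<^sup>2)
       \<le> c * sqrt (\<Sum>j<dim_col (map_mat mult_op F). (hnorm ipL (h j))\<^sup>2))} = M"
    (is "{c. 0 \<le> c \<and> ?P c} = M")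
  proof -
    have "?P c \<longleftrightarrow> blockwise ?F n c" if c: "0 \<le> c" for c
    proof -
      have eq: "sqrt s \<le> c * sqrt t \<longleftrightarrow> s \<le> c\<^sup>2 * t" if "0 \<le> s" "0 \<le> t" for s t
      proof -
        have "c * sqrt t = sqrt (c\<^sup>2 * t)" using c by (simp add: real_sqrt_mult)
        then show ?thesis by simp
      qed
      have "?P c \<longleftrightarrow> (\<forall>h. (\<forall>j<n. h j \<in> L) \<longrightarrow>
          (\<Sum>i<n. (hnorm ipL (\<Sum>j<n. mult_op (?F i j) (h j)))\<^sup>2) \<le> c\<^sup>2 * (\<Sum>j<n. (hnorm ipL (h j))\<^sup>2))"
        using FD(1) by (simp add: eq sum_nonneg)
      then show ?thesis
        using multiplication_bound(2)[of ?F n c] blockwise_of_multiplication_bound[of n ?F c] by blast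
    qed
    then show ?thesis by (auto simp: M_def)
  qed
  have BM: "?B \<subseteq> M" using blockwise_of_bpw_bound[OF n FD(1)] by (auto simp: M_def)
  \<comment> \<open>\<open>c\<close> may be 0, whereas the approximating nets are built for positive
    bounds; the slack \<open>e\<close> disappears in the infimum.\<close>
  have MB: "c + e \<in> ?B" if "c \<in> M" "0 < e" for c e
    using that blockwise_mono[of ?F n c "c + e"] by (intro bpw_bound_of_blockwise[OF n _ FD(1)]) (auto simp: M_def)
  have "\<exists>C. blockwise (\<lambda>_ _. ?F i j) 1 C" if "i < n" "j < n" for i j
    using multiplier_blockwise[of "?F i j"] FD(2)[OF that] by (auto simp: multipliers_eq_bpw_completion)
  then obtain C where "\<And>i j. i < n \<Longrightarrow> j < n \<Longrightarrow> blockwise (\<lambda>_ _. ?F i j) 1 (C i j)" by metis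
  then obtain c where c: "0 < c" "blockwise ?F n c" using blockwise_of_entries[of n ?F C] by blast
  then have M_ne: "M \<noteq> {}" by (auto simp: M_def intro: less_imp_le)
  then have B_ne: "?B \<noteq> {}" using MB[of _ 1] by fastforce
  have bdd: "bdd_below M" by (rule bdd_belowI[of _ 0]) (simp add: M_def)
  have "Inf ?B \<le> Inf M"
  proof (rule cInf_greatest[OF M_ne])
    fix c assume "c \<in> M"
    then have "Inf ?B \<le> c + e" if "0 < e" for e
      using MB that by (intro cInf_lower bdd_below_mono[OF bdd BM]) auto
    then show "Inf ?B \<le> c" by (rule field_le_epsilon)
  qed
  moreover have "Inf M \<le> Inf ?B" by (rule cInf_superset_mono[OF B_ne bdd BM])
  ultimately have "Inf ?B = Inf M" by simp
  then show ?thesis unfolding bpw_norm_def multiplier_norm_def op_mat_norm_def op .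
qed

end

text \<open>The coefficient space consists of the square-summable families indexed by all functions
  on X; the block coordinates occupy the indices \<open>idx p\<close>, and elements of
  \<open>L\<close> vanish at the other indices.\<close>

theorem theorem2p4:
  fixes A :: "('x \<Rightarrow> complex) set"
    and nrm :: "('x \<Rightarrow> complex) mat \<Rightarrow> real"
  assumes "operator_algebra_of_functions A nrm"
  shows "\<exists>(C :: (('x \<Rightarrow> complex) \<Rightarrow> complex) set) ip (K :: 'x \<Rightarrow> 'x \<Rightarrow> _) L ipL.
    chilbert_space C ip \<and>
    positive_definite_kernel C ip K \<and>
    is_kernel_space C ip K L ipL \<and>
    multipliers L = bpw_completion A nrm \<and>
    (\<forall>n>0. \<forall>F\<in>mats n (bpw_completion A nrm). bpw_norm A nrm F = multiplier_norm L ipL F)"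
proof -
  interpret operator_algebra_of_functions A nrm by fact
  define cs where "cs S n = (SOME cs. dense_admissible S n cs)" for S n
  interpret K: admissible_sequences A nrm cs
    by unfold_locales (unfold cs_def, rule someI_ex[OF admissible_sequence_exists])
  obtain K where "positive_definite_kernel (ell2 UNIV) (ell2_ip UNIV) K"
    "is_kernel_space (ell2 UNIV) (ell2_ip UNIV) K K.L K.ipL"
    using kernel_of_bounded_evaluations[OF chilbert_space_ell2 K.chilbert_space_L K.evaluation_bounded] by blast
  then show ?thesis
    using chilbert_space_ell2 K.multipliers_eq_bpw_completion K.bpw_norm_eq_multiplier_norm by blast
qed

end
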